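(* Let $X$ be a full $d$-dimensional shift on a finite alphabet and $\phi:X\to \mathbb R$ be a continuous potential. If $\sum_{n\geq 1} n^{d-1}\mathrm{var}_n\phi<\infty$ then $\phi$ cannot have a freezing phase transition.
   Context: $X=\mathcal A^{\mathbb Z^d}$ with $\mathcal A$ finite and the shift action. $\mathrm{var}_n\phi=\sup\{|\phi(x)-\phi(y)|: x|_{[-n,n]^d\cap\mathbb Z^d}=y|_{[-n,n]^d\cap\mathbb Z^d}\}$. For $\beta\in\mathbb R$, $\mathrm{ES}(\beta\phi)$ is the set of shift-invariant probability measures $\mu$ maximizing $h(\mu)+\beta\int\phi\,d\mu$, where $h$ is measure-theoretic entropy. $\phi$ has a freezing phase transition at $\beta_c$ if $\mathrm{ES}(\beta\phi)=\mathrm{ES}(\beta'\phi)$ for all $\beta,\beta'>\beta_c$ while $\mathrm{ES}(\beta\phi)\ne\mathrm{ES}(\beta'\phi)$ for any $\beta<\beta_c<\beta'$. *)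

theory Defs
  imports "HOL-Probability.Probability"
begin

text \<open>Configurations of the full shift: functions from the lattice Z^d (represented
  as 'd => int for a finite index type 'd, d = CARD('d)) to a finite alphabet 'a.\<close>

type_synonym ('d, 'a) config = "('d \<Rightarrow> int) \<Rightarrow> 'a"

definition shift :: "('d \<Rightarrow> int) \<Rightarrow> ('d, 'a) config \<Rightarrow> ('d, 'a) config" where
  "shift g x = (\<lambda>h. x (\<lambda>i. h i + g i))"

definition shift_space :: "('d, 'a) config measure" where
  "shift_space = PiM UNIV (\<lambda>_. count_space UNIV)"

definition shift_topology :: "('d, 'a) config topology" where
  "shift_topology = product_topology (\<lambda>_. discrete_topology UNIV) UNIV"

definition box :: "nat \<Rightarrow> ('d::finite \<Rightarrow> int) set" where
  "box n = {g. \<forall>i. \<bar>g i\<bar> \<le> int n}"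

definition var :: "nat \<Rightarrow> (('d::finite, 'a) config \<Rightarrow> real) \<Rightarrow> real" where
  "var n \<phi> = Sup {\<bar>\<phi> x - \<phi> y\<bar> | x y. \<forall>g\<in>box n. x g = y g}"

definition invariant_measures :: "('d, 'a) config measure set" where
  "invariant_measures = {\<mu>. prob_space \<mu> \<and> sets \<mu> = sets shift_space \<and>
                              (\<forall>g. distr \<mu> \<mu> (shift g) = \<mu>)}"

definition shannon :: "'b measure \<Rightarrow> ('b \<Rightarrow> 'c) \<Rightarrow> real" where
  "shannon \<mu> f = (\<Sum>v\<in>f ` space \<mu>. - (measure \<mu> (f -` {v} \<inter> space \<mu>)
                     * ln (measure \<mu> (f -` {v} \<inter> space \<mu>))))"

text \<open>Finite measurable partitions, encoded by their labelling functions.\<close>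
definition finite_partitions :: "(('d, 'a) config \<Rightarrow> nat) set" where
  "finite_partitions = {P. P \<in> measurable shift_space (count_space UNIV) \<and> finite (range P)}"

definition join :: "nat \<Rightarrow> (('d::finite, 'a) config \<Rightarrow> nat) \<Rightarrow> ('d, 'a) config \<Rightarrow> ('d \<Rightarrow> int) \<Rightarrow> nat" where
  "join n P x = restrict (\<lambda>g. P (shift g x)) {g. \<forall>i. 0 \<le> g i \<and> g i < int n}"

definition entropy_part :: "('d::finite, 'a) config measure \<Rightarrow> (('d, 'a) config \<Rightarrow> nat) \<Rightarrow> real" where
  "entropy_part \<mu> P = lim (\<lambda>n. shannon \<mu> (join n P) / real n ^ CARD('d))"

definition ks_entropy :: "('d::finite, 'a) config measure \<Rightarrow> real" where
  "ks_entropy \<mu> = Sup (entropy_part \<mu> ` finite_partitions)"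

definition ES :: "real \<Rightarrow> (('d::finite, 'a) config \<Rightarrow> real) \<Rightarrow> ('d, 'a) config measure set" where
  "ES \<beta> \<phi> = {\<mu> \<in> invariant_measures.
      \<forall>\<nu> \<in> invariant_measures.
        ks_entropy \<nu> + \<beta> * integral\<^sup>L \<nu> \<phi> \<le> ks_entropy \<mu> + \<beta> * integral\<^sup>L \<mu> \<phi>}"

definition freezing_transition :: "(('d::finite, 'a) config \<Rightarrow> real) \<Rightarrow> real \<Rightarrow> bool" where
  "freezing_transition \<phi> \<beta>c \<longleftrightarrow>
     (\<forall>\<beta> \<beta>'. \<beta> > \<beta>c \<longrightarrow> \<beta>' > \<beta>c \<longrightarrow> ES \<beta> \<phi> = ES \<beta>' \<phi>) \<and>
     (\<forall>\<beta> \<beta>'. \<beta> < \<beta>c \<longrightarrow> \<beta>c < \<beta>' \<longrightarrow> ES \<beta> \<phi> \<noteq> ES \<beta>' \<phi>)"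

end

theory Submission
  imports Defs "HOL-Complex_Analysis.Great_Picard" "HOL-Library.Function_Algebras"
begin

text \<open>If \<open>ES(\<beta>\<phi>)\<close> is constant for \<open>\<beta> > \<beta>\<^sub>c\<close>, then it contains a measure \<open>\<mu>\<close> that is an equilibrium state
  for all large \<open>\<beta>\<close>. If all invariant measures give \<open>\<phi>\<close> the same integral, then \<open>ES(\<beta>\<phi>)\<close> does not depend
  on \<open>\<beta>\<close> at all. Otherwise there are configurations \<open>u\<close>, \<open>v\<close> differing on a finite set only, such that
  replacing \<open>u\<close> by \<open>v\<close> gains energy; by summability this gain is visible already when the environment
  agrees with \<open>u\<close> on a large box. If the pattern of \<open>u\<close> on this box has positive
  \<open>\<mu>\<close>-probability, replacing it by \<open>v\<close> on a grid of cells gains energy proportional to the volume,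
  hence free energy proportional to \<open>\<beta>\<close>, more than the entropy of \<open>\<mu>\<close> can compensate. If it has
  probability zero, writing it into a sparse set of cells costs bounded energy per cell, because
  the effect of a local change is summable, but the choice of cells is an additional source of
  entropy; again the free energy increases. In both cases the modified patterns bound the
  finite-volume partition function from below, and a limit of Gibbs distributions
  attains the resulting free energy.\<close>

section \<open>Shannon entropy of simple functions\<close>

text \<open>Replacing every occurrence of \<open>u\<close> by \<open>v\<close> cannot be undone, so
  nothing is known about the entropy that survives, and the estimate discards all of it. This is
  affordable because the measure stays the same while \<beta> grows, so that the discarded entropy
  per site is a fixed number. When the pattern is missing, one \<beta> suffices: the written cells
  can be read off the result, so only the entropy of the erased symbols is lost. Modified
  configurations need not have an invariant law, which would make a direct comparison of invariant
  measures awkward. The Gibbs inequality asks only for a random pattern on a cube, hence the detour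
  through partition functions. The way back to \<open>ES\<close> is phrased with
  \<open>ks_entropy\<close>, a supremum over all finite partitions, and therefore rests on the
  generator theorem.\<close>

lemma information_space_exp1: "prob_space M \<Longrightarrow> information_space M (exp 1)"
  unfolding information_space_def information_space_axioms_def by simp

text \<open>Base \<open>exp 1\<close> turns the library logarithm into \<open>ln\<close>, so that
  chain rule and data processing carry over to \<open>shannon\<close>.\<close>

lemma shannon_eq_entropy:
  assumes "prob_space M" "simple_function M f"
  shows "shannon M f = prob_space.entropy M (exp 1) (count_space (f ` space M)) f"
proof -
  interpret information_space M "exp 1" using information_space_exp1 assms(1) .
  show ?thesis
    unfolding shannon_def
    by (subst entropy_simple_distributed[OF simple_distributedI[OF assms(2) measure_nonneg refl]])
       (simp add: sum_negf log_def)
qed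

lemma shannon_cong:
  assumes "\<And>x. x \<in> space M \<Longrightarrow> f x = g x"
  shows "shannon M f = shannon M g"
proof -
  have "f ` space M = g ` space M" "\<And>v. f -` {v} \<inter> space M = g -` {v} \<inter> space M"
    using assms by auto
  then show ?thesis by (simp add: shannon_def)
qed

lemma neg_mult_ln_nonneg: "0 \<le> p \<Longrightarrow> p \<le> 1 \<Longrightarrow> 0 \<le> - (p * ln p)" for p :: real
  by (cases "p = 0") (auto simp: mult_le_0_iff)

lemma shannon_nonneg: "prob_space M \<Longrightarrow> 0 \<le> shannon M f"
  unfolding shannon_def
  by (intro sum_nonneg neg_mult_ln_nonneg measure_nonneg prob_space.prob_le_1)

lemma shannon_eq_sum:
  assumes "finite V" "f ` space M \<subseteq> V"
  shows "shannon M f = (\<Sum>v\<in>V. - (measure M (f -` {v} \<inter> space M)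
                     * ln (measure M (f -` {v} \<inter> space M))))"
  unfolding shannon_def
proof (rule sum.mono_neutral_left[OF assms], safe)
  fix v assume "v \<notin> f ` space M"
  then have "f -` {v} \<inter> space M = {}" by auto
  then show "- (measure M (f -` {v} \<inter> space M) * ln (measure M (f -` {v} \<inter> space M))) = 0" by simp
qed

lemma shannon_Pair_le:
  assumes "prob_space M" "simple_function M f" "simple_function M g"
  shows "shannon M (\<lambda>x. (f x, g x)) \<le> shannon M f + shannon M g"
proof -
  interpret information_space M "exp 1" using information_space_exp1 assms(1) .
  show ?thesis
    using entropy_chain_rule[OF assms(2,3)] conditional_entropy_less_eq_entropy[OF assms(3,2)] assms
    by (simp add: shannon_eq_entropy)
qed

text \<open>\<open>g\<close> factors through \<open>f\<close> on the space, so the data processing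
  inequality applies. With the hypothesis phrased by fibres, later comparisons of entropies reduce
  to showing that one observation determines another.\<close>

lemma shannon_le_of_factor:
  assumes "prob_space M" "simple_function M f"
    "\<And>x y. x \<in> space M \<Longrightarrow> y \<in> space M \<Longrightarrow> f x = f y \<Longrightarrow> g x = g y"
  shows "shannon M g \<le> shannon M f"
proof -
  interpret information_space M "exp 1" using information_space_exp1 assms(1) .
  define k where "k v = g (SOME x. x \<in> space M \<and> f x = v)" for v
  have k: "g x = (k \<circ> f) x" if "x \<in> space M" for x
  proof -
    have "(SOME y. y \<in> space M \<and> f y = f x) \<in> space M \<and> f (SOME y. y \<in> space M \<and> f y = f x) = f x"
      using that by (intro someI[of "\<lambda>y. y \<in> space M \<and> f y = f x" x]) auto
    then show ?thesis using assms(3)[OF that] by (simp add: k_def)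
  qed
  have "simple_function M (k \<circ> f)" by (rule simple_function_compose[OF assms(2)])
  then have "shannon M (k \<circ> f) \<le> shannon M f"
    using entropy_data_processing[OF assms(2), of k] assms(2)
    by (simp only: shannon_eq_entropy[OF assms(1)])
  then show ?thesis using shannon_cong[of M g "k \<circ> f"] k by metis
qed

lemma simple_function_of_factor:
  assumes "simple_function M f"
    "\<And>x y. x \<in> space M \<Longrightarrow> y \<in> space M \<Longrightarrow> f x = f y \<Longrightarrow> g x = g y"
  shows "simple_function M g"
proof -
  define k where "k v = g (SOME x. x \<in> space M \<and> f x = v)" for v
  have k: "g x = (k \<circ> f) x" if "x \<in> space M" for x
  proof -
    have "(SOME y. y \<in> space M \<and> f y = f x) \<in> space M \<and> f (SOME y. y \<in> space M \<and> f y = f x) = f x"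
      using that by (intro someI[of "\<lambda>y. y \<in> space M \<and> f y = f x" x]) auto
    then show ?thesis using assms(2)[OF that] by (simp add: k_def)
  qed
  show ?thesis
    using simple_function_compose[OF assms(1), of k] simple_function_cong[of M g "k \<circ> f"] k by blast
qed

text \<open>Values are confined to \<open>V\<close> only almost everywhere because, in the argument
  for a missing pattern, the modified configurations have the prescribed form only off a null
  set.\<close>

lemma prob_sum_fibres:
  assumes "prob_space M" "simple_function M f" "finite V" "AE x in M. f x \<in> V"
  shows "(\<Sum>v\<in>V. measure M (f -` {v} \<inter> space M)) = 1"
proof -
  interpret prob_space M by fact
  have m: "f -` {v} \<inter> space M \<in> sets M" for v
    using assms(2) by (rule simple_functionD)
  have "(\<Sum>v\<in>V. measure M (f -` {v} \<inter> space M)) = measure M (\<Union>v\<in>V. f -` {v} \<inter> space M)"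
    using m assms(3) by (subst finite_measure_finite_Union) (auto simp: disjoint_family_on_def)
  also have "\<dots> = 1"
    using m assms(3,4) by (subst prob_eq_1) (auto elim!: eventually_mono intro!: sets.finite_UN simp del: UN_simps)
  finally show ?thesis .
qed

text \<open>Apply \<open>ln t \<le> t - 1\<close> to \<open>t = exp (F v) / (Z * p v)\<close>,
  multiply by \<open>p v\<close> and sum: \<open>p\<close> and \<open>exp (F v) / Z\<close> both
  have sum 1 and cancel.\<close>

lemma gibbs_inequality_sum:
  fixes p F :: "'v \<Rightarrow> real"
  assumes "finite V" "\<And>v. v \<in> V \<Longrightarrow> 0 \<le> p v" "sum p V = 1"
  shows "(\<Sum>v\<in>V. - (p v * ln (p v)) + p v * F v) \<le> ln (\<Sum>v\<in>V. exp (F v))"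
proof -
  define Z where "Z = (\<Sum>v\<in>V. exp (F v))"
  have "V \<noteq> {}" using assms(3) by auto
  then have Z: "Z > 0" unfolding Z_def using assms(1) by (intro sum_pos) auto
  have "- (p v * ln (p v)) + p v * F v \<le> p v * ln Z + exp (F v) / Z - p v" if "v \<in> V" for v
  proof (cases "p v = 0")
    case True
    then show ?thesis using Z by simp
  next
    case False
    then have pv: "p v > 0" using assms(2)[OF that] by simp
    have "ln (exp (F v) / (Z * p v)) \<le> exp (F v) / (Z * p v) - 1"
      using pv Z by (intro ln_le_minus_one) auto
    then have "F v - ln Z - ln (p v) \<le> exp (F v) / (Z * p v) - 1"
      using pv Z by (simp add: ln_div ln_mult)
    then have "p v * (F v - ln Z - ln (p v)) \<le> p v * (exp (F v) / (Z * p v) - 1)"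
      using pv by (intro mult_left_mono) auto
    also have "\<dots> = exp (F v) / Z - p v" using pv Z by (simp add: field_simps)
    finally show ?thesis by (simp add: algebra_simps)
  qed
  then have "(\<Sum>v\<in>V. - (p v * ln (p v)) + p v * F v) \<le> (\<Sum>v\<in>V. p v * ln Z + exp (F v) / Z - p v)"
    by (rule sum_mono)
  also have "\<dots> = ln Z"
    using assms(3) Z
    by (simp add: sum.distrib sum_subtractf sum_divide_distrib[symmetric] sum_distrib_right[symmetric] Z_def[symmetric])
  finally show ?thesis by (simp add: Z_def)
qed

lemma integral_simple_function_eq_sum:
  fixes F :: "'v \<Rightarrow> real"
  assumes "prob_space M" "simple_function M f" "finite V" "AE x in M. f x \<in> V"
  shows "(\<integral>x. F (f x) \<partial>M) = (\<Sum>v\<in>V. measure M (f -` {v} \<inter> space M) * F v)"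
proof -
  interpret prob_space M by fact
  have m: "f -` {v} \<inter> space M \<in> sets M" for v
    using assms(2) by (rule simple_functionD)
  have "(\<integral>x. F (f x) \<partial>M) = (\<integral>x. (\<Sum>v\<in>V. indicator (f -` {v} \<inter> space M) x * F v) \<partial>M)"
  proof (rule integral_cong_AE)
    show "(\<lambda>x. F (f x)) \<in> borel_measurable M"
      using simple_function_compose[OF assms(2), of F]
      by (intro borel_measurable_simple_function) (simp add: o_def)
    show "(\<lambda>x. \<Sum>v\<in>V. indicator (f -` {v} \<inter> space M) x * F v) \<in> borel_measurable M"
      using m by measurable
    show "AE x in M. F (f x) = (\<Sum>v\<in>V. indicator (f -` {v} \<inter> space M) x * F v)"
    proof (rule AE_mp[OF assms(4)], rule AE_I2, rule impI)
      fix x assume x: "x \<in> space M" "f x \<in> V"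
      have "(\<Sum>v\<in>V. indicator (f -` {v} \<inter> space M) x * F v)
          = (\<Sum>v\<in>V. if v = f x then F v else 0)"
        using x by (intro sum.cong) (auto simp: indicator_def)
      then show "F (f x) = (\<Sum>v\<in>V. indicator (f -` {v} \<inter> space M) x * F v)"
        using x assms(3) by simp
    qed
  qed
  also have "\<dots> = (\<Sum>v\<in>V. \<integral>x. indicator (f -` {v} \<inter> space M) x * F v \<partial>M)"
    using m by (intro Bochner_Integration.integral_sum) (auto simp: finite_measure.emeasure_finite less_top[symmetric])
  also have "\<dots> = (\<Sum>v\<in>V. measure M (f -` {v} \<inter> space M) * F v)"
    using m by (intro sum.cong) auto
  finally show ?thesis .
qed

lemma shannon_eq_sum_AE:
  assumes "prob_space M" "simple_function M f" "finite V" "AE x in M. f x \<in> V"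
  shows "shannon M f = (\<Sum>v\<in>V. - (measure M (f -` {v} \<inter> space M)
                     * ln (measure M (f -` {v} \<inter> space M))))"
proof -
  interpret prob_space M by fact
  have m: "f -` {v} \<inter> space M \<in> sets M" for v
    using assms(2) by (rule simple_functionD)
  have fin: "finite (V \<union> f ` space M)" using assms(2,3) by (simp add: simple_functionD)
  have "measure M (f -` {v} \<inter> space M) = 0" if "v \<notin> V" for v
    using assms(4) m[of v] that by (subst prob_eq_0) (auto elim!: eventually_mono)
  then show ?thesis
    using fin by (subst shannon_eq_sum[OF fin]) (auto intro!: sum.mono_neutral_right)
qed

text \<open>All lower bounds for partition functions come from here: any random pattern with values
  in \<open>V\<close> may serve as a trial distribution.\<close>

lemma gibbs_inequality:
  assumes "prob_space M" "simple_function M f" "finite V" "AE x in M. f x \<in> V"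
  shows "shannon M f + (\<integral>x. F (f x) \<partial>M) \<le> ln (\<Sum>v\<in>V. exp (F v))"
  using gibbs_inequality_sum[OF assms(3) _ prob_sum_fibres[OF assms], of F]
  by (simp add: shannon_eq_sum_AE[OF assms] integral_simple_function_eq_sum[OF assms] sum.distrib sum_subtractf sum_negf)

lemma shannon_le_ln_card:
  assumes "prob_space M" "simple_function M f" "finite V" "f ` space M \<subseteq> V"
  shows "shannon M f \<le> ln (card V)"
  using gibbs_inequality[OF assms(1-3), of "\<lambda>_. 0"] assms(4) by auto

lemma shannon_const: "prob_space M \<Longrightarrow> shannon M (\<lambda>_. c) = 0"
  using prob_space.not_empty[of M] prob_space.prob_space[of M] by (simp add: shannon_def image_constant_conv vimage_const)

lemma shannon_transfer:
  assumes "finite V" "f ` space M \<subseteq> V" "g ` space N \<subseteq> V"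
    "\<And>v. v \<in> V \<Longrightarrow> measure M (f -` {v} \<inter> space M) = measure N (g -` {v} \<inter> space N)"
  shows "shannon M f = shannon N g"
  using assms by (simp add: shannon_eq_sum[of V])

section \<open>Cubes in the lattice\<close>

text \<open>Half-open with arbitrary integer ends, so that one family contains the index sets of
  \<open>join\<close>, the symmetric boxes and the base points of all translates that meet a
  cube.\<close>

definition hcube :: "int \<Rightarrow> int \<Rightarrow> ('d \<Rightarrow> int) set" where
  "hcube a b = {g. \<forall>i. a \<le> g i \<and> g i < b}"

abbreviation cube :: "nat \<Rightarrow> ('d \<Rightarrow> int) set" where
  "cube n \<equiv> hcube 0 (int n)"

lemma hcube_eq_PiE: "hcube a b = PiE UNIV (\<lambda>_. {a..<b})"
  by (auto simp: hcube_def PiE_def Pi_def)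

lemma finite_hcube [simp, intro]: "finite (hcube a b :: ('d::finite \<Rightarrow> int) set)"
  unfolding hcube_eq_PiE by (rule finite_PiE) auto

lemma card_hcube: "card (hcube a b :: ('d::finite \<Rightarrow> int) set) = nat (b - a) ^ CARD('d)"
  unfolding hcube_eq_PiE by (simp add: card_PiE)

lemma real_card_hcube:
  "a \<le> b \<Longrightarrow> real (card (hcube a b :: ('d::finite \<Rightarrow> int) set)) = of_int (b - a) ^ CARD('d)"
  unfolding card_hcube by (simp add: of_nat_power)

lemma hcube_mono:
  assumes "a' \<le> a" "b \<le> b'"
  shows "(hcube a b :: ('d \<Rightarrow> int) set) \<subseteq> hcube a' b'"
proof
  fix g :: "'d \<Rightarrow> int" assume "g \<in> hcube a b"
  then have "a' \<le> g i \<and> g i < b'" for i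
    using assms unfolding hcube_def mem_Collect_eq by (metis order_trans less_le_trans)
  then show "g \<in> hcube a' b'" by (simp add: hcube_def)
qed

lemma box_eq_hcube: "box n = hcube (- int n) (int n + 1)"
  by (auto simp: box_def hcube_def abs_le_iff) (smt (verit))+

lemma finite_box [simp, intro]: "finite (box n :: ('d::finite \<Rightarrow> int) set)"
  by (simp add: box_eq_hcube)

lemma box_mono: "m \<le> n \<Longrightarrow> box m \<subseteq> box n"
  unfolding box_eq_hcube by (rule hcube_mono) auto

lemma shift_eq: "shift g x = (\<lambda>h. x (h + g))"
  by (simp add: shift_def plus_fun_def)

lemma shift_shift: "shift g (shift h x) = shift (g + h) x"
  by (simp add: shift_eq add.assoc)

lemma translate_hcube: "(+) g ` hcube a b = {h. h - g \<in> hcube a b}"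
  by (auto intro!: image_eqI[where x="_ - g"])

lemma subset_box: "finite (F :: ('d::finite \<Rightarrow> int) set) \<Longrightarrow> \<exists>r. F \<subseteq> box r"
proof (induction rule: finite_induct)
  case (insert g F)
  then obtain r where r: "F \<subseteq> box r" by auto
  define m where "m = nat (Max (range (\<lambda>i. \<bar>g i\<bar>)))"
  have "\<bar>g i\<bar> \<le> int m" for i
  proof -
    have "\<bar>g i\<bar> \<le> Max (range (\<lambda>i. \<bar>g i\<bar>))" by (rule Max_ge) auto
    then show ?thesis unfolding m_def by linarith
  qed
  then have "g \<in> box m" by (simp add: box_def)
  then show ?case using r box_mono[of m "max m r"] box_mono[of r "max m r"] by (auto intro!: exI[of _ "max m r"])
qed auto

text \<open>The translates of \<open>cube k\<close> with base points in a fixed residue class modulo \<open>k\<close> tile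
  the lattice; the bound is the sum over all residue classes.\<close>

lemma cube_tiling_bound:
  fixes H :: "('d::finite \<Rightarrow> int) set \<Rightarrow> real"
  assumes sub: "\<And>S T. finite S \<Longrightarrow> finite T \<Longrightarrow> H (S \<union> T) \<le> H S + H T"
    and mono: "\<And>S T. finite T \<Longrightarrow> S \<subseteq> T \<Longrightarrow> H S \<le> H T"
    and empty: "H {} = 0" and k: "k > 0"
  shows "real k ^ CARD('d) * H (cube n) \<le> (\<Sum>g\<in>hcube (1 - int k) (int n). H ((+) g ` cube k))"
proof -
  define B where "B = (hcube (1 - int k) (int n) :: ('d \<Rightarrow> int) set)"
  define md where "md g = (\<lambda>i. g i mod int k)" for g :: "'d \<Rightarrow> int"
  have UN: "H (\<Union>g\<in>G. T g) \<le> (\<Sum>g\<in>G. H (T g))"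
    if "finite G" "\<And>g. finite (T g)" for G and T :: "('d \<Rightarrow> int) \<Rightarrow> ('d \<Rightarrow> int) set"
    using that(1)
  proof induction
    case (insert g G)
    then show ?case
      using sub[of "T g" "\<Union>g\<in>G. T g"] that(2) by auto
  qed (simp add: empty)
  have one: "H (cube n) \<le> (\<Sum>g | g \<in> B \<and> md g = j. H ((+) g ` cube k))" if "j \<in> cube k" for j
  proof -
    have "h \<in> (\<Union>g\<in>{g \<in> B. md g = j}. (+) g ` cube k)" if h: "h \<in> cube n" for h
    proof
      \<comment> \<open>The base point of the tile of class \<open>j\<close> that contains
        \<open>h\<close>: in each coordinate the largest number at most \<open>h i\<close> that is
        congruent to \<open>j i\<close>. It precedes 0 by at most \<open>k - 1\<close>, hence the
        lower end \<open>1 - int k\<close> of \<open>B\<close>.\<close>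
      define g where "g = (\<lambda>i. h i - (h i - j i) mod int k)"
      have r: "0 \<le> (h i - j i) mod int k" "(h i - j i) mod int k < int k" for i
        using k by auto
      have "g \<in> B"
        using h r by (auto simp: B_def hcube_def g_def) (smt (verit))+
      moreover have "md g = j"
        using \<open>j \<in> cube k\<close> by (auto simp: md_def g_def hcube_def mod_diff_right_eq)
      ultimately show "g \<in> {g \<in> B. md g = j}" by simp
      show "h \<in> (+) g ` cube k"
        using r by (simp add: translate_hcube) (auto simp: hcube_def g_def)
    qed
    then have "cube n \<subseteq> (\<Union>g\<in>{g \<in> B. md g = j}. (+) g ` cube k)" by auto
    then have "H (cube n) \<le> H (\<Union>g\<in>{g \<in> B. md g = j}. (+) g ` cube k)"
      by (intro mono) (auto simp: B_def)
    also have "\<dots> \<le> (\<Sum>g | g \<in> B \<and> md g = j. H ((+) g ` cube k))"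
      by (intro UN) (auto simp: B_def)
    finally show ?thesis .
  qed
  have "real k ^ CARD('d) * H (cube n) = (\<Sum>j\<in>(cube k :: ('d \<Rightarrow> int) set). H (cube n))"
    by (simp add: card_hcube)
  also have "\<dots> \<le> (\<Sum>j\<in>cube k. \<Sum>g | g \<in> B \<and> md g = j. H ((+) g ` cube k))"
    using one by (rule sum_mono)
  also have "\<dots> = (\<Sum>g\<in>B. H ((+) g ` cube k))"
  proof (rule sum.group)
    show "md ` B \<subseteq> cube k" using k by (auto simp: md_def hcube_def)
  qed (auto simp: B_def)
  finally show ?thesis by (simp add: B_def)
qed

lemma cube_ratio_tendsto:
  "(\<lambda>n. (real n + c) ^ d / real n ^ d) \<longlonglongrightarrow> 1"
proof -
  have "(\<lambda>n. ((real n + c) / real n) ^ d) \<longlonglongrightarrow> 1 ^ d"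
    by (intro tendsto_power) real_asymp
  then show ?thesis by (simp add: power_divide)
qed

text \<open>Fekete's argument in several dimensions. Averaging over all residue classes bounds the
  ratio at \<open>n\<close> by \<open>1 + o(1)\<close> times the ratio at a fixed \<open>k\<close>,
  without divisibility of \<open>n\<close> by \<open>k\<close>; so the limit is the infimum.\<close>

lemma cube_subadditive_limit:
  fixes H :: "('d::finite \<Rightarrow> int) set \<Rightarrow> real"
  assumes sub: "\<And>S T. finite S \<Longrightarrow> finite T \<Longrightarrow> H (S \<union> T) \<le> H S + H T"
    and mono: "\<And>S T. finite T \<Longrightarrow> S \<subseteq> T \<Longrightarrow> H S \<le> H T"
    and empty: "H {} = 0"
    and inv: "\<And>g S. finite S \<Longrightarrow> H ((+) g ` S) = H S"
  shows "\<exists>L. (\<lambda>n. H (cube n) / real n ^ CARD('d)) \<longlonglongrightarrow> L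
    \<and> (\<forall>k>0. L \<le> H (cube k) / real k ^ CARD('d))"
proof -
  define a where "a n = H (cube n) / real n ^ CARD('d)" for n
  have nonneg: "0 \<le> H S" if "finite S" for S using mono[of S "{}"] empty that by simp
  have a0: "0 \<le> a n" for n by (simp add: a_def nonneg)
  have bound: "a n \<le> (real n + (real k - 1)) ^ CARD('d) / real n ^ CARD('d) * a k" if "k > 0" "n > 0" for n k
  proof -
    have "real k ^ CARD('d) * H (cube n) \<le> (real n + (real k - 1)) ^ CARD('d) * H (cube k)"
      using cube_tiling_bound[OF sub mono empty, of k n] that
      by (simp add: inv real_card_hcube algebra_simps)
    then show ?thesis using that by (simp add: a_def field_simps)
  qed
  define L where "L = Inf (a ` {0<..})"
  have bdd: "bdd_below (a ` {0<..})" using a0 by (intro bdd_belowI[of _ 0]) auto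
  have L_le: "L \<le> a k" if "k > 0" for k
    unfolding L_def using bdd that by (intro cInf_lower) auto
  have "a \<longlonglongrightarrow> L"
  proof (rule order_tendstoI)
    fix y assume "y < L"
    then show "\<forall>\<^sub>F n in sequentially. y < a n"
      using L_le by (intro eventually_mono[OF eventually_gt_at_top[of 0]]) (auto intro: less_le_trans)
  next
    fix y assume "L < y"
    then obtain k where k: "k > 0" "a k < y"
      unfolding L_def by (subst (asm) cInf_less_iff) (use bdd in auto)
    have "(\<lambda>n. (real n + (real k - 1)) ^ CARD('d) / real n ^ CARD('d) * a k) \<longlonglongrightarrow> 1 * a k"
      by (intro tendsto_mult tendsto_const cube_ratio_tendsto)
    then have "\<forall>\<^sub>F n in sequentially. (real n + (real k - 1)) ^ CARD('d) / real n ^ CARD('d) * a k < y"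
      using k(2) by (intro order_tendstoD) auto
    then show "\<forall>\<^sub>F n in sequentially. a n < y"
      using eventually_gt_at_top[of 0]
      by eventually_elim (rule le_less_trans[OF bound[OF k(1)]])
  qed
  then show ?thesis using L_le unfolding a_def by blast
qed

section \<open>Entropy of families of simple functions\<close>

lemma restrict_eq_iff: "restrict f S = restrict g S \<longleftrightarrow> (\<forall>x\<in>S. f x = g x)"
  by (metis restrict_apply' restrict_ext)

lemma simple_function_family:
  assumes "finite S" "\<And>g. simple_function M (X g)"
  shows "simple_function M (\<lambda>x. restrict (\<lambda>g. X g x) S)"
  unfolding simple_function_def
proof (intro conjI ballI)
  have "(\<lambda>x. restrict (\<lambda>g. X g x) S) ` space M \<subseteq> PiE S (\<lambda>g. X g ` space M)" by auto
  moreover have "finite (PiE S (\<lambda>g. X g ` space M))"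
    using assms by (intro finite_PiE) (auto simp: simple_functionD)
  ultimately show "finite ((\<lambda>x. restrict (\<lambda>g. X g x) S) ` space M)" by (rule finite_subset)
  fix v assume "v \<in> (\<lambda>x. restrict (\<lambda>g. X g x) S) ` space M"
  then have v: "v \<in> extensional S" by auto
  have "(\<lambda>x. restrict (\<lambda>g. X g x) S) -` {v} \<inter> space M = {x \<in> space M. \<forall>g\<in>S. X g x = v g}"
    using v by (auto simp: fun_eq_iff restrict_def extensional_def)
  also have "\<dots> \<in> sets M"
  proof (intro sets.sets_Collect_finite_All assms)
    fix g assume "g \<in> S"
    have "{x \<in> space M. X g x = v g} = X g -` {v g} \<inter> space M" by auto
    then show "{x \<in> space M. X g x = v g} \<in> sets M" using assms(2) by (simp add: simple_functionD)
  qed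
  finally show "(\<lambda>x. restrict (\<lambda>g. X g x) S) -` {v} \<inter> space M \<in> sets M" .
qed

context
  fixes M :: "'b measure" and X :: "'g \<Rightarrow> 'b \<Rightarrow> 'c"
  assumes M: "prob_space M" and X: "\<And>g. simple_function M (X g)"
begin

private abbreviation "fam S \<equiv> (\<lambda>x. restrict (\<lambda>g. X g x) S)"

lemma shannon_family_Un:
  assumes "finite S" "finite T"
  shows "shannon M (fam (S \<union> T)) \<le> shannon M (fam S) + shannon M (fam T)"
proof -
  have "shannon M (fam (S \<union> T)) \<le> shannon M (\<lambda>x. (fam S x, fam T x))"
    using assms by (intro shannon_le_of_factor M simple_function_Pair simple_function_family X)
      (auto simp: restrict_eq_iff)
  also have "\<dots> \<le> shannon M (fam S) + shannon M (fam T)"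
    using assms by (intro shannon_Pair_le M simple_function_family X)
  finally show ?thesis .
qed

lemma shannon_family_mono:
  assumes "finite T" "S \<subseteq> T"
  shows "shannon M (fam S) \<le> shannon M (fam T)"
  using assms by (intro shannon_le_of_factor M simple_function_family X)
    (auto simp: restrict_eq_iff)

lemma shannon_family_empty: "shannon M (fam {}) = 0"
  using shannon_const[OF M, of "\<lambda>_. undefined"] by (simp add: restrict_def)

lemma shannon_family_le_sum:
  assumes "finite S"
  shows "shannon M (fam S) \<le> (\<Sum>g\<in>S. shannon M (X g))"
  using assms
proof induction
  case (insert g S)
  have "shannon M (fam {g}) \<le> shannon M (X g)"
    by (intro shannon_le_of_factor M X) (auto simp: restrict_eq_iff)
  then show ?case
    using insert shannon_family_Un[of "{g}" S] by (simp del: restrict_apply)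
qed (simp add: shannon_family_empty del: restrict_apply)

end

section \<open>Shift-invariant measures and their entropy\<close>

lemma space_shift_space: "space (shift_space :: ('d, 'a) config measure) = UNIV"
  by (simp add: shift_space_def space_PiM)

lemma measurable_coordinate:
  "(\<lambda>x. x g) \<in> measurable (shift_space :: ('d, 'a) config measure) (count_space UNIV)"
  unfolding shift_space_def by (rule measurable_component_singleton) simp

lemma measurable_shift: "shift g \<in> measurable shift_space (shift_space :: ('d, 'a) config measure)"
proof -
  have "shift g \<in> measurable (shift_space :: ('d, 'a) config measure) (PiM UNIV (\<lambda>_. count_space UNIV))"
    unfolding shift_eq
    by (rule measurable_PiM_single') (auto simp: measurable_coordinate space_PiM)
  then show ?thesis by (simp add: shift_space_def)
qed

section \<open>Measures on configurations and approximation by cylinders\<close>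

locale config_measure = prob_space \<mu> for \<mu> :: "('d::finite, 'a::finite) config measure" +
  assumes sets_mu: "sets \<mu> = sets shift_space"
begin

lemma space_mu [simp]: "space \<mu> = UNIV"
  using sets_eq_imp_space_eq[OF sets_mu] by (simp add: space_shift_space)

lemma measurable_mu: "measurable \<mu> N = measurable shift_space N"
  using sets_mu by (rule measurable_cong_sets) simp

lemma simple_coordinate: "simple_function \<mu> (\<lambda>x. x g)"
  unfolding simple_function_def
  using measurable_sets[OF measurable_coordinate[of g]]
  by (auto simp: sets_mu space_shift_space)

lemma simple_restrict: "finite S \<Longrightarrow> simple_function \<mu> (\<lambda>x. restrict x S)"
  using simple_function_family[OF _ simple_coordinate, of S "\<lambda>g. g"] by simp

lemma simple_finite_dep:
  assumes "finite S" "\<And>x y. (\<And>g. g \<in> S \<Longrightarrow> x g = y g) \<Longrightarrow> f x = f y"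
  shows "simple_function \<mu> f"
  by (rule simple_function_of_factor[OF simple_restrict[OF assms(1)]])
    (metis assms(2) restrict_apply')

lemma sets_finite_dep:
  assumes "finite S" "\<And>x y. (\<And>g. g \<in> S \<Longrightarrow> x g = y g) \<Longrightarrow> x \<in> C \<longleftrightarrow> y \<in> C"
  shows "C \<in> sets \<mu>"
proof -
  have "simple_function \<mu> (\<lambda>x. x \<in> C)" using assms by (rule simple_finite_dep)
  then have "(\<lambda>x. x \<in> C) -` {True} \<inter> space \<mu> \<in> sets \<mu>" by (rule simple_functionD)
  moreover have "(\<lambda>x. x \<in> C) -` {True} \<inter> space \<mu> = C" by auto
  ultimately show ?thesis by simp
qed

text \<open>The sets that can be approximated by cylinders over boxes contain the one-coordinate
  sets and are closed under complement and countable union.\<close>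

lemma cylinder_approx:
  assumes "A \<in> sets \<mu>" "e > 0"
  shows "\<exists>m C. (\<forall>x y. (\<forall>g\<in>box m. x g = y g) \<longrightarrow> (x \<in> C \<longleftrightarrow> y \<in> C)) \<and>
    measure \<mu> ((A - C) \<union> (C - A)) < e"
proof -
  define G where "G = {{f \<in> PiE UNIV (\<lambda>_. UNIV). f i \<in> A} | (i :: 'd \<Rightarrow> int) (A :: 'a set). True}"
  have sets: "sets \<mu> = sigma_sets UNIV G"
    unfolding sets_mu shift_space_def sets_PiM_single G_def by (simp add: PiE_UNIV_domain)
  have cylsets: "C \<in> sets \<mu>" if "\<forall>x y. (\<forall>g\<in>box m. x g = y g) \<longrightarrow> (x \<in> C \<longleftrightarrow> y \<in> C)" for C m
    using that by (intro sets_finite_dep[of "box m"]) auto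
  have "A \<in> sigma_sets UNIV G" using assms(1) sets by simp
  then show ?thesis using assms(2)
  proof (induction arbitrary: e)
    case (Basic a)
    then obtain i A where a: "a = {f. f i \<in> A}" by (auto simp: G_def)
    obtain m where "{i} \<subseteq> box m" using subset_box[of "{i}"] by auto
    then have "(\<forall>x y. (\<forall>g\<in>box m. x g = y g) \<longrightarrow> (x \<in> a \<longleftrightarrow> y \<in> a))" by (auto simp: a)
    moreover have "measure \<mu> ((a - a) \<union> (a - a)) < e" using Basic by simp
    ultimately show ?case by (intro exI conjI)
  next
    case Empty
    then have "measure \<mu> (({} - {}) \<union> ({} - {})) < e" by simp
    then show ?case by (intro exI[of _ 0] exI[of _ "{}"] conjI) auto
  next
    case (Compl a)
    from Compl.IH[OF Compl.prems]
    obtain m C where C: "\<forall>x y. (\<forall>g\<in>box m. x g = y g) \<longrightarrow> (x \<in> C \<longleftrightarrow> y \<in> C)"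
      "measure \<mu> ((a - C) \<union> (C - a)) < e" by (elim exE conjE)
    have "((UNIV - a) - (- C)) \<union> ((- C) - (UNIV - a)) = (a - C) \<union> (C - a)" by auto
    then have "measure \<mu> (((UNIV - a) - (- C)) \<union> ((- C) - (UNIV - a))) < e" using C(2) by simp
    moreover have "\<forall>x y. (\<forall>g\<in>box m. x g = y g) \<longrightarrow> (x \<in> - C \<longleftrightarrow> y \<in> - C)"
      using C(1) by simp
    ultimately show ?case by (intro exI conjI)
  next
    case (Union a)
    have am: "a i \<in> sets \<mu>" for i using Union(1) sets by simp
    have "(\<lambda>n. measure \<mu> (\<Union>i<n. a i)) \<longlonglongrightarrow> measure \<mu> (\<Union>n. \<Union>i<n. a i)"
      using am by (intro finite_Lim_measure_incseq) (force simp: incseq_def)+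
    also have "(\<Union>n. \<Union>i<n. a i) = (\<Union>i. a i)" by auto
    finally have "\<forall>\<^sub>F n in sequentially. measure \<mu> (\<Union>i. a i) - e / 2 < measure \<mu> (\<Union>i<n. a i)"
      by (rule order_tendstoD) (use Union in simp)
    then obtain N where N: "measure \<mu> (\<Union>i. a i) - e / 2 < measure \<mu> (\<Union>i<N. a i)"
      by (auto simp: eventually_sequentially)
    \<comment> \<open>Half of \<open>e\<close> was spent on truncating the union, so the
      \<open>N\<close> approximations share the other half; \<open>N + 1\<close> also covers
      \<open>N = 0\<close>.\<close>
    have "\<exists>m C. (\<forall>x y. (\<forall>g\<in>box m. x g = y g) \<longrightarrow> (x \<in> C \<longleftrightarrow> y \<in> C)) \<and>
      measure \<mu> ((a i - C) \<union> (C - a i)) < e / (2 * (real N + 1))" for i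
      by (rule Union.IH) (use Union.prems in auto)
    then obtain m C where C: "\<And>i. \<forall>x y. (\<forall>g\<in>box (m i). x g = y g) \<longrightarrow> (x \<in> C i \<longleftrightarrow> y \<in> C i)"
      "\<And>i. measure \<mu> ((a i - C i) \<union> (C i - a i)) < e / (2 * (real N + 1))" by metis
    define mm where "mm = Max (insert 0 (m ` {..<N}))"
    have mm: "box (m i) \<subseteq> (box mm :: ('d \<Rightarrow> int) set)" if "i < N" for i
      using that by (intro box_mono) (auto simp: mm_def intro!: Max_ge)
    define D where "D = (\<Union>i<N. C i)"
    have D: "\<forall>x y. (\<forall>g\<in>box mm. x g = y g) \<longrightarrow> (x \<in> D \<longleftrightarrow> y \<in> D)"
    proof (intro allI impI)
      fix x y :: "('d \<Rightarrow> int) \<Rightarrow> 'a" assume "\<forall>g\<in>box mm. x g = y g"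
      then have "x \<in> C i \<longleftrightarrow> y \<in> C i" if "i < N" for i
        using C(1)[of i] mm[OF that] by blast
      then show "x \<in> D \<longleftrightarrow> y \<in> D" by (auto simp: D_def)
    qed
    have Cm: "C i \<in> sets \<mu>" for i using C(1) by (rule cylsets)
    have "measure \<mu> (((\<Union>i. a i) - D) \<union> (D - (\<Union>i. a i)))
      \<le> measure \<mu> (((\<Union>i. a i) - (\<Union>i<N. a i)) \<union> (\<Union>i<N. (a i - C i) \<union> (C i - a i)))"
      using am Cm by (intro finite_measure_mono) (auto simp: D_def)
    also have "\<dots> \<le> measure \<mu> ((\<Union>i. a i) - (\<Union>i<N. a i)) + measure \<mu> (\<Union>i<N. (a i - C i) \<union> (C i - a i))"
      using am Cm by (intro measure_Un_le) auto
    also have "measure \<mu> (\<Union>i<N. (a i - C i) \<union> (C i - a i)) \<le> (\<Sum>i<N. measure \<mu> ((a i - C i) \<union> (C i - a i)))"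
      using am Cm by (intro finite_measure_subadditive_finite) auto
    also have "\<dots> \<le> (\<Sum>i<N. e / (2 * (real N + 1)))"
      using C(2) by (intro sum_mono less_imp_le) auto
    also have "\<dots> \<le> e / 2" using Union(3) by (simp add: field_simps)
    also have "measure \<mu> ((\<Union>i. a i) - (\<Union>i<N. a i)) = measure \<mu> (\<Union>i. a i) - measure \<mu> (\<Union>i<N. a i)"
      using am by (intro finite_measure_Diff) auto
    finally have "measure \<mu> (((\<Union>i. a i) - D) \<union> (D - (\<Union>i. a i))) < e" using N by simp
    then show ?case using D by (intro exI conjI)
  qed
qed

end

text \<open>Comes from \<open>ln s \<le> s - 1\<close> at \<open>s = 1 / sqrt t\<close>. It
  expresses the continuity of the entropy term at 0 in quantitative form.\<close>

lemma entropy_term_le_sqrt: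
  fixes t :: real
  assumes "0 \<le> t"
  shows "- (t * ln t) \<le> 2 * sqrt t"
proof (cases "t = 0")
  case False
  then have t: "t > 0" using assms by simp
  have "ln (1 / sqrt t) \<le> 1 / sqrt t - 1" using t by (intro ln_le_minus_one) auto
  then have "- ln t \<le> 2 * (1 / sqrt t - 1)" using t by (simp add: ln_div ln_sqrt)
  then have "t * - ln t \<le> t * (2 * (1 / sqrt t - 1))" using t by (intro mult_left_mono) auto
  also have "\<dots> = 2 * (t / sqrt t) - 2 * t" by (simp add: algebra_simps)
  also have "\<dots> \<le> 2 * sqrt t" using t by (simp add: real_div_sqrt)
  finally show ?thesis by simp
qed simp

text \<open>The tangent of the concave entropy term at \<open>t = 1\<close>; it controls an atom of
  nearly full mass.\<close>

lemma entropy_term_le_minus: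
  fixes t :: real
  assumes "0 \<le> t"
  shows "- (t * ln t) \<le> 1 - t"
proof (cases "t = 0")
  case False
  then have t: "t > 0" using assms by simp
  have "ln (1 / t) \<le> 1 / t - 1" using t by (intro ln_le_minus_one) auto
  then have "t * - ln t \<le> t * (1 / t - 1)" using t by (intro mult_left_mono) (auto simp: ln_div)
  then show ?thesis using t by (simp add: algebra_simps)
qed simp

text \<open>Every atom contributes at most \<open>2 * sqrt t\<close>: those other than
  \<open>c\<close> have mass at most \<open>t\<close>, and the atom at \<open>c\<close> has mass at
  least \<open>1 - t\<close>. The crude factor \<open>card W\<close> is harmless because
  \<open>W\<close> is fixed before \<open>t\<close> is chosen.\<close>

lemma shannon_le_of_concentrated:
  assumes "prob_space M" "simple_function M f" "finite W" "f ` space M \<subseteq> W"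
    "measure M {x \<in> space M. f x \<noteq> c} \<le> t" "t \<le> 1"
  shows "shannon M f \<le> real (card W) * (2 * sqrt t)"
proof -
  interpret prob_space M by fact
  have m: "f -` V \<inter> space M \<in> sets M" for V using assms(2) by (rule simple_functionD)
  have t0: "0 \<le> t" using assms(5) measure_nonneg order_trans by blast
  have "- (measure M (f -` {v} \<inter> space M) * ln (measure M (f -` {v} \<inter> space M))) \<le> 2 * sqrt t" for v
  proof (cases "v = c")
    case False
    have "measure M (f -` {v} \<inter> space M) \<le> measure M {x \<in> space M. f x \<noteq> c}"
      using m[of "- {c}"] False by (intro finite_measure_mono) (auto simp: vimage_def Int_def conj_commute)
    then have "measure M (f -` {v} \<inter> space M) \<le> t" using assms(5) by simp
    then show ?thesis
      using entropy_term_le_sqrt[of "measure M (f -` {v} \<inter> space M)"] real_sqrt_le_mono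
      by (smt (verit) measure_nonneg)
  next
    case True
    have "{x \<in> space M. f x \<noteq> c} = space M - (f -` {c} \<inter> space M)" by auto
    then have "measure M {x \<in> space M. f x \<noteq> c} = 1 - measure M (f -` {c} \<inter> space M)"
      using prob_compl[OF m[of "{c}"]] by simp
    moreover have "t \<le> sqrt t" using t0 assms(6) by (simp add: real_le_rsqrt power2_eq_square mult_left_le)
    ultimately show ?thesis using True entropy_term_le_minus[of "measure M (f -` {c} \<inter> space M)"] assms(5) t0
      by simp
  qed
  then have "shannon M f \<le> (\<Sum>v\<in>W. 2 * sqrt t)"
    unfolding shannon_eq_sum[OF assms(3,4)] by (intro sum_mono) auto
  then show ?thesis by simp
qed

section \<open>Invariant measures and the generator theorem\<close>

locale invariant_measure = config_measure +
  assumes invariant: "distr \<mu> \<mu> (shift g) = \<mu>"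

lemma invariant_measures_iff: "\<mu> \<in> invariant_measures \<longleftrightarrow> invariant_measure \<mu>"
  unfolding invariant_measures_def invariant_measure_def invariant_measure_axioms_def
    config_measure_def config_measure_axioms_def by auto

context invariant_measure
begin

lemma measurable_shift_mu: "shift g \<in> measurable \<mu> \<mu>"
  using measurable_shift measurable_cong_sets[OF sets_mu sets_mu] by blast

lemma measure_shift_vimage: "A \<in> sets \<mu> \<Longrightarrow> measure \<mu> (shift g -` A) = measure \<mu> A"
  using measure_distr[OF measurable_shift_mu, of A g] by (simp add: invariant)

lemma integral_shift:
  fixes f :: "('a, 'b) config \<Rightarrow> real"
  assumes "f \<in> borel_measurable \<mu>"
  shows "(\<integral>x. f (shift g x) \<partial>\<mu>) = (\<integral>x. f x \<partial>\<mu>)"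
  using integral_distr[OF measurable_shift_mu assms, of g] by (simp add: invariant)

lemma simple_shift:
  assumes "simple_function \<mu> P"
  shows "simple_function \<mu> (\<lambda>x. P (shift g x))"
proof -
  have "P -` {v} \<in> sets \<mu>" for v using simple_functionD(2)[OF assms, of "{v}"] by simp
  then have "shift g -` (P -` {v}) \<in> sets \<mu>" for v
    using measurable_sets[OF measurable_shift_mu] by fastforce
  moreover have "finite (range (\<lambda>x. P (shift g x)))"
    using simple_functionD(1)[OF assms] by (auto intro: finite_subset[rotated])
  ultimately show ?thesis by (simp add: simple_function_def vimage_def)
qed

lemma shannon_shift:
  assumes "simple_function \<mu> P"
  shows "shannon \<mu> (\<lambda>x. P (shift g x)) = shannon \<mu> P"
proof (rule shannon_transfer[where V = "range P"])
  show "finite (range P)" using simple_functionD(1)[OF assms] by simp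
  fix v
  have "P -` {v} \<in> sets \<mu>" using simple_functionD(2)[OF assms, of "{v}"] by simp
  then show "measure \<mu> ((\<lambda>x. P (shift g x)) -` {v} \<inter> space \<mu>) = measure \<mu> (P -` {v} \<inter> space \<mu>)"
    using measure_shift_vimage[of "P -` {v}" g] by (simp add: vimage_def)
qed auto

text \<open>A function of finite sets of sites, as the subadditivity argument requires; on
  \<open>cube n\<close> it is the entropy of \<open>join n P\<close>. The label type is free because
  error variables take values in an option type.\<close>

definition part_entropy :: "(('a, 'b) config \<Rightarrow> 'v) \<Rightarrow> ('a \<Rightarrow> int) set \<Rightarrow> real" where
  "part_entropy P S = shannon \<mu> (\<lambda>x. restrict (\<lambda>g. P (shift g x)) S)"

lemmas simple_shift_family = simple_function_family[OF _ simple_shift]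

lemma part_entropy_translate:
  assumes P: "simple_function \<mu> P" and S: "finite S"
  shows "part_entropy P ((+) g ` S) = part_entropy P S"
proof -
  have S': "finite ((+) g ` S)" using S by simp
  have "part_entropy P S = shannon \<mu> (\<lambda>x. restrict (\<lambda>h. P (shift h (shift g x))) S)"
    unfolding part_entropy_def by (rule shannon_shift[OF simple_shift_family[OF S P], symmetric])
  also have "\<dots> = part_entropy P ((+) g ` S)"
  proof (rule antisym)
    show "shannon \<mu> (\<lambda>x. restrict (\<lambda>h. P (shift h (shift g x))) S) \<le> part_entropy P ((+) g ` S)"
      unfolding part_entropy_def
      by (rule shannon_le_of_factor[OF prob_space_axioms simple_shift_family[OF S' P]])
        (simp add: restrict_eq_iff shift_shift add.commute)
    show "part_entropy P ((+) g ` S) \<le> shannon \<mu> (\<lambda>x. restrict (\<lambda>h. P (shift h (shift g x))) S)"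
      unfolding part_entropy_def
      by (rule shannon_le_of_factor[OF prob_space_axioms simple_shift[OF simple_shift_family[OF S P]]])
        (simp add: restrict_eq_iff shift_shift add.commute)
  qed
  finally show ?thesis by simp
qed

lemma part_entropy_limit:
  assumes P: "simple_function \<mu> P"
  shows "\<exists>L. (\<lambda>n. part_entropy P (cube n) / real n ^ CARD('a)) \<longlonglongrightarrow> L
    \<and> (\<forall>k>0. L \<le> part_entropy P (cube k) / real k ^ CARD('a))"
proof (rule cube_subadditive_limit)
  fix S T :: "('a \<Rightarrow> int) set"
  show "part_entropy P (S \<union> T) \<le> part_entropy P S + part_entropy P T" if "finite S" "finite T"
    unfolding part_entropy_def using that by (intro shannon_family_Un prob_space_axioms simple_shift P)
  show "part_entropy P S \<le> part_entropy P T" if "finite T" "S \<subseteq> T"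
    unfolding part_entropy_def using that by (intro shannon_family_mono prob_space_axioms simple_shift P)
  show "part_entropy P {} = 0"
    unfolding part_entropy_def by (intro shannon_family_empty prob_space_axioms simple_shift P)
qed (rule part_entropy_translate[OF P])

lemma entropy_part_eq: "entropy_part \<mu> P = lim (\<lambda>n. part_entropy P (cube n) / real n ^ CARD('a))"
  unfolding entropy_part_def join_def[abs_def] part_entropy_def hcube_def ..

definition pattern_entropy :: "('a \<Rightarrow> int) set \<Rightarrow> real" where
  "pattern_entropy S = shannon \<mu> (\<lambda>x. restrict x S)"

lemma pattern_entropy_eq: "pattern_entropy S = part_entropy (\<lambda>x. x 0) S"
  unfolding pattern_entropy_def part_entropy_def by (simp add: shift_eq)

definition entropy_rate :: real where
  "entropy_rate = lim (\<lambda>n. pattern_entropy (cube n) / real n ^ CARD('a))"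

text \<open>The second claim holds because the limit is an infimum. It bounds the entropy on one
  finite cube from below with no error term.\<close>

lemma entropy_rate:
  "(\<lambda>n. pattern_entropy (cube n) / real n ^ CARD('a)) \<longlonglongrightarrow> entropy_rate"
  "k > 0 \<Longrightarrow> entropy_rate \<le> pattern_entropy (cube k) / real k ^ CARD('a)"
  using part_entropy_limit[OF simple_coordinate[of 0]]
  unfolding entropy_rate_def pattern_entropy_eq by (auto dest: limI)

text \<open>Members of \<open>finite_partitions\<close> have labels in \<open>nat\<close>, so the
  symbol at the origin enters through an injective coding of the alphabet.\<close>

lemma part_entropy_inj:
  assumes "finite S" "inj f"
  shows "part_entropy (\<lambda>x. f (x 0)) S = pattern_entropy S"
proof (rule antisym)
  have *: "simple_function \<mu> (\<lambda>x. f (x 0))"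
    using simple_function_compose[OF simple_coordinate[of 0], of f] by (simp add: o_def)
  show "part_entropy (\<lambda>x. f (x 0)) S \<le> pattern_entropy S"
    unfolding part_entropy_def pattern_entropy_def
    by (rule shannon_le_of_factor[OF prob_space_axioms simple_restrict[OF assms(1)]])
      (simp add: restrict_eq_iff shift_eq)
  show "pattern_entropy S \<le> part_entropy (\<lambda>x. f (x 0)) S"
    unfolding part_entropy_def pattern_entropy_def
    by (rule shannon_le_of_factor[OF prob_space_axioms simple_shift_family[OF assms(1) *]])
      (use assms(2) in \<open>simp add: restrict_eq_iff shift_eq inj_eq\<close>)
qed

text \<open>Working with the entropy of the error variable, where \<open>P\<close> and its approximation differ,
  avoids conditional entropies in the generator theorem.\<close>

lemma partition_approx:
  fixes P :: "('a, 'b) config \<Rightarrow> 'v"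
  assumes P: "simple_function \<mu> P" and e: "e > 0"
  shows "\<exists>m (P' :: ('a, 'b) config \<Rightarrow> 'v) (E :: ('a, 'b) config \<Rightarrow> 'v option). (\<forall>x y. (\<forall>g\<in>box m. x g = y g) \<longrightarrow> P' x = P' y) \<and>
    simple_function \<mu> E \<and> shannon \<mu> E \<le> e \<and>
    (\<forall>x y. P' x = P' y \<longrightarrow> E x = E y \<longrightarrow> P x = P y)"
proof -
  define V where "V = range P"
  have V: "finite V" using simple_functionD(1)[OF P] by (simp add: V_def)
  have Vc: "card V > 0" using V by (simp add: V_def card_gt_0_iff)
  \<comment> \<open>Chosen so that \<open>shannon_le_of_concentrated\<close> yields
    \<open>e\<close>: the error variable takes at most \<open>card V + 1\<close> values, the labels
    and \<open>None\<close>.\<close>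
  define t where "t = min 1 ((e / (2 * (real (card V) + 1)))\<^sup>2)"
  have t: "0 < t" "t \<le> 1" using e by (auto simp: t_def)
  have "sqrt t \<le> e / (2 * (real (card V) + 1))"
    using e by (intro real_le_lsqrt) (auto simp: t_def)
  then have te: "(real (card V) + 1) * (2 * sqrt t) \<le> e" by (simp add: field_simps)
  have meas: "P -` {v} \<in> sets \<mu>" for v using simple_functionD(2)[OF P, of "{v}"] by simp
  have "\<exists>m C. (\<forall>x y. (\<forall>g\<in>box m. x g = y g) \<longrightarrow> (x \<in> C \<longleftrightarrow> y \<in> C)) \<and>
    measure \<mu> ((P -` {v} - C) \<union> (C - P -` {v})) < t / card V" for v
    by (rule cylinder_approx[OF meas]) (use t Vc in auto)
  then obtain m C where C: "\<And>v. \<forall>x y. (\<forall>g\<in>box (m v). x g = y g) \<longrightarrow> (x \<in> C v \<longleftrightarrow> y \<in> C v)"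
    "\<And>v. measure \<mu> ((P -` {v} - C v) \<union> (C v - P -` {v})) < t / card V" by metis
  have Cm: "C v \<in> sets \<mu>" for v using C(1)[of v] by (intro sets_finite_dep[of "box (m v)"]) auto
  define mm where "mm = Max (m ` V)"
  have mm: "box (m v) \<subseteq> (box mm :: ('a \<Rightarrow> int) set)" if "v \<in> V" for v
    using that V by (intro box_mono) (auto simp: mm_def)
  \<comment> \<open>If no label or several labels fit, the choice is arbitrary; wherever it is
    wrong, \<open>E\<close> stores the correct label.\<close>
  define P' where "P' x = (SOME v. v \<in> V \<and> x \<in> C v)" for x
  have dep: "P' x = P' y" if "\<forall>g\<in>box mm. x g = y g" for x y
  proof -
    have "v \<in> V \<and> x \<in> C v \<longleftrightarrow> v \<in> V \<and> y \<in> C v" for v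
      using C(1)[of v] mm[of v] that by blast
    then show ?thesis unfolding P'_def by presburger
  qed
  define E where "E x = (if P x = P' x then None else Some (P x))" for x
  have sP': "simple_function \<mu> P'" using dep by (intro simple_finite_dep[of "box mm"]) auto
  have sE: "simple_function \<mu> E"
    by (rule simple_function_of_factor[OF simple_function_Pair[OF P sP']]) (simp add: E_def)
  \<comment> \<open>If no approximation errs at \<open>x\<close>, then \<open>P x\<close> is the
    only label in \<open>V\<close> that fits, so the choice in \<open>P'\<close> is forced to be
    right.\<close>
  have "{x \<in> space \<mu>. E x \<noteq> None} \<subseteq> (\<Union>v\<in>V. (P -` {v} - C v) \<union> (C v - P -` {v}))"
  proof (intro subsetI, rule ccontr)
    fix x assume "x \<in> {x \<in> space \<mu>. E x \<noteq> None}"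
    then have x: "E x \<noteq> None" by simp
    assume n: "x \<notin> (\<Union>v\<in>V. (P -` {v} - C v) \<union> (C v - P -` {v}))"
    have nv: "x \<notin> (P -` {v} - C v) \<union> (C v - P -` {v})" if "v \<in> V" for v
      using n that by blast
    have "P x \<in> V" by (simp add: V_def)
    with nv[of "P x"] have "P x \<in> V \<and> x \<in> C (P x)" by simp
    then have "P' x \<in> V \<and> x \<in> C (P' x)" unfolding P'_def by (rule someI)
    then have "P x = P' x" using nv[of "P' x"] by simp
    then show False using x by (simp add: E_def)
  qed
  then have "measure \<mu> {x \<in> space \<mu>. E x \<noteq> None} \<le> measure \<mu> (\<Union>v\<in>V. (P -` {v} - C v) \<union> (C v - P -` {v}))"
    using meas Cm V by (intro finite_measure_mono sets.finite_UN) auto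
  also have "\<dots> \<le> (\<Sum>v\<in>V. measure \<mu> ((P -` {v} - C v) \<union> (C v - P -` {v})))"
    using meas Cm V by (intro finite_measure_subadditive_finite) auto
  also have "\<dots> \<le> (\<Sum>v\<in>V. t / card V)" using C(2) by (intro sum_mono less_imp_le) auto
  also have "\<dots> = t" using Vc by simp
  finally have *: "measure \<mu> {x \<in> space \<mu>. E x \<noteq> None} \<le> t" .
  have "shannon \<mu> E \<le> real (card (insert None (Some ` V))) * (2 * sqrt t)"
    by (rule shannon_le_of_concentrated[OF prob_space_axioms sE _ _ * t(2)])
      (use V in \<open>auto simp: E_def V_def\<close>)
  also have "card (insert None (Some ` V)) = card V + 1"
    using V by (simp add: card_image)
  finally have "shannon \<mu> E \<le> e" using te by (simp add: algebra_simps)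
  moreover have "P x = P y" if "P' x = P' y" "E x = E y" for x y
    using that by (auto simp: E_def split: if_splits)
  ultimately show ?thesis using dep sE by blast
qed

text \<open>The labels along \<open>cube n\<close> are determined by the symbols in the cube
  fattened by \<open>m\<close> together with the error variables. Fattening changes the volume by a
  factor tending to 1, and the errors add at most \<open>e\<close> per site.\<close>

theorem entropy_part_le_rate:
  fixes P :: "('a, 'b) config \<Rightarrow> nat"
  assumes P: "simple_function \<mu> P"
  shows "entropy_part \<mu> P \<le> entropy_rate"
proof (rule field_le_epsilon)
  fix e :: real assume e: "e > 0"
  obtain m and P' :: "('a, 'b) config \<Rightarrow> nat" and E :: "('a, 'b) config \<Rightarrow> nat option"
    where P': "\<And>x y. (\<forall>g\<in>box m. x g = y g) \<Longrightarrow> P' x = P' y"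
    and E: "simple_function \<mu> E" "shannon \<mu> E \<le> e"
    and PE: "\<And>x y. P' x = P' y \<Longrightarrow> E x = E y \<Longrightarrow> P x = P y"
    using partition_approx[OF P e] by metis
  have bound: "part_entropy P (cube n) \<le> pattern_entropy (cube (n + 2 * m)) + real n ^ CARD('a) * e" for n
  proof -
    define B where "B = (hcube (- int m) (int (n + m)) :: ('a \<Rightarrow> int) set)"
    have fB: "finite B" by (simp add: B_def)
    have fC: "finite (cube n :: ('a \<Rightarrow> int) set)" by simp
    have B: "B = (+) (\<lambda>_. - int m) ` cube (n + 2 * m)"
    proof -
      have "h \<in> B \<longleftrightarrow> h - (\<lambda>_. - int m) \<in> cube (n + 2 * m)" for h
      proof -
        have "- int m \<le> h i \<and> h i < int (n + m) \<longleftrightarrow>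
            0 \<le> (h - (\<lambda>_. - int m)) i \<and> (h - (\<lambda>_. - int m)) i < int (n + 2 * m)" for i
          by auto
        then show ?thesis by (simp add: B_def hcube_def)
      qed
      then show ?thesis unfolding translate_hcube by blast
    qed
    have "part_entropy P (cube n) \<le>
        shannon \<mu> (\<lambda>x. (restrict x B, restrict (\<lambda>g. E (shift g x)) (cube n)))"
      unfolding part_entropy_def
    proof (rule shannon_le_of_factor[OF prob_space_axioms
          simple_function_Pair[OF simple_restrict[OF fB] simple_shift_family[OF fC E(1)]]])
      fix x y
      assume "(restrict x B, restrict (\<lambda>g. E (shift g x)) (cube n)) =
        (restrict y B, restrict (\<lambda>g. E (shift g y)) (cube n))"
      then have x: "\<forall>g\<in>B. x g = y g" and Ex: "\<forall>g\<in>cube n. E (shift g x) = E (shift g y)"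
        by (simp_all add: restrict_eq_iff)
      have "P (shift g x) = P (shift g y)" if g: "g \<in> cube n" for g
      proof (rule PE)
        show "P' (shift g x) = P' (shift g y)"
        proof (rule P', intro ballI)
          fix h :: "'a \<Rightarrow> int" assume "h \<in> box m"
          then have "- int m \<le> h i \<and> h i \<le> int m \<and> 0 \<le> g i \<and> g i < int n" for i
            using g by (auto simp: box_eq_hcube hcube_def)
          then have "- int m \<le> h i + g i \<and> h i + g i < int (n + m)" for i by (smt (verit) of_nat_add)
          then have "h + g \<in> B" by (auto simp: B_def hcube_def)
          then show "shift g x h = shift g y h" using x by (simp add: shift_eq)
        qed
      qed (use Ex g in auto)
      then show "restrict (\<lambda>g. P (shift g x)) (cube n) = restrict (\<lambda>g. P (shift g y)) (cube n)"
        by (simp add: restrict_eq_iff)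
    qed
    also have "\<dots> \<le> pattern_entropy B + part_entropy E (cube n)"
      unfolding pattern_entropy_def part_entropy_def
      by (intro shannon_Pair_le prob_space_axioms simple_restrict simple_shift_family fB fC E)
    also have "pattern_entropy B = pattern_entropy (cube (n + 2 * m))"
      unfolding B pattern_entropy_eq
      by (rule part_entropy_translate[OF simple_coordinate]) simp
    also have "part_entropy E (cube n) \<le> (\<Sum>g\<in>(cube n :: ('a \<Rightarrow> int) set). shannon \<mu> (\<lambda>x. E (shift g x)))"
      unfolding part_entropy_def
      by (rule shannon_family_le_sum[OF prob_space_axioms simple_shift[OF E(1)] fC])
    also have "\<dots> = real n ^ CARD('a) * shannon \<mu> E"
      by (simp add: shannon_shift[OF E(1)] card_hcube)
    also have "\<dots> \<le> real n ^ CARD('a) * e" using E(2) by (intro mult_left_mono) auto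
    finally show ?thesis by simp
  qed
  obtain L where L: "(\<lambda>n. part_entropy P (cube n) / real n ^ CARD('a)) \<longlonglongrightarrow> L"
    using part_entropy_limit[OF P] by blast
  then have "entropy_part \<mu> P = L" unfolding entropy_part_eq by (rule limI)
  moreover have "L \<le> entropy_rate + e"
  proof (rule tendsto_le[OF _ _ L])
    have "(\<lambda>n. pattern_entropy (cube (n + 2 * m)) / real (n + 2 * m) ^ CARD('a)) \<longlonglongrightarrow> entropy_rate"
      by (rule LIMSEQ_ignore_initial_segment[OF entropy_rate(1)])
    from tendsto_mult[OF this cube_ratio_tendsto[of "real (2 * m)" "CARD('a)"]]
    have "(\<lambda>n. pattern_entropy (cube (n + 2 * m)) / real (n + 2 * m) ^ CARD('a)
        * ((real n + real (2 * m)) ^ CARD('a) / real n ^ CARD('a))) \<longlonglongrightarrow> entropy_rate"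
      by simp
    then show "(\<lambda>n. pattern_entropy (cube (n + 2 * m)) / real (n + 2 * m) ^ CARD('a)
        * ((real n + real (2 * m)) ^ CARD('a) / real n ^ CARD('a)) + e) \<longlonglongrightarrow> entropy_rate + e"
      by (intro tendsto_add tendsto_const)
    show "\<forall>\<^sub>F n in sequentially. part_entropy P (cube n) / real n ^ CARD('a)
      \<le> pattern_entropy (cube (n + 2 * m)) / real (n + 2 * m) ^ CARD('a)
        * ((real n + real (2 * m)) ^ CARD('a) / real n ^ CARD('a)) + e"
      using eventually_gt_at_top[of 0]
    proof eventually_elim
      case (elim n)
      then show ?case using bound[of n] by (simp add: field_simps)
    qed
  qed simp
  ultimately show "entropy_part \<mu> P \<le> entropy_rate + e" by simp
qed

text \<open>The supremum is attained, by the partition according to the symbol at the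
  origin.\<close>

theorem ks_entropy_eq_rate: "ks_entropy \<mu> = entropy_rate"
  unfolding ks_entropy_def
proof (rule cSup_eq_maximum)
  obtain f :: "'b \<Rightarrow> nat" where f: "inj f" using finite_imp_inj_to_nat_seg[of "UNIV :: 'b set"] by auto
  have "(\<lambda>x :: ('a, 'b) config. f (x 0)) \<in> measurable shift_space (count_space UNIV)"
    using measurable_compose[OF measurable_coordinate[of 0] measurable_count_space[of f]] .
  moreover have "finite (range (\<lambda>x :: ('a, 'b) config. f (x 0)))"
    by (rule finite_subset[of _ "range f"]) auto
  ultimately have "(\<lambda>x :: ('a, 'b) config. f (x 0)) \<in> finite_partitions" by (simp add: finite_partitions_def)
  moreover have "entropy_part \<mu> (\<lambda>x. f (x 0)) = entropy_rate"
    unfolding entropy_part_eq entropy_rate_def by (simp add: part_entropy_inj[OF _ f])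
  ultimately show "entropy_rate \<in> entropy_part \<mu> ` finite_partitions" by (metis imageI)
next
  fix y assume "y \<in> entropy_part \<mu> ` finite_partitions"
  then obtain P where P: "y = entropy_part \<mu> P" "P \<in> measurable shift_space (count_space UNIV)"
    "finite (range P)" by (auto simp: finite_partitions_def)
  then have "simple_function \<mu> P"
    using measurable_sets[of P \<mu> "count_space UNIV"] by (auto simp: simple_function_def measurable_mu)
  then show "y \<le> entropy_rate" unfolding P(1) by (rule entropy_part_le_rate)
qed

end

section \<open>Energy estimates\<close>

lemma power_diff_le:
  fixes x y :: real
  assumes "0 \<le> y" "y \<le> x"
  shows "x ^ n - y ^ n \<le> real n * (x - y) * x ^ (n - 1)"
proof (induction n)
  case (Suc n)
  have "x ^ Suc n - y ^ Suc n = x * (x ^ n - y ^ n) + (x - y) * y ^ n" by (simp add: algebra_simps)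
  also have "\<dots> \<le> x * (real n * (x - y) * x ^ (n - 1)) + (x - y) * x ^ n"
    using assms Suc by (intro add_mono mult_left_mono power_mono) auto
  also have "\<dots> = real (Suc n) * (x - y) * x ^ (Suc n - 1)"
    by (cases n) (simp_all add: algebra_simps)
  finally show ?case .
qed simp

lemma boundary_ratio_tendsto:
  "(\<lambda>n. (real n ^ d - (real n - c) ^ d) / real n ^ d) \<longlonglongrightarrow> 0"
proof -
  have "(\<lambda>n. 1 - (real n + (- c)) ^ d / real n ^ d) \<longlonglongrightarrow> 1 - 1"
    by (intro tendsto_diff tendsto_const cube_ratio_tendsto)
  then have "(\<lambda>n. 1 - (real n - c) ^ d / real n ^ d) \<longlonglongrightarrow> 0" by simp
  then show ?thesis
    by (rule Lim_transform_eventually)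
      (use eventually_gt_at_top[of 0] in eventually_elim, simp add: diff_divide_distrib)
qed

lemma card_box: "real (card (box j :: ('d::finite \<Rightarrow> int) set)) = (2 * real j + 1) ^ CARD('d)"
  unfolding box_eq_hcube by (subst real_card_hcube) auto

lemma translate_box_subset:
  assumes "g \<in> hcube (int k) (int n - int k)" "h \<in> box k"
  shows "h + g \<in> cube n"
proof -
  have "- int k \<le> h i \<and> h i \<le> int k \<and> int k \<le> g i \<and> g i < int n - int k" for i
    using assms by (auto simp: box_eq_hcube hcube_def)
  then have "0 \<le> h i + g i \<and> h i + g i < int n" for i by (smt (verit))
  then show ?thesis by (simp add: hcube_def)
qed

lemma box_uminus: "h \<in> box k \<Longrightarrow> - h \<in> box k"
  by (simp add: box_def)

lemma compact_shift_topology: "compact_space (shift_topology :: ('d, 'a::finite) config topology)"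
  unfolding shift_topology_def compact_space_product_topology
  by (auto simp: compact_space_discrete_topology)

section \<open>Variations of the potential and single-site influences\<close>

locale summable_potential =
  fixes \<phi> :: "('d::finite, 'a::finite) config \<Rightarrow> real"
  assumes cont: "continuous_map shift_topology euclideanreal \<phi>"
    and summ: "summable (\<lambda>n. real (Suc n) ^ (CARD('d) - 1) * var (Suc n) \<phi>)"
begin

text \<open>\<open>Sup\<close> on the reals is informative only for bounded sets; compactness
  supplies the bound behind \<open>osc\<close>, \<open>var\<close> and
  \<open>influence\<close>.\<close>

lemma bounded_range: "\<exists>K. \<forall>x. \<bar>\<phi> x\<bar> \<le> K"
proof -
  have ts: "topspace (shift_topology :: ('d, 'a) config topology) = UNIV"
    by (simp add: shift_topology_def)
  have "compactin euclideanreal (\<phi> ` UNIV)"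
    using image_compactin[OF _ cont, of UNIV] compact_shift_topology[where 'a = 'a and 'd = 'd]
    by (simp add: compact_space_def ts)
  then have "bounded (range \<phi>)" by (simp add: compact_imp_bounded)
  then show ?thesis by (auto simp: bounded_iff)
qed

definition osc :: real where "osc = Sup (range (\<lambda>(x, y). \<bar>\<phi> x - \<phi> y\<bar>))"

lemma bdd_above_osc: "bdd_above (range (\<lambda>(x, y). \<bar>\<phi> x - \<phi> y\<bar>))"
proof -
  obtain K where "\<And>x. \<bar>\<phi> x\<bar> \<le> K" using bounded_range by auto
  then have "\<bar>\<phi> x - \<phi> y\<bar> \<le> K + K" for x y
    using abs_triangle_ineq4[of "\<phi> x" "\<phi> y"] by (meson add_mono order_trans)
  then show ?thesis by (auto intro!: bdd_aboveI[of _ "K + K"])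
qed

lemma diff_le_osc: "\<bar>\<phi> x - \<phi> y\<bar> \<le> osc"
  unfolding osc_def by (rule cSup_upper[OF _ bdd_above_osc]) auto

lemma bdd_above_var: "bdd_above {\<bar>\<phi> x - \<phi> y\<bar> |x y. R x y}"
  by (rule bdd_above_mono[OF bdd_above_osc]) auto

lemma diff_le_var: "(\<And>g. g \<in> box n \<Longrightarrow> x g = y g) \<Longrightarrow> \<bar>\<phi> x - \<phi> y\<bar> \<le> var n \<phi>"
  unfolding var_def by (rule cSup_upper[OF _ bdd_above_var]) auto

lemma var_nonneg: "0 \<le> var n \<phi>"
  using diff_le_var[of n undefined undefined] by simp

lemma var_tendsto_0: "(\<lambda>n. var n \<phi>) \<longlonglongrightarrow> 0"
proof -
  have lim: "(\<lambda>n. real (Suc n) ^ (CARD('d) - 1) * var (Suc n) \<phi>) \<longlonglongrightarrow> 0"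
    using summ by (rule summable_LIMSEQ_zero)
  have "(\<lambda>n. var (Suc n) \<phi>) \<longlonglongrightarrow> 0"
  proof (rule tendsto_sandwich[OF _ _ tendsto_const lim])
    show "\<forall>\<^sub>F n in sequentially. var (Suc n) \<phi> \<le> real (Suc n) ^ (CARD('d) - 1) * var (Suc n) \<phi>"
    proof (rule always_eventually, rule allI)
      fix n
      have "1 * var (Suc n) \<phi> \<le> real (Suc n) ^ (CARD('d) - 1) * var (Suc n) \<phi>"
        by (intro mult_right_mono var_nonneg one_le_power) simp
      then show "var (Suc n) \<phi> \<le> real (Suc n) ^ (CARD('d) - 1) * var (Suc n) \<phi>" by simp
    qed
  qed (simp add: var_nonneg)
  then show ?thesis by (rule LIMSEQ_imp_Suc)
qed

text \<open>\<open>\<phi>\<close> is a pointwise limit of functions of finitely many coordinates.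
  Here \<open>restrict\<close> is read as filling the outside of the box with the fixed symbol
  \<open>undefined\<close>, so its result is again a configuration.\<close>

lemma borel_measurable_potential:
  assumes "config_measure \<mu>"
  shows "\<phi> \<in> borel_measurable \<mu>"
proof -
  interpret config_measure \<mu> by fact
  have "(\<lambda>x. \<phi> (restrict x (box n))) \<in> borel_measurable \<mu>" for n
    by (intro borel_measurable_simple_function simple_finite_dep[of "box n"])
      (auto intro!: arg_cong[where f = \<phi>] restrict_ext)
  moreover have "(\<lambda>n. \<phi> (restrict x (box n))) \<longlonglongrightarrow> \<phi> x" for x
  proof (rule tendsto_norm_zero_cancel[THEN LIM_zero_cancel])
    show "(\<lambda>n. norm (\<phi> (restrict x (box n)) - \<phi> x)) \<longlonglongrightarrow> 0"
      by (rule tendsto_sandwich[OF _ _ tendsto_const var_tendsto_0]) (auto intro!: always_eventually diff_le_var)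
  qed
  ultimately show ?thesis by (rule borel_measurable_LIMSEQ_real[rotated])
qed

lemma integrable_potential:
  assumes "config_measure \<mu>"
  shows "integrable \<mu> \<phi>"
proof -
  interpret config_measure \<mu> by fact
  obtain K where K: "\<And>x. \<bar>\<phi> x\<bar> \<le> K" using bounded_range by auto
  show ?thesis
    by (rule integrable_const_bound[of _ K]) (use K borel_measurable_potential[OF assms] in auto)
qed

text \<open>Apart from the decay of \<open>var n \<phi>\<close>, the summability hypothesis is used
  in the form that these single-site oscillations have a finite sum over the lattice.\<close>

definition influence :: "('d \<Rightarrow> int) \<Rightarrow> real" where
  "influence g = Sup {\<bar>\<phi> x - \<phi> y\<bar> |x y. \<forall>h. h \<noteq> g \<longrightarrow> x h = y h}"

lemma diff_le_influence: "(\<And>h. h \<noteq> g \<Longrightarrow> x h = y h) \<Longrightarrow> \<bar>\<phi> x - \<phi> y\<bar> \<le> influence g"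
  unfolding influence_def by (rule cSup_upper[OF _ bdd_above_var]) auto

lemma influence_nonneg: "0 \<le> influence g"
  using diff_le_influence[of g undefined undefined] by simp

lemma influence_le_var: "g \<notin> box n \<Longrightarrow> influence g \<le> var n \<phi>"
  unfolding influence_def by (rule cSup_least) (auto intro!: diff_le_var)

text \<open>Pass from \<open>x\<close> to \<open>y\<close> by changing the sites of \<open>F\<close>
  one at a time.\<close>

lemma diff_le_sum_influence:
  assumes "finite F" "\<And>h. h \<notin> F \<Longrightarrow> x h = y h"
  shows "\<bar>\<phi> x - \<phi> y\<bar> \<le> (\<Sum>p\<in>F. influence p)"
  using assms
proof (induction arbitrary: x rule: finite_induct)
  case empty
  then have "x = y" by auto
  then show ?case by simp
next
  case (insert p F)
  have "\<bar>\<phi> (x(p := y p)) - \<phi> y\<bar> \<le> (\<Sum>p\<in>F. influence p)"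
    using insert by (intro insert.IH) auto
  moreover have "\<bar>\<phi> x - \<phi> (x(p := y p))\<bar> \<le> influence p"
    by (rule diff_le_influence) auto
  ultimately have "\<bar>\<phi> x - \<phi> y\<bar> \<le> influence p + (\<Sum>p\<in>F. influence p)" by linarith
  then show ?case using insert by simp
qed

text \<open>The number of lattice points on a sphere of radius \<open>j\<close> is of order \<open>j^(d-1)\<close>; this is
  where the summability hypothesis enters.\<close>

lemma influence_sums_bounded: "\<exists>K. \<forall>m. (\<Sum>g\<in>box m. influence g) \<le> K"
proof -
  define A where "A m = (\<Sum>g\<in>(box m :: ('d \<Rightarrow> int) set). influence g)" for m
  \<comment> \<open>From \<open>power_diff_le\<close> applied to a shell: 2 is the growth of the
    side length, and 5 comes from \<open>2 * (n + 2) + 1 \<le> 5 * (n + 1)\<close>.\<close>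
  define C where "C = 2 * real (CARD('d)) * 5 ^ (CARD('d) - 1)"
  define b where "b n = real (Suc n) ^ (CARD('d) - 1) * var (Suc n) \<phi>" for n
  have step: "A (Suc (Suc n)) \<le> A (Suc n) + C * b n" for n
  proof -
    let ?S = "box (Suc (Suc n)) - box (Suc n) :: ('d \<Rightarrow> int) set"
    have sub: "box (Suc n) \<subseteq> (box (Suc (Suc n)) :: ('d \<Rightarrow> int) set)" by (rule box_mono) simp
    have "A (Suc (Suc n)) = A (Suc n) + sum influence ?S"
      unfolding A_def using sum.subset_diff[OF sub, of influence] by simp
    moreover have "sum influence ?S \<le> real (card ?S) * var (Suc n) \<phi>"
      by (rule sum_bounded_above) (auto intro: influence_le_var)
    moreover have "real (card ?S) * var (Suc n) \<phi> \<le> C * b n"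
    proof -
      have "real (card ?S) = (2 * real (Suc (Suc n)) + 1) ^ CARD('d) - (2 * real (Suc n) + 1) ^ CARD('d)"
        using sub by (simp add: card_Diff_subset of_nat_diff card_mono card_box del: of_nat_Suc)
      also have "\<dots> \<le> real (CARD('d)) * (2 * real (Suc (Suc n)) + 1 - (2 * real (Suc n) + 1))
          * (2 * real (Suc (Suc n)) + 1) ^ (CARD('d) - 1)"
        by (rule power_diff_le) auto
      also have "\<dots> \<le> real (CARD('d)) * 2 * (5 * real (Suc n)) ^ (CARD('d) - 1)"
        by (intro mult_mono power_mono) auto
      also have "\<dots> = C * real (Suc n) ^ (CARD('d) - 1)" by (simp only: C_def power_mult_distrib)
      finally show ?thesis
        unfolding b_def using mult_right_mono[OF _ var_nonneg] by (metis mult.assoc)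
    qed
    ultimately show ?thesis by simp
  qed
  have b0: "0 \<le> b n" for n by (simp add: b_def var_nonneg)
  have C0: "0 \<le> C" by (simp add: C_def)
  have "A (Suc m) \<le> A 1 + C * (\<Sum>n<m. b n)" for m
  proof (induction m)
    case (Suc m)
    then show ?case using step[of m] by (simp add: algebra_simps)
  qed simp
  moreover have "(\<Sum>n<m. b n) \<le> suminf b" for m
    using summ b0 unfolding b_def[abs_def] by (intro sum_le_suminf) auto
  ultimately have "A (Suc m) \<le> A 1 + C * suminf b" for m
    using C0 by (meson add_left_mono mult_left_mono order_trans)
  moreover have "A m \<le> A (Suc m)" for m
    unfolding A_def by (intro sum_mono2) (auto simp: influence_nonneg intro: box_mono[THEN subsetD, rotated])
  ultimately show ?thesis unfolding A_def by (meson order_trans)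
qed

definition total_influence :: real where
  "total_influence = (SUP m. \<Sum>g\<in>box m. influence g)"

lemma bdd_above_influence_sums: "bdd_above (range (\<lambda>m. \<Sum>g\<in>box m. influence g))"
  using influence_sums_bounded by (auto intro: bdd_aboveI)

lemma sum_influence_le:
  assumes "finite W"
  shows "(\<Sum>g\<in>W. influence g) \<le> total_influence"
proof -
  obtain m where m: "W \<subseteq> box m" using subset_box[OF assms] by auto
  have "(\<Sum>g\<in>W. influence g) \<le> (\<Sum>g\<in>box m. influence g)"
    using m by (intro sum_mono2) (auto simp: influence_nonneg)
  also have "\<dots> \<le> total_influence"
    unfolding total_influence_def by (rule cSUP_upper[OF _ bdd_above_influence_sums]) simp
  finally show ?thesis .
qed

lemma total_influence_nonneg: "0 \<le> total_influence"
  using sum_influence_le[of "{}"] by simp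

text \<open>Take a box whose sum is within \<open>e\<close> of the total; a disjoint finite set
  contributing more than \<open>e\<close> would push the sum above the total.\<close>

lemma influence_tail:
  assumes "e > 0"
  shows "\<exists>k. \<forall>W. finite W \<longrightarrow> W \<inter> box k = {} \<longrightarrow> (\<Sum>g\<in>W. influence g) \<le> e"
proof -
  have "total_influence - e < total_influence" using assms by simp
  then obtain k where k: "total_influence - e < (\<Sum>g\<in>box k. influence g)"
    using less_cSUP_iff[OF _ bdd_above_influence_sums, of "total_influence - e"]
    by (auto simp: total_influence_def)
  have "(\<Sum>g\<in>W. influence g) \<le> e" if W: "finite W" "W \<inter> box k = {}" for W
  proof -
    have "(\<Sum>g\<in>W. influence g) + (\<Sum>g\<in>box k. influence g) = (\<Sum>g\<in>W \<union> box k. influence g)"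
      using W by (subst sum.union_disjoint) auto
    also have "\<dots> \<le> total_influence" using W by (intro sum_influence_le) auto
    finally show ?thesis using k by simp
  qed
  then show ?thesis by blast
qed

section \<open>Energies (Birkhoff sums) over finite windows\<close>

definition energy :: "('d \<Rightarrow> int) set \<Rightarrow> ('d, 'a) config \<Rightarrow> real" where
  "energy W x = (\<Sum>g\<in>W. \<phi> (shift g x))"

lemma shift_diff_le_sum_influence:
  assumes "finite F" "\<And>h. h \<notin> F \<Longrightarrow> x h = y h"
  shows "\<bar>\<phi> (shift g x) - \<phi> (shift g y)\<bar> \<le> (\<Sum>p\<in>F. influence (p - g))"
proof -
  have "\<bar>\<phi> (shift g x) - \<phi> (shift g y)\<bar> \<le> (\<Sum>q\<in>(\<lambda>p. p - g) ` F. influence q)"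
  proof (rule diff_le_sum_influence)
    fix h assume h: "h \<notin> (\<lambda>p. p - g) ` F"
    have "h + g \<notin> F"
    proof
      assume "h + g \<in> F"
      then have "(h + g) - g \<in> (\<lambda>p. p - g) ` F" by (rule imageI)
      then show False using h by simp
    qed
    then show "shift g x h = shift g y h" using assms(2) by (simp add: shift_eq)
  qed (use assms in simp)
  also have "\<dots> = (\<Sum>p\<in>F. influence (p - g))"
    by (rule sum.reindex_cong[of "\<lambda>p. p - g"]) (auto simp: inj_on_def)
  finally show ?thesis .
qed

text \<open>A changed site \<open>p\<close> is seen from \<open>g\<close> at the relative position
  \<open>p - g\<close>. Summing over \<open>g\<close> first keeps the dependence on
  \<open>W\<close>, so that the bound yields both the estimate by \<open>total_influence\<close> and
  tail estimates for distant windows.\<close>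

lemma energy_diff_le_influence:
  assumes "finite F" "finite W" "\<And>h. h \<notin> F \<Longrightarrow> x h = y h"
  shows "\<bar>energy W x - energy W y\<bar> \<le> (\<Sum>p\<in>F. \<Sum>q\<in>(\<lambda>g. p - g) ` W. influence q)"
proof -
  have "\<bar>energy W x - energy W y\<bar> \<le> (\<Sum>g\<in>W. \<bar>\<phi> (shift g x) - \<phi> (shift g y)\<bar>)"
    unfolding energy_def sum_subtractf[symmetric] by (rule sum_abs)
  also have "\<dots> \<le> (\<Sum>g\<in>W. \<Sum>p\<in>F. influence (p - g))"
    by (intro sum_mono shift_diff_le_sum_influence assms)
  also have "\<dots> = (\<Sum>p\<in>F. \<Sum>g\<in>W. influence (p - g))" by (rule sum.swap)
  also have "\<dots> = (\<Sum>p\<in>F. \<Sum>q\<in>(\<lambda>g. p - g) ` W. influence q)"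
    by (intro sum.cong sum.reindex_cong[symmetric]) (auto simp: inj_on_def)
  finally show ?thesis .
qed

lemma energy_diff_le:
  assumes "finite F" "finite W" "\<And>h. h \<notin> F \<Longrightarrow> x h = y h"
  shows "\<bar>energy W x - energy W y\<bar> \<le> real (card F) * total_influence"
proof -
  have "(\<Sum>p\<in>F. \<Sum>q\<in>(\<lambda>g. p - g) ` W. influence q) \<le> real (card F) * total_influence"
    using assms by (intro sum_bounded_above sum_influence_le) auto
  then show ?thesis using energy_diff_le_influence[of F W x y, OF assms] by simp
qed

text \<open>Terms based at depth \<open>k\<close> see only symbols of the cube on
  \<open>box k\<close> and change by at most \<open>var k \<phi>\<close>; the remaining boundary
  layer has o(n^d) terms, each changing by at most \<open>osc\<close>.\<close>

lemma energy_restrict_cube: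
  assumes "e > 0"
  shows "\<forall>\<^sub>F n in sequentially. \<forall>x.
    \<bar>energy (cube n) x - energy (cube n) (restrict x (cube n))\<bar> \<le> e * real n ^ CARD('d)"
proof -
  obtain k where k: "var k \<phi> < e / 2"
    using order_tendstoD(2)[OF var_tendsto_0, of "e / 2"] assms by (auto simp: eventually_sequentially)
  have "(\<lambda>n. osc * ((real n ^ CARD('d) - (real n - 2 * real k) ^ CARD('d)) / real n ^ CARD('d))) \<longlonglongrightarrow> osc * 0"
    by (intro tendsto_mult tendsto_const boundary_ratio_tendsto)
  then have "\<forall>\<^sub>F n in sequentially.
      osc * ((real n ^ CARD('d) - (real n - 2 * real k) ^ CARD('d)) / real n ^ CARD('d)) < e / 2"
    using assms by (intro order_tendstoD) auto
  then show ?thesis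
    using eventually_gt_at_top[of "2 * k"]
  proof eventually_elim
    case (elim n)
    define I where "I = (hcube (int k) (int n - int k) :: ('d \<Rightarrow> int) set)"
    have I: "I \<subseteq> cube n" unfolding I_def by (rule hcube_mono) auto
    have cI: "real (card I) = (real n - 2 * real k) ^ CARD('d)"
      unfolding I_def by (subst real_card_hcube) (use elim in \<open>auto simp: algebra_simps\<close>)
    have cC: "real (card (cube n - I)) = real n ^ CARD('d) - (real n - 2 * real k) ^ CARD('d)"
      using I cI by (subst card_Diff_subset)
        (auto simp: I_def of_nat_diff card_mono real_card_hcube)
    show ?case
    proof
      fix x :: "('d, 'a) config"
      let ?y = "restrict x (cube n)"
      let ?D = "\<lambda>g. \<bar>\<phi> (shift g x) - \<phi> (shift g ?y)\<bar>"
      have "\<bar>energy (cube n) x - energy (cube n) ?y\<bar> \<le> (\<Sum>g\<in>cube n. ?D g)"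
        unfolding energy_def sum_subtractf[symmetric] by (rule sum_abs)
      also have "\<dots> = (\<Sum>g\<in>cube n - I. ?D g) + (\<Sum>g\<in>I. ?D g)"
        by (rule sum.subset_diff[OF I]) simp
      also have "(\<Sum>g\<in>cube n - I. ?D g) \<le> real (card (cube n - I)) * osc"
        by (intro sum_bounded_above diff_le_osc)
      also have "(\<Sum>g\<in>I. ?D g) \<le> (\<Sum>g\<in>I. e / 2)"
      proof (intro sum_mono)
        fix g assume "g \<in> I"
        then have "?D g \<le> var k \<phi>"
          by (intro diff_le_var) (simp add: shift_eq translate_box_subset I_def)
        then show "?D g \<le> e / 2" using k by simp
      qed
      also have "(\<Sum>g\<in>I. e / 2) \<le> e / 2 * real n ^ CARD('d)"
      proof -
        have "real (card I) \<le> real n ^ CARD('d)" unfolding cI by (rule power_mono) (use elim in auto)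
        then show ?thesis using assms by (simp add: mult_right_mono mult.commute)
      qed
      also have "real (card (cube n - I)) * osc \<le> e / 2 * real n ^ CARD('d)"
        unfolding cC using elim by (simp add: field_simps)
      finally show "\<bar>energy (cube n) x - energy (cube n) ?y\<bar> \<le> e * real n ^ CARD('d)"
        by simp
    qed
  qed
qed

text \<open>For \<open>p\<close> at depth \<open>k\<close> in the cube, all differences
  \<open>p - g\<close> with \<open>g\<close> outside avoid \<open>box k\<close>, which leaves only
  the tail of the influences. The o(n^d) other sites are charged \<open>total_influence\<close>
  each.\<close>

lemma outside_influence:
  assumes "e > 0"
  shows "\<forall>\<^sub>F n in sequentially. \<forall>W. finite W \<longrightarrow> W \<inter> cube n = {} \<longrightarrow>
    (\<Sum>p\<in>cube n. \<Sum>q\<in>(\<lambda>g. p - g) ` W. influence q) \<le> e * real n ^ CARD('d)"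
proof -
  obtain k where k: "\<And>W. finite W \<Longrightarrow> W \<inter> box k = {} \<Longrightarrow> (\<Sum>g\<in>W. influence g) \<le> e / 2"
    using influence_tail[of "e / 2"] assms by auto
  let ?T = "total_influence"
  have "(\<lambda>n. ?T * ((real n ^ CARD('d) - (real n - 2 * real k) ^ CARD('d)) / real n ^ CARD('d))) \<longlonglongrightarrow> ?T * 0"
    by (intro tendsto_mult tendsto_const boundary_ratio_tendsto)
  then have "\<forall>\<^sub>F n in sequentially.
      ?T * ((real n ^ CARD('d) - (real n - 2 * real k) ^ CARD('d)) / real n ^ CARD('d)) < e / 2"
    using assms by (intro order_tendstoD) auto
  then show ?thesis
    using eventually_gt_at_top[of "2 * k"]
  proof eventually_elim
    case (elim n)
    define I where "I = (hcube (int k) (int n - int k) :: ('d \<Rightarrow> int) set)"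
    have I: "I \<subseteq> cube n" unfolding I_def by (rule hcube_mono) auto
    have cI: "real (card I) = (real n - 2 * real k) ^ CARD('d)"
      unfolding I_def by (subst real_card_hcube) (use elim in \<open>auto simp: algebra_simps\<close>)
    have cC: "real (card (cube n - I)) = real n ^ CARD('d) - (real n - 2 * real k) ^ CARD('d)"
      using I cI by (subst card_Diff_subset)
        (auto simp: I_def of_nat_diff card_mono real_card_hcube)
    show ?case
    proof (intro allI impI)
      fix W :: "('d \<Rightarrow> int) set" assume W: "finite W" "W \<inter> cube n = {}"
      let ?D = "\<lambda>p. \<Sum>q\<in>(\<lambda>g. p - g) ` W. influence q"
      have "(\<Sum>p\<in>cube n. ?D p) = (\<Sum>g\<in>cube n - I. ?D g) + (\<Sum>g\<in>I. ?D g)"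
        by (rule sum.subset_diff[OF I]) simp
      also have "(\<Sum>g\<in>cube n - I. ?D g) \<le> real (card (cube n - I)) * ?T"
        using W by (intro sum_bounded_above sum_influence_le) auto
      also have "(\<Sum>g\<in>I. ?D g) \<le> (\<Sum>g\<in>I. e / 2)"
      proof (intro sum_mono k)
        fix p assume p: "p \<in> I"
        have "p - g \<notin> box k" if "g \<in> W" for g
        proof
          assume "p - g \<in> box k"
          then have "- (p - g) + p \<in> cube n"
            using p by (intro translate_box_subset[of p k n] box_uminus) (simp_all add: I_def)
          then show False using that W by auto
        qed
        then show "(\<lambda>g. p - g) ` W \<inter> box k = {}" by auto
      qed (use W in auto)
      also have "(\<Sum>g\<in>I. e / 2) \<le> e / 2 * real n ^ CARD('d)"
      proof -
        have "real (card I) \<le> real n ^ CARD('d)" unfolding cI by (rule power_mono) (use elim in auto)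
        then show ?thesis using assms by (simp add: mult_right_mono mult.commute)
      qed
      also have "real (card (cube n - I)) * ?T \<le> e / 2 * real n ^ CARD('d)"
        unfolding cC using elim by (simp add: field_simps)
      finally show "(\<Sum>p\<in>cube n. ?D p) \<le> e * real n ^ CARD('d)" by simp
    qed
  qed
qed

lemma energy_translate: "energy ((+) \<gamma> ` W) x = energy W (shift \<gamma> x)"
  unfolding energy_def by (rule sum.reindex_cong[of "(+) \<gamma>"]) (auto simp: shift_shift add.commute)

lemma energy_split: "finite W \<Longrightarrow> V \<subseteq> W \<Longrightarrow> energy W x = energy V x + energy (W - V) x"
  unfolding energy_def using sum.subset_diff[of V W "\<lambda>g. \<phi> (shift g x)"] by simp

lemma integrable_shift:
  assumes "invariant_measure \<mu>"
  shows "integrable \<mu> (\<lambda>x. \<phi> (shift g x))"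
proof -
  interpret invariant_measure \<mu> by fact
  show ?thesis
    using integrable_distr[OF measurable_shift_mu, of g \<phi>] integrable_potential[OF config_measure_axioms]
    by (simp add: invariant)
qed

lemma integral_energy:
  assumes "invariant_measure \<mu>"
  shows "integrable \<mu> (energy W)" "(\<integral>x. energy W x \<partial>\<mu>) = real (card W) * (\<integral>x. \<phi> x \<partial>\<mu>)"
proof -
  interpret invariant_measure \<mu> by fact
  note int = integrable_shift[OF assms]
  show "integrable \<mu> (energy W)" unfolding energy_def[abs_def] using int by simp
  show "(\<integral>x. energy W x \<partial>\<mu>) = real (card W) * (\<integral>x. \<phi> x \<partial>\<mu>)"
    unfolding energy_def
    using int integral_shift[OF borel_measurable_potential[OF config_measure_axioms]]
    by (subst Bochner_Integration.integral_sum) auto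
qed

text \<open>Averages yield one configuration of low and one of high energy on a large cube;
  truncating both to the cube makes them agree outside. Terms outside the cube change by the
  interaction across its boundary, which is o(n^d) uniformly in \<open>W\<close>.\<close>

lemma homoclinic_gain:
  assumes "invariant_measure \<mu>" "invariant_measure \<nu>" "(\<integral>x. \<phi> x \<partial>\<mu>) < (\<integral>x. \<phi> x \<partial>\<nu>)"
  shows "\<exists>n u v \<delta>. \<delta> > 0 \<and> (\<forall>h. h \<notin> cube n \<longrightarrow> u h = v h) \<and>
    (\<forall>W. finite W \<longrightarrow> cube n \<subseteq> W \<longrightarrow> energy W u + \<delta> \<le> energy W v)"
proof -
  \<comment> \<open>The gap of 8 units pays for five errors of one unit each: choosing
    \<open>x\<close> and \<open>y\<close>, truncating each of them, and the terms outside the cube.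
    This leaves 3.\<close>
  define e where "e = ((\<integral>x. \<phi> x \<partial>\<nu>) - (\<integral>x. \<phi> x \<partial>\<mu>)) / 8"
  have e: "e > 0" using assms(3) by (simp add: e_def)
  from energy_restrict_cube[OF e] outside_influence[OF e] eventually_gt_at_top[of 0]
  have "\<forall>\<^sub>F n in sequentially. n > 0 \<and> (\<forall>x.
      \<bar>energy (cube n) x - energy (cube n) (restrict x (cube n))\<bar> \<le> e * real n ^ CARD('d)) \<and>
      (\<forall>W. finite W \<longrightarrow> W \<inter> cube n = {} \<longrightarrow>
        (\<Sum>p\<in>cube n. \<Sum>q\<in>(\<lambda>g. p - g) ` W. influence q) \<le> e * real n ^ CARD('d))"
    by eventually_elim blast
  then obtain n where n: "n > 0"
    "\<And>x. \<bar>energy (cube n) x - energy (cube n) (restrict x (cube n))\<bar> \<le> e * real n ^ CARD('d)"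
    "\<And>W. finite W \<Longrightarrow> W \<inter> cube n = {} \<Longrightarrow>
        (\<Sum>p\<in>cube n. \<Sum>q\<in>(\<lambda>g. p - g) ` W. influence q) \<le> e * real n ^ CARD('d)"
    unfolding eventually_sequentially by blast
  define N where "N = real n ^ CARD('d)"
  have N: "N > 0" using n(1) by (simp add: N_def)
  then have eN: "e * N > 0" using e by simp
  have cN: "real (card (cube n :: ('d \<Rightarrow> int) set)) = N" by (simp add: N_def card_hcube)
  interpret mu: invariant_measure \<mu> by fact
  interpret nu: invariant_measure \<nu> by fact
  have "\<exists>x. energy (cube n) x \<le> N * (\<integral>x. \<phi> x \<partial>\<mu>) + e * N"
  proof (rule ccontr)
    assume "\<nexists>x. energy (cube n) x \<le> N * (\<integral>x. \<phi> x \<partial>\<mu>) + e * N"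
    then have "N * (\<integral>x. \<phi> x \<partial>\<mu>) + e * N \<le> (\<integral>x. energy (cube n) x \<partial>\<mu>)"
      by (intro mu.integral_ge_const integral_energy assms AE_I2) (meson not_le less_imp_le)
    then show False using eN by (simp add: integral_energy[OF assms(1)] cN)
  qed
  then obtain x where x: "energy (cube n) x \<le> N * (\<integral>x. \<phi> x \<partial>\<mu>) + e * N" by blast
  have "\<exists>y. energy (cube n) y \<ge> N * (\<integral>x. \<phi> x \<partial>\<nu>) - e * N"
  proof (rule ccontr)
    assume "\<nexists>y. energy (cube n) y \<ge> N * (\<integral>x. \<phi> x \<partial>\<nu>) - e * N"
    then have "(\<integral>x. energy (cube n) x \<partial>\<nu>) \<le> N * (\<integral>x. \<phi> x \<partial>\<nu>) - e * N"
      by (intro nu.integral_le_const integral_energy assms AE_I2) (meson not_le less_imp_le)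
    then show False using eN by (simp add: integral_energy[OF assms(2)] cN)
  qed
  then obtain y where y: "energy (cube n) y \<ge> N * (\<integral>x. \<phi> x \<partial>\<nu>) - e * N" by blast
  define u v where "u = restrict x (cube n)" and "v = restrict y (cube n)"
  have uv: "u h = v h" if "h \<notin> cube n" for h using that by (simp add: u_def v_def)
  have gap: "energy (cube n) u + 4 * (e * N) \<le> energy (cube n) v"
  proof -
    have "N * (\<integral>x. \<phi> x \<partial>\<nu>) = N * (\<integral>x. \<phi> x \<partial>\<mu>) + 8 * (e * N)"
      by (simp add: e_def field_simps)
    then show ?thesis
      using n(2)[of x] n(2)[of y] x y unfolding u_def v_def N_def[symmetric] by linarith
  qed
  have "energy W u + 3 * (e * N) \<le> energy W v" if W: "finite W" "cube n \<subseteq> W" for W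
  proof -
    have "\<bar>energy (W - cube n) u - energy (W - cube n) v\<bar> \<le>
        (\<Sum>p\<in>cube n. \<Sum>q\<in>(\<lambda>g. p - g) ` (W - cube n). influence q)"
      by (rule energy_diff_le_influence) (use W uv in auto)
    also have "\<dots> \<le> e * N" unfolding N_def by (rule n(3)) (use W in auto)
    finally show ?thesis using gap energy_split[OF W, of u] energy_split[OF W, of v] by linarith
  qed
  moreover have "3 * (e * N) > 0" using e N by simp
  ultimately show ?thesis using uv by blast
qed

text \<open>The gain is made independent of the environment. Far from \<open>F\<close> the energies
  of \<open>z\<close> and \<open>z'\<close> differ by a tail of influences, at most
  \<open>\<delta> / 4\<close>; near \<open>F\<close> there are finitely many terms, and replacing
  \<open>u\<close> and \<open>v\<close> by \<open>z\<close> and \<open>z'\<close> costs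
  \<open>\<delta> / 8\<close> each.\<close>

lemma robust_gain:
  assumes "\<delta> > 0" "finite F" "\<And>h. h \<notin> F \<Longrightarrow> u h = v h"
    and gain: "\<And>W. finite W \<Longrightarrow> F \<subseteq> W \<Longrightarrow> energy W u + \<delta> \<le> energy W v"
  shows "\<exists>r. F \<subseteq> box r \<and> (\<forall>W z z'. finite W \<longrightarrow> box r \<subseteq> W \<longrightarrow>
    (\<forall>h\<in>box r. z h = u h \<and> z' h = v h) \<longrightarrow> (\<forall>h. h \<notin> box r \<longrightarrow> z h = z' h) \<longrightarrow>
    energy W z + \<delta> / 2 \<le> energy W z')"
proof -
  obtain s where s: "F \<subseteq> box s" using subset_box[OF assms(2)] by auto
  define t where "t = \<delta> / (4 * (real (card F) + 1))"
  have t: "t > 0" using assms(1) by (simp add: t_def)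
  obtain k where k: "\<And>W. finite W \<Longrightarrow> W \<inter> box k = {} \<Longrightarrow> (\<Sum>g\<in>W. influence g) \<le> t"
    using influence_tail[OF t] by blast
  \<comment> \<open>As \<open>F\<close> lies in \<open>box s\<close>, sites outside
    \<open>box R\<close> differ from those of \<open>F\<close> by vectors outside
    \<open>box k\<close>. The extra margin \<open>m\<close> in \<open>r\<close> lets every term
    based in \<open>box R\<close> see agreement on \<open>box m\<close>.\<close>
  define R where "R = s + k"
  define t' where "t' = \<delta> / (8 * real (card (box R :: ('d \<Rightarrow> int) set)))"
  have cB: "real (card (box R :: ('d \<Rightarrow> int) set)) > 0" by (simp add: card_box)
  have t': "t' > 0" using assms(1) cB by (simp add: t'_def)
  obtain m where m: "var m \<phi> < t'"
    using order_tendstoD(2)[OF var_tendsto_0 t'] by (auto simp: eventually_sequentially)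
  define r where "r = R + m"
  have Fr: "F \<subseteq> box r" using s box_mono[of s r] by (auto simp: r_def R_def)
  have sum_box: "g + h \<in> box (a + b)" if "g \<in> box a" "h \<in> box b" for a b and g h :: "'d \<Rightarrow> int"
    using that by (auto simp: box_def intro!: order_trans[OF abs_triangle_ineq] add_mono)
  have close: "\<bar>energy (box R) z - energy (box R) w\<bar> \<le> \<delta> / 8" if zw: "\<forall>h\<in>box r. z h = w h" for z w
  proof -
    have "\<bar>energy (box R) z - energy (box R) w\<bar> \<le> (\<Sum>g\<in>box R. \<bar>\<phi> (shift g z) - \<phi> (shift g w)\<bar>)"
      unfolding energy_def sum_subtractf[symmetric] by (rule sum_abs)
    also have "\<dots> \<le> (\<Sum>g\<in>(box R :: ('d \<Rightarrow> int) set). t')"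
    proof (rule sum_mono)
      fix g :: "'d \<Rightarrow> int" assume g: "g \<in> box R"
      have "\<bar>\<phi> (shift g z) - \<phi> (shift g w)\<bar> \<le> var m \<phi>"
      proof (rule diff_le_var)
        fix h :: "'d \<Rightarrow> int" assume "h \<in> box m"
        then have "h + g \<in> box r" using sum_box[OF _ g, of h m] by (simp add: r_def add.commute)
        then show "shift g z h = shift g w h" using zw by (simp add: shift_eq)
      qed
      then show "\<bar>\<phi> (shift g z) - \<phi> (shift g w)\<bar> \<le> t'" using m by simp
    qed
    also have "\<dots> = real (card (box R :: ('d \<Rightarrow> int) set)) * t'" by simp
    also have "\<dots> = \<delta> / 8" 
    proof -
      have "c * (\<delta> / (8 * c)) = \<delta> / 8" if "c > 0" for c :: real using that by simp
      from this[OF cB] show ?thesis by (simp only: t'_def)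
    qed
    finally show ?thesis .
  qed
  have "energy W z + \<delta> / 2 \<le> energy W z'"
    if W: "finite W" "box r \<subseteq> W" and z: "\<forall>h\<in>box r. z h = u h \<and> z' h = v h"
      "\<forall>h. h \<notin> box r \<longrightarrow> z h = z' h" for W z z'
  proof -
    have RW: "box R \<subseteq> W" using W(2) box_mono[of R r] by (auto simp: r_def)
    have zz: "z h = z' h" if "h \<notin> F" for h using z assms(3)[OF that] by metis
    have "\<bar>energy (W - box R) z - energy (W - box R) z'\<bar> \<le>
        (\<Sum>p\<in>F. \<Sum>q\<in>(\<lambda>g. p - g) ` (W - box R). influence q)"
      by (rule energy_diff_le_influence) (use W zz assms(2) in auto)
    also have "\<dots> \<le> (\<Sum>p\<in>F. t)"
    proof (intro sum_mono k)
      fix p assume p: "p \<in> F"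
      have "p - g \<notin> box k" if "g \<in> W - box R" for g
      proof
        assume "p - g \<in> box k"
        then have "p + - (p - g) \<in> box R"
          unfolding R_def using p s by (intro sum_box box_uminus) auto
        then show False using that by simp
      qed
      then show "(\<lambda>g. p - g) ` (W - box R) \<inter> box k = {}" by auto
    qed (use W in auto)
    also have "\<dots> \<le> \<delta> / 4"
    proof -
      have "c * (\<delta> / (4 * (c + 1))) \<le> \<delta> / 4" if "c \<ge> 0" for c :: real
        using that assms(1) by (simp add: field_simps)
      from this[of "real (card F)"] show ?thesis by (simp add: t_def)
    qed
    finally have far: "\<bar>energy (W - box R) z - energy (W - box R) z'\<bar> \<le> \<delta> / 4" .
    have "energy (box R) u + \<delta> \<le> energy (box R) v"
      using s box_mono[of s R] by (intro gain) (auto simp: R_def)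
    moreover have "\<bar>energy (box R) z - energy (box R) u\<bar> \<le> \<delta> / 8"
      "\<bar>energy (box R) z' - energy (box R) v\<bar> \<le> \<delta> / 8"
      by (rule close, use z(1) in blast)+
    ultimately show ?thesis
      using far energy_split[OF W(1) RW, of z] energy_split[OF W(1) RW, of z'] by linarith
  qed
  then show ?thesis using Fr by blast
qed

end

section \<open>Weak limits\<close>

text \<open>For a finite alphabet these are the clopen sets, which serve as test sets for weak
  convergence.\<close>

definition finite_dep :: "('d, 'a) config set set" where
  "finite_dep = {E. \<exists>S. finite S \<and> (\<forall>x y. (\<forall>g\<in>S. x g = y g) \<longrightarrow> (x \<in> E \<longleftrightarrow> y \<in> E))}"

lemma finite_depI:
  assumes "finite S" "\<And>x y. (\<And>g. g \<in> S \<Longrightarrow> x g = y g) \<Longrightarrow> x \<in> E \<Longrightarrow> y \<in> E"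
  shows "E \<in> finite_dep"
  unfolding finite_dep_def using assms by (intro CollectI exI[of _ S] conjI allI impI iffI) auto

lemma finite_depE:
  assumes "E \<in> finite_dep"
  obtains S where "finite S" "\<forall>x y. (\<forall>g\<in>S. x g = y g) \<longrightarrow> (x \<in> E \<longleftrightarrow> y \<in> E)"
  using assms unfolding finite_dep_def mem_Collect_eq by (elim exE conjE) (rule that)

lemma algebra_finite_dep: "algebra UNIV (finite_dep :: ('d, 'a) config set set)"
  unfolding algebra_iff_Un
proof (intro conjI ballI)
  show "{} \<in> (finite_dep :: ('d, 'a) config set set)" by (rule finite_depI[of "{}"]) auto
  fix E :: "('d, 'a) config set" assume "E \<in> finite_dep"
  then obtain S where S0: "finite S" "\<forall>x y. (\<forall>g\<in>S. x g = y g) \<longrightarrow> (x \<in> E \<longleftrightarrow> y \<in> E)"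
    by (rule finite_depE)
  note S = S0(1) S0(2)[rule_format]
  show "UNIV - E \<in> finite_dep" by (rule finite_depI[OF S(1)]) (use S(2) in blast)
  fix E' :: "('d, 'a) config set" assume "E' \<in> finite_dep"
  then obtain S' where S'0: "finite S'" "\<forall>x y. (\<forall>g\<in>S'. x g = y g) \<longrightarrow> (x \<in> E' \<longleftrightarrow> y \<in> E')"
    by (rule finite_depE)
  note S' = S'0(1) S'0(2)[rule_format]
  show "E \<union> E' \<in> finite_dep"
  proof (rule finite_depI[of "S \<union> S'"])
    fix x y :: "('d, 'a) config" assume eq: "\<And>g. g \<in> S \<union> S' \<Longrightarrow> x g = y g" and "x \<in> E \<union> E'"
    have "x \<in> E \<longleftrightarrow> y \<in> E" using eq by (intro S(2)) auto
    moreover have "x \<in> E' \<longleftrightarrow> y \<in> E'" using eq by (intro S'(2)) auto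
    ultimately show "y \<in> E \<union> E'" using \<open>x \<in> E \<union> E'\<close> by auto
  qed (use S S' in auto)
qed auto

text \<open>There are countably many finite sets of sites and finitely many patterns on each.
  Countability permits a diagonal choice of a subsequence converging on every cylinder.\<close>

lemma countable_finite_dep: "countable (finite_dep :: ('d::finite, 'a::finite) config set set)"
proof (rule countable_subset)
  let ?f = "\<lambda>S (V :: ('d, 'a) config set). {x. restrict x S \<in> V}"
  show "finite_dep \<subseteq> (\<Union>S\<in>Collect finite. ?f S ` Pow (PiE S (\<lambda>_. UNIV)))"
  proof
    fix E :: "('d, 'a) config set" assume "E \<in> finite_dep"
    then obtain S where S0: "finite S" "\<forall>x y. (\<forall>g\<in>S. x g = y g) \<longrightarrow> (x \<in> E \<longleftrightarrow> y \<in> E)"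
      by (rule finite_depE)
    note S = S0(1) S0(2)[rule_format]
    have "E = ?f S ((\<lambda>x. restrict x S) ` E)"
    proof (intro set_eqI iffI)
      fix x assume "x \<in> ?f S ((\<lambda>x. restrict x S) ` E)"
      then obtain y where "y \<in> E" "restrict x S = restrict y S" by auto
      then show "x \<in> E" using S(2)[of x y] by (simp add: restrict_eq_iff)
    qed auto
    then show "E \<in> (\<Union>S\<in>Collect finite. ?f S ` Pow (PiE S (\<lambda>_. UNIV)))"
      using S(1) by (intro UN_I[of S] image_eqI[where x = "(\<lambda>x. restrict x S) ` E"]) auto
  qed
  show "countable (\<Union>S\<in>Collect finite. ?f S ` Pow (PiE S (\<lambda>_. UNIV)))"
  proof (intro countable_UN countable_Collect_finite countable_image)
    fix S :: "('d \<Rightarrow> int) set" assume "S \<in> Collect finite"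
    then have "finite (Pow (PiE S (\<lambda>_. UNIV :: 'a set)))" by (simp add: finite_PiE)
    then show "countable (Pow (PiE S (\<lambda>_. UNIV :: 'a set)))" by (rule countable_finite)
  qed
qed

lemma sets_shift_space_finite_dep:
  "sets (shift_space :: ('d::finite, 'a::finite) config measure) = sigma_sets UNIV finite_dep"
proof (rule antisym)
  have "{f \<in> PiE UNIV (\<lambda>_. UNIV). f i \<in> A} \<in> finite_dep" for i :: "'d \<Rightarrow> int" and A :: "'a set"
    by (rule finite_depI[of "{i}"]) (simp_all add: PiE_UNIV_domain)
  then have "sigma_sets UNIV {{f \<in> PiE UNIV (\<lambda>_. UNIV). f i \<in> A} | (i :: 'd \<Rightarrow> int) (A :: 'a set). True}
      \<subseteq> sigma_sets UNIV finite_dep"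
    by (intro sigma_sets_mono') blast
  then show "sets (shift_space :: ('d, 'a) config measure) \<subseteq> sigma_sets UNIV finite_dep"
    unfolding shift_space_def sets_PiM_single by (simp add: PiE_UNIV_domain)
  have "E \<in> sets shift_space" if E: "E \<in> finite_dep" for E :: "('d, 'a) config set"
  proof -
    obtain S where S0: "finite S" "\<forall>x y. (\<forall>g\<in>S. x g = y g) \<longrightarrow> (x \<in> E \<longleftrightarrow> y \<in> E)"
      using E by (rule finite_depE)
    note S = S0(1) S0(2)[rule_format]
    have E_eq: "E = (\<Union>v\<in>(\<lambda>x. restrict x S) ` E. {x. \<forall>g\<in>S. x g = v g})"
    proof (intro set_eqI iffI)
      fix x assume "x \<in> (\<Union>v\<in>(\<lambda>x. restrict x S) ` E. {x. \<forall>g\<in>S. x g = v g})"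
      then obtain y where "y \<in> E" "\<forall>g\<in>S. x g = y g" by auto
      then show "x \<in> E" using S(2)[of x y] by simp
    qed auto
    have fin: "finite ((\<lambda>x. restrict x S) ` E)"
      by (rule finite_subset[of _ "PiE S (\<lambda>_. UNIV)"]) (auto simp: S(1) finite_PiE)
    have *: "{x \<in> space shift_space. \<forall>g\<in>S. x g = v g} \<in> sets shift_space" for v :: "('d, 'a) config"
    proof (rule sets.sets_Collect_finite_All[OF _ S(1)])
      fix g
      have "(\<lambda>x. x g) -` {v g} \<inter> space shift_space \<in> sets (shift_space :: ('d, 'a) config measure)"
        by (rule measurable_sets[OF measurable_coordinate]) simp
      then show "{x \<in> space shift_space. x g = v g} \<in> sets shift_space"
        by (simp add: space_shift_space vimage_def)
    qed
    show ?thesis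
      by (subst E_eq, rule sets.finite_UN[OF fin]) (use * in \<open>simp add: space_shift_space\<close>)
  qed
  then show "sigma_sets UNIV finite_dep \<subseteq> sets (shift_space :: ('d, 'a) config measure)"
    by (metis sets.sigma_sets_subset space_shift_space subsetI)
qed

lemma closedin_finite_dep:
  assumes "E \<in> finite_dep"
  shows "closedin (shift_topology :: ('d, 'a) config topology) E"
proof -
  obtain S where S0: "finite S" "\<forall>x y. (\<forall>g\<in>S. x g = y g) \<longrightarrow> (x \<in> E \<longleftrightarrow> y \<in> E)"
    using assms by (rule finite_depE)
  note S = S0(1) S0(2)[rule_format]
  have ts: "topspace (shift_topology :: ('d, 'a) config topology) = UNIV"
    by (simp add: shift_topology_def)
  have "\<exists>T. openin shift_topology T \<and> x \<in> T \<and> T \<subseteq> - E" if x: "x \<in> - E" for x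
  proof (intro exI conjI)
    let ?T = "PiE UNIV (\<lambda>g. if g \<in> S then {x g} else UNIV)"
    have "finite {g. (if g \<in> S then {x g} else UNIV) \<noteq> (UNIV :: 'a set)}"
      by (rule finite_subset[OF _ S(1)]) auto
    then show "openin shift_topology ?T"
      unfolding shift_topology_def openin_PiE_gen by auto
    show "x \<in> ?T" by (auto simp: PiE_iff)
    show "?T \<subseteq> - E"
    proof
      fix y assume "y \<in> ?T"
      then have "x g = y g" if "g \<in> S" for g using that by (auto simp: PiE_iff dest: spec[of _ g])
      then show "y \<in> - E" using S(2)[of x y] x by auto
    qed
  qed
  then have "openin shift_topology (- E)" by (subst openin_subopen) blast
  then show ?thesis by (simp add: closedin_def ts Compl_eq_Diff_UNIV)
qed

text \<open>Compactness of the space makes every finitely additive set function on the cylinder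
  algebra continuous at the empty set, so Caratheodory extension applies to pointwise limits.\<close>

lemma weak_limit_exists:
  fixes P :: "nat \<Rightarrow> ('d::finite, 'a::finite) config set \<Rightarrow> real"
  assumes lim: "\<And>E. E \<in> finite_dep \<Longrightarrow> (\<lambda>n. P n E) \<longlonglongrightarrow> L E"
    and nonneg: "\<And>n E. 0 \<le> P n E" and UNIV: "\<And>n. P n UNIV = 1"
    and add: "\<And>n E E'. E \<in> finite_dep \<Longrightarrow> E' \<in> finite_dep \<Longrightarrow> E \<inter> E' = {} \<Longrightarrow> P n (E \<union> E') = P n E + P n E'"
  shows "\<exists>\<mu>. config_measure \<mu> \<and> (\<forall>E\<in>finite_dep. measure \<mu> E = L E)"
proof -
  interpret A: algebra UNIV "finite_dep :: ('d, 'a) config set set" by (rule algebra_finite_dep)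
  have L0: "0 \<le> L E" if "E \<in> finite_dep" for E
    by (rule tendsto_lowerbound[OF lim[OF that]]) (auto simp: nonneg)
  have L1: "L UNIV = 1" using lim[OF A.top] by (simp add: UNIV LIMSEQ_const_iff)
  have Ladd: "L (E \<union> E') = L E + L E'" if "E \<in> finite_dep" "E' \<in> finite_dep" "E \<inter> E' = {}" for E E'
  proof (rule LIMSEQ_unique[OF lim])
    show "E \<union> E' \<in> finite_dep" using that by auto
    show "(\<lambda>n. P n (E \<union> E')) \<longlonglongrightarrow> L E + L E'"
      using tendsto_add[OF lim[OF that(1)] lim[OF that(2)]] by (simp add: add[OF that])
  qed
  have Lempty: "L {} = 0" using Ladd[of "{}" "{}"] by simp
  have "\<exists>\<mu> :: ('d, 'a) config set \<Rightarrow> ennreal. (\<forall>s\<in>finite_dep. \<mu> s = ennreal (L s)) \<and>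
      measure_space UNIV (sigma_sets UNIV finite_dep) \<mu>"
  proof (rule A.caratheodory_empty_continuous)
    show "positive finite_dep (\<lambda>E. ennreal (L E))" by (simp add: positive_def Lempty)
    show "additive finite_dep (\<lambda>E. ennreal (L E))"
      unfolding additive_def using Ladd L0 by (simp add: ennreal_plus)
    fix C :: "nat \<Rightarrow> ('d, 'a) config set"
    assume C: "range C \<subseteq> finite_dep" "decseq C" "(\<Inter>i. C i) = {}"
    \<comment> \<open>Cylinders are closed in a compact space, so a decreasing sequence of nonempty
      ones would have a common point.\<close>
    have "\<exists>i. C i = {}"
    proof (rule ccontr)
      assume "\<nexists>i. C i = {}"
      then have "(\<Inter>i. C i) \<noteq> {}"
        using C by (intro compact_space_imp_nest[OF compact_shift_topology] closedin_finite_dep) auto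
      then show False using C(3) by simp
    qed
    then obtain i where i: "C i = {}" by blast
    have "C j = {}" if "j \<ge> i" for j using i C(2) that by (auto simp: decseq_def)
    then have "\<forall>\<^sub>F j in sequentially. ennreal (L (C j)) = 0"
      unfolding eventually_sequentially by (intro exI[of _ i]) (simp add: Lempty)
    then show "(\<lambda>j. ennreal (L (C j))) \<longlonglongrightarrow> 0" by (rule tendsto_eventually)
  qed auto
  then obtain m where m: "\<And>E. E \<in> finite_dep \<Longrightarrow> m E = ennreal (L E)"
    and ms: "measure_space UNIV (sigma_sets UNIV finite_dep) m" by blast
  define \<mu> where "\<mu> = measure_of UNIV (sigma_sets UNIV finite_dep) m"
  have sets: "sets \<mu> = sigma_sets UNIV finite_dep"
    by (simp add: \<mu>_def sigma_sets_sigma_sets_eq)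
  have em: "emeasure \<mu> E = m E" if "E \<in> sigma_sets UNIV finite_dep" for E
    using ms that unfolding \<mu>_def measure_space_def
    by (intro emeasure_measure_of_sigma) auto
  have em': "emeasure \<mu> E = ennreal (L E)" if "E \<in> finite_dep" for E
    using em[of E] m[OF that] that by auto
  have "space \<mu> = UNIV" by (simp add: \<mu>_def)
  then have "config_measure \<mu>"
    using em'[OF A.top] sets
    unfolding config_measure_def config_measure_axioms_def sets_shift_space_finite_dep
    by (auto intro!: prob_spaceI simp: L1)
  moreover have "measure \<mu> E = L E" if "E \<in> finite_dep" for E
    using em'[OF that] L0[OF that] by (simp add: measure_def)
  ultimately show ?thesis by blast
qed

lemma finite_dep_shift_vimage:
  assumes "E \<in> finite_dep"
  shows "shift g -` E \<in> finite_dep"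
proof -
  obtain S where S0: "finite S" "\<forall>x y. (\<forall>g\<in>S. x g = y g) \<longrightarrow> (x \<in> E \<longleftrightarrow> y \<in> E)"
    using assms by (rule finite_depE)
  note S = S0(1) S0(2)[rule_format]
  show ?thesis
  proof (rule finite_depI[of "(\<lambda>h. h + g) ` S"])
    fix x y :: "('a, 'b) config"
    assume "\<And>h. h \<in> (\<lambda>h. h + g) ` S \<Longrightarrow> x h = y h" "x \<in> shift g -` E"
    then show "y \<in> shift g -` E" using S(2)[of "shift g x" "shift g y"] by (simp add: shift_eq)
  qed (use S in auto)
qed

lemma (in config_measure) invariantI:
  assumes "\<And>g E. E \<in> finite_dep \<Longrightarrow> measure \<mu> (shift g -` E) = measure \<mu> E"
  shows "invariant_measure \<mu>"
proof
  fix g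
  interpret A: algebra UNIV "finite_dep :: ('d, 'a) config set set" by (rule algebra_finite_dep)
  have sets: "sets \<mu> = sigma_sets UNIV finite_dep" by (simp add: sets_mu sets_shift_space_finite_dep)
  have ms: "shift g \<in> measurable \<mu> \<mu>"
    using measurable_shift measurable_cong_sets[OF sets_mu sets_mu] by blast
  show "distr \<mu> \<mu> (shift g) = \<mu>"
  proof (rule measure_eqI_generator_eq[where E = "finite_dep :: ('d, 'a) config set set" and \<Omega> = UNIV
        and A = "\<lambda>_. UNIV"], goal_cases)
    case 1
    show ?case by (auto simp: Int_stable_def)
  next
    case (3 E)
    then have "E \<in> sets \<mu>" by (auto simp: sets)
    then show ?case
      using assms[OF 3, of g] by (simp add: emeasure_distr[OF ms] emeasure_eq_measure)
  qed (auto simp: sets emeasure_distr[OF ms])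
qed

text \<open>Asymptotic invariance becomes exact in the limit because shift preimages of cylinders
  are again cylinders, on which the subsequence converges.\<close>

lemma weak_compactness:
  fixes P :: "nat \<Rightarrow> ('d::finite, 'a::finite) config pmf"
  assumes asymp: "\<And>g E. (\<lambda>n. measure (P n) (shift g -` E) - measure (P n) E) \<longlonglongrightarrow> 0"
  shows "\<exists>r \<mu>. strict_mono r \<and> invariant_measure \<mu> \<and>
    (\<forall>E\<in>finite_dep. (\<lambda>n. measure (P (r n)) E) \<longlonglongrightarrow> measure \<mu> E)"
proof -
  obtain r where r: "strict_mono (r :: nat \<Rightarrow> nat)"
    "\<And>E. E \<in> finite_dep \<Longrightarrow> \<exists>l. (\<lambda>n. measure (P (r n)) E) \<longlonglongrightarrow> l"
    by (rule function_convergent_subsequence[of "finite_dep :: ('d, 'a) config set set" "\<lambda>n E. measure (P n) E" 1])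
      (auto simp: countable_finite_dep)
  then obtain L where L: "\<And>E. E \<in> finite_dep \<Longrightarrow> (\<lambda>n. measure (P (r n)) E) \<longlonglongrightarrow> L E" by metis
  obtain \<mu> where mu: "config_measure \<mu>" and muL: "\<And>E. E \<in> finite_dep \<Longrightarrow> measure \<mu> E = L E"
    using weak_limit_exists[of "\<lambda>n E. measure (P (r n)) E" L, OF L]
    by (auto simp: measure_pmf.finite_measure_Union)
  have "measure \<mu> (shift g -` E) = measure \<mu> E" if E: "E \<in> finite_dep" for g E
  proof -
    have "(\<lambda>n. measure (P (r n)) (shift g -` E) - measure (P (r n)) E) \<longlonglongrightarrow> L (shift g -` E) - L E"
      by (intro tendsto_diff L finite_dep_shift_vimage E)
    moreover have "(\<lambda>n. measure (P (r n)) (shift g -` E) - measure (P (r n)) E) \<longlonglongrightarrow> 0"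
      using LIMSEQ_subseq_LIMSEQ[OF asymp r(1)] by (simp add: o_def)
    ultimately show ?thesis using LIMSEQ_unique muL E finite_dep_shift_vimage by fastforce
  qed
  then have "invariant_measure \<mu>" using config_measure.invariantI[OF mu] by blast
  then show ?thesis using r(1) L muL by (intro exI[of _ r] exI[of _ \<mu>]) simp
qed

section \<open>Averaged finite-volume distributions\<close>

text \<open>Concavity of entropy, from the Gibbs inequality with \<open>F = ln a\<close>, whose
  normalising sum is 1.\<close>

lemma sum_entropy_le_entropy_avg:
  fixes p :: "'g \<Rightarrow> 'v \<Rightarrow> real"
  assumes "finite G" "G \<noteq> {}" "finite V" and nonneg: "\<And>g v. 0 \<le> p g v"
    and one: "\<And>g. g \<in> G \<Longrightarrow> sum (p g) V = 1"
    and avg: "\<And>v. v \<in> V \<Longrightarrow> real (card G) * a v = (\<Sum>g\<in>G. p g v)"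
  shows "(\<Sum>g\<in>G. \<Sum>v\<in>V. - (p g v * ln (p g v))) \<le> real (card G) * (\<Sum>v\<in>V. - (a v * ln (a v)))"
proof -
  \<comment> \<open>Since \<open>ln 0 = 0\<close>, an atom with \<open>a v = 0\<close> would count
    as \<open>exp (ln (a v)) = 1\<close>. Such atoms are null for every \<open>p g\<close> with
    \<open>g \<in> G\<close> and are removed.\<close>
  define V' where "V' = {v \<in> V. a v \<noteq> 0}"
  have fV': "finite V'" using assms(3) by (simp add: V'_def)
  have cG: "real (card G) > 0" using assms(1,2) by (simp add: card_gt_0_iff)
  have a0: "0 \<le> a v" if "v \<in> V" for v
  proof -
    have "0 \<le> real (card G) * a v" unfolding avg[OF that] by (rule sum_nonneg) (rule nonneg)
    then show ?thesis using cG by (simp add: zero_le_mult_iff)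
  qed
  have p0: "p g v = 0" if "g \<in> G" "v \<in> V" "v \<notin> V'" for g v
  proof -
    have "(\<Sum>g\<in>G. p g v) = 0" using avg[OF that(2)] that by (simp add: V'_def)
    then show ?thesis using sum_nonneg_eq_0_iff[OF assms(1), of "\<lambda>g. p g v"] nonneg that(1) by simp
  qed
  have "(\<Sum>v\<in>V. a v) = 1"
  proof -
    have "real (card G) * (\<Sum>v\<in>V. a v) = (\<Sum>v\<in>V. \<Sum>g\<in>G. p g v)"
      by (simp add: sum_distrib_left avg)
    also have "\<dots> = (\<Sum>g\<in>G. sum (p g) V)" by (rule sum.swap)
    also have "\<dots> = real (card G)" by (simp add: one)
    finally show ?thesis using cG by simp
  qed
  moreover have "(\<Sum>v\<in>V'. a v) = (\<Sum>v\<in>V. a v)"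
    using assms(3) by (intro sum.mono_neutral_left) (auto simp: V'_def)
  ultimately have Z: "(\<Sum>v\<in>V'. exp (ln (a v))) = 1"
    using a0 by (subst sum.cong[of V' V' _ a]) (auto simp: V'_def less_le)
  have "(\<Sum>v\<in>V. - (p g v * ln (p g v))) \<le> (\<Sum>v\<in>V. - (p g v * ln (a v)))" if g: "g \<in> G" for g
  proof -
    have "sum (p g) V' = sum (p g) V"
      using assms(3) p0[OF g] by (intro sum.mono_neutral_left) (auto simp: V'_def)
    then have "(\<Sum>v\<in>V'. - (p g v * ln (p g v)) + p g v * ln (a v)) \<le> 0"
      using gibbs_inequality_sum[OF fV', of "p g" "\<lambda>v. ln (a v)"] nonneg one[OF g] Z by simp
    also have "(\<Sum>v\<in>V'. - (p g v * ln (p g v)) + p g v * ln (a v)) =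
        (\<Sum>v\<in>V. - (p g v * ln (p g v)) + p g v * ln (a v))"
      using assms(3) p0[OF g] by (intro sum.mono_neutral_left) (auto simp: V'_def)
    finally show ?thesis by (simp add: sum.distrib sum_negf sum_subtractf)
  qed
  then have "(\<Sum>g\<in>G. \<Sum>v\<in>V. - (p g v * ln (p g v))) \<le> (\<Sum>g\<in>G. \<Sum>v\<in>V. - (p g v * ln (a v)))"
    by (rule sum_mono)
  also have "\<dots> = (\<Sum>v\<in>V. \<Sum>g\<in>G. - (p g v * ln (a v)))" by (rule sum.swap)
  also have "\<dots> = (\<Sum>v\<in>V. - (real (card G) * a v * ln (a v)))"
    by (intro sum.cong refl) (simp add: avg sum_negf sum_distrib_right)
  also have "\<dots> = real (card G) * (\<Sum>v\<in>V. - (a v * ln (a v)))"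
    by (simp add: sum_distrib_left mult.assoc sum_negf)
  finally show ?thesis .
qed

text \<open>The finite-volume laws live on finitely many patterns, so their averaged translates are
  handled as discrete distributions. For \<open>n = 0\<close> the cube is empty and the value
  carries no information.\<close>

definition avg_pmf :: "nat \<Rightarrow> ('d::finite, 'a) config pmf \<Rightarrow> ('d, 'a) config pmf" where
  "avg_pmf n q = pmf_of_set (cube n) \<bind> (\<lambda>g. map_pmf (shift g) q)"

lemma cube_nonempty: "n > 0 \<Longrightarrow> cube n \<noteq> ({} :: ('d \<Rightarrow> int) set)"
  by (auto simp: hcube_def intro!: exI[of _ "\<lambda>_. 0"])

lemma expectation_avg_pmf:
  fixes h :: "('d::finite, 'a) config \<Rightarrow> real"
  assumes "n > 0" "finite (set_pmf q)"
  shows "real n ^ CARD('d) * measure_pmf.expectation (avg_pmf n q) h =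
    (\<Sum>g\<in>cube n. measure_pmf.expectation q (\<lambda>x. h (shift g x)))"
  unfolding avg_pmf_def using assms
  by (subst pmf_expectation_bind_pmf_of_set)
    (simp_all add: cube_nonempty card_hcube sum_distrib_left[symmetric])

lemma prob_avg_pmf:
  fixes q :: "('d::finite, 'a) config pmf"
  assumes "n > 0" "finite (set_pmf q)"
  shows "real n ^ CARD('d) * measure_pmf.prob (avg_pmf n q) E =
    (\<Sum>g\<in>cube n. measure_pmf.prob q (shift g -` E))"
proof -
  have "measure_pmf.expectation q (\<lambda>x. indicator E (shift g x)) = measure_pmf.prob q (shift g -` E)" for g
    by (simp add: indicator_vimage[symmetric, unfolded o_def])
  then show ?thesis using expectation_avg_pmf[OF assms, of "indicator E"] by simp
qed

text \<open>The cube and its translate by \<open>k\<close> both lie in a cube \<open>B\<close> with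
  margin \<open>m\<close>, and the summands are probabilities; so the two averages differ by at most
  the relative volume of the margin.\<close>

lemma avg_pmf_asymptotically_invariant:
  fixes q :: "nat \<Rightarrow> ('d::finite, 'a) config pmf"
  assumes "\<And>n. finite (set_pmf (q n))"
  shows "(\<lambda>n. measure_pmf.prob (avg_pmf n (q n)) (shift k -` E) - measure_pmf.prob (avg_pmf n (q n)) E) \<longlonglongrightarrow> 0"
proof -
  obtain m where m: "{k} \<subseteq> box m" using subset_box[of "{k}"] by auto
  have "(\<lambda>n. (real n + 2 * real m) ^ CARD('d) / real n ^ CARD('d) - 1) \<longlonglongrightarrow> 1 - 1"
    by (intro tendsto_diff tendsto_const cube_ratio_tendsto)
  then have lim: "(\<lambda>n. (real n + 2 * real m) ^ CARD('d) / real n ^ CARD('d) - 1) \<longlonglongrightarrow> 0" by simp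
  show ?thesis
  proof (rule Lim_null_comparison[OF _ lim])
    show "\<forall>\<^sub>F n in sequentially. norm (measure_pmf.prob (avg_pmf n (q n)) (shift k -` E)
      - measure_pmf.prob (avg_pmf n (q n)) E) \<le> (real n + 2 * real m) ^ CARD('d) / real n ^ CARD('d) - 1"
      using eventually_gt_at_top[of 0]
    proof eventually_elim
      case (elim n)
      define p where "p g = measure_pmf.prob (q n) (shift g -` E)" for g
      define B where "B = (hcube (- int m) (int n + int m) :: ('d \<Rightarrow> int) set)"
      have cB: "real (card B) = (real n + 2 * real m) ^ CARD('d)"
        unfolding B_def by (subst real_card_hcube) (auto simp: add.commute)
      have bd: "sum p B - sum p S \<in> {0..real (card B) - real n ^ CARD('d)}"
        if S: "S \<subseteq> B" "card S = n ^ CARD('d)" for S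
      proof -
        have fB: "finite B" by (simp add: B_def)
        have "sum p B = sum p (B - S) + sum p S" by (rule sum.subset_diff[OF S(1) fB])
        moreover have "0 \<le> sum p (B - S)" by (rule sum_nonneg) (simp add: p_def)
        moreover have "sum p (B - S) \<le> real (card (B - S)) * 1"
          by (rule sum_bounded_above) (simp add: p_def)
        moreover have "real (card (B - S)) = real (card B) - real n ^ CARD('d)"
          using S fB by (simp add: card_Diff_subset finite_subset card_mono of_nat_diff flip: S(2))
        ultimately show ?thesis by simp
      qed
      have "(+) k ` cube n \<subseteq> B"
      proof
        fix h assume "h \<in> (+) k ` cube n"
        then obtain g where "h = k + g" "g \<in> cube n" by auto
        moreover have "\<bar>k i\<bar> \<le> int m" for i
          using m by (simp add: box_def)
        ultimately have "- int m \<le> h i \<and> h i < int n + int m" for i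
          by (simp add: hcube_def abs_le_iff) (smt (verit))
        then show "h \<in> B" by (simp add: B_def hcube_def)
      qed
      then have 1: "sum p B - sum p ((+) k ` cube n) \<in> {0..real (card B) - real n ^ CARD('d)}"
        by (rule bd) (subst card_image, auto simp: card_hcube)
      have 2: "sum p B - sum p (cube n) \<in> {0..real (card B) - real n ^ CARD('d)}"
      proof (rule bd)
        show "cube n \<subseteq> B" unfolding B_def by (rule hcube_mono) auto
      qed (simp add: card_hcube)
      have "real n ^ CARD('d) * (measure_pmf.prob (avg_pmf n (q n)) (shift k -` E)
          - measure_pmf.prob (avg_pmf n (q n)) E) =
        (\<Sum>g\<in>cube n. measure_pmf.prob (q n) (shift g -` shift k -` E)) - sum p (cube n)"
        unfolding right_diff_distrib prob_avg_pmf[OF elim assms] by (simp add: p_def)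
      also have "(\<Sum>g\<in>cube n. measure_pmf.prob (q n) (shift g -` shift k -` E)) = sum p ((+) k ` cube n)"
        by (rule sum.reindex_cong[symmetric, of "(+) k"])
          (auto simp: p_def vimage_def shift_shift)
      finally have "real n ^ CARD('d) * \<bar>measure_pmf.prob (avg_pmf n (q n)) (shift k -` E)
          - measure_pmf.prob (avg_pmf n (q n)) E\<bar> \<le> real (card B) - real n ^ CARD('d)"
      proof -
        assume eq: "real n ^ CARD('d) * (measure_pmf.prob (avg_pmf n (q n)) (shift k -` E)
          - measure_pmf.prob (avg_pmf n (q n)) E) = sum p ((+) k ` cube n) - sum p (cube n)"
        have "real n ^ CARD('d) * \<bar>measure_pmf.prob (avg_pmf n (q n)) (shift k -` E)
            - measure_pmf.prob (avg_pmf n (q n)) E\<bar> = \<bar>sum p ((+) k ` cube n) - sum p (cube n)\<bar>"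
          unfolding eq[symmetric] by (simp add: abs_mult)
        then show ?thesis using 1 2 by auto
      qed
      then show ?case using elim unfolding cB by (simp add: field_simps)
    qed
  qed
qed

lemma simple_function_measure_pmf: "finite (range f) \<Longrightarrow> simple_function (measure_pmf q) f"
  by (simp add: simple_function_def)

lemma finite_range_restrict:
  "finite S \<Longrightarrow> finite (range (\<lambda>x :: 'g \<Rightarrow> 'a::finite. restrict x S))"
  by (rule finite_subset[of _ "PiE S (\<lambda>_. UNIV)"]) (auto simp: finite_PiE)

lemma shannon_shift_avg_pmf:
  fixes q :: "('d::finite, 'a::finite) config pmf"
  assumes "n > 0" "finite (set_pmf q)" "finite S"
  shows "(\<Sum>g\<in>cube n. shannon q (\<lambda>x. restrict (shift g x) S))
    \<le> real n ^ CARD('d) * shannon (avg_pmf n q) (\<lambda>x. restrict x S)"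
proof -
  define V where "V = (PiE S (\<lambda>_. UNIV) :: ('d, 'a) config set)"
  have fV: "finite V" using assms(3) by (simp add: V_def finite_PiE)
  have shq: "shannon q (\<lambda>x. restrict (shift g x) S) =
      (\<Sum>v\<in>V. - (measure_pmf.prob q ((\<lambda>x. restrict (shift g x) S) -` {v})
        * ln (measure_pmf.prob q ((\<lambda>x. restrict (shift g x) S) -` {v}))))" for g
    by (subst shannon_eq_sum[OF fV]) (auto simp: V_def)
  have sha: "shannon (avg_pmf n q) (\<lambda>x. restrict x S) =
      (\<Sum>v\<in>V. - (measure_pmf.prob (avg_pmf n q) ((\<lambda>x. restrict x S) -` {v})
        * ln (measure_pmf.prob (avg_pmf n q) ((\<lambda>x. restrict x S) -` {v}))))"
    by (subst shannon_eq_sum[OF fV]) (auto simp: V_def)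
  have c: "real (card (cube n :: ('d \<Rightarrow> int) set)) = real n ^ CARD('d)" by (simp add: card_hcube)
  show ?thesis
    unfolding shq sha c[symmetric]
  proof (rule sum_entropy_le_entropy_avg)
    fix g :: "'d \<Rightarrow> int"
    have fr: "finite (range (\<lambda>x :: ('d, 'a) config. restrict (shift g x) S))"
      by (rule finite_subset[OF _ fV]) (auto simp: V_def)
    show "(\<Sum>v\<in>V. measure_pmf.prob q ((\<lambda>x. restrict (shift g x) S) -` {v})) = 1"
      using prob_sum_fibres[OF measure_pmf.prob_space_axioms simple_function_measure_pmf[OF fr] fV, of q]
      by (auto simp: V_def)
  next
    fix v
    show "real (card (cube n :: ('d \<Rightarrow> int) set)) * measure_pmf.prob (avg_pmf n q) ((\<lambda>x. restrict x S) -` {v}) =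
      (\<Sum>g\<in>cube n. measure_pmf.prob q ((\<lambda>x. restrict (shift g x) S) -` {v}))"
      unfolding c prob_avg_pmf[OF assms(1,2)] by (simp add: vimage_def)
  qed (use assms fV cube_nonempty in auto)
qed

text \<open>The entropy step in Misiurewicz's argument. In the tiling bound, translates of
  \<open>cube k\<close> based inside \<open>cube n\<close> are handled by concavity of entropy;
  those based outside are few and are charged the maximal entropy \<open>ln (real CARD('a))\<close>
  per site.\<close>

lemma shannon_cube_le_avg_pmf:
  fixes q :: "('d::finite, 'a::finite) config pmf"
  assumes "n > 0" "k > 0" "finite (set_pmf q)"
  shows "shannon q (\<lambda>x. restrict x (cube n)) / real n ^ CARD('d)
    \<le> shannon (avg_pmf n q) (\<lambda>x. restrict x (cube k)) / real k ^ CARD('d)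
      + ((real n + (real k - 1)) ^ CARD('d) / real n ^ CARD('d) - 1) * ln (real CARD('a))"
proof -
  define H where "H S = shannon q (\<lambda>x. restrict x S)" for S
  note ps = measure_pmf.prob_space_axioms[of q]
  have sc: "simple_function q (\<lambda>x. x g)" for g :: "'d \<Rightarrow> int"
    by (rule simple_function_measure_pmf) simp
  have sr: "simple_function q (\<lambda>x. restrict x S)" if "finite S" for S :: "('d \<Rightarrow> int) set"
    using that by (intro simple_function_measure_pmf finite_range_restrict)
  define B where "B = (hcube (1 - int k) (int n) :: ('d \<Rightarrow> int) set)"
  have cB: "real (card B) = (real n + (real k - 1)) ^ CARD('d)"
    unfolding B_def by (subst real_card_hcube) (use assms in \<open>auto simp: algebra_simps\<close>)
  have CB: "cube n \<subseteq> B" unfolding B_def using assms by (intro hcube_mono) auto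
  have H_le: "H S \<le> real (card S) * ln (real CARD('a))" if "finite S" for S
  proof -
    have "H S \<le> (\<Sum>g\<in>S. shannon q (\<lambda>x. x g))"
      unfolding H_def using shannon_family_le_sum[OF ps sc that] by simp
    also have "\<dots> \<le> (\<Sum>g\<in>S. ln (real CARD('a)))"
      by (intro sum_mono shannon_le_ln_card[OF ps sc]) auto
    finally show ?thesis by simp
  qed
  have "real k ^ CARD('d) * H (cube n) \<le> (\<Sum>g\<in>B. H ((+) g ` cube k))"
    unfolding B_def
  proof (rule cube_tiling_bound)
    show "H (S \<union> T) \<le> H S + H T" if "finite S" "finite T" for S T
      unfolding H_def using shannon_family_Un[OF ps sc that] by simp
    show "H S \<le> H T" if "finite T" "S \<subseteq> T" for S T
      unfolding H_def using shannon_family_mono[OF ps sc that] by simp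
    show "H {} = 0" unfolding H_def using shannon_family_empty[where X = "\<lambda>g x. x g", OF ps sc] by simp
  qed (use assms in auto)
  also have "\<dots> = (\<Sum>g\<in>B - cube n. H ((+) g ` cube k)) + (\<Sum>g\<in>cube n. H ((+) g ` cube k))"
    by (rule sum.subset_diff[OF CB]) (simp add: B_def)
  also have "(\<Sum>g\<in>B - cube n. H ((+) g ` cube k)) \<le>
      real (card (B - cube n)) * (real k ^ CARD('d) * ln (real CARD('a)))"
  proof (rule sum_bounded_above)
    fix g
    show "H ((+) g ` cube k) \<le> real k ^ CARD('d) * ln (real CARD('a))"
      using H_le[of "(+) g ` cube k"] by (simp add: card_image card_hcube)
  qed
  also have "real (card (B - cube n)) = (real n + (real k - 1)) ^ CARD('d) - real n ^ CARD('d)"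
    using CB cB by (subst card_Diff_subset)
      (auto simp: B_def of_nat_diff card_mono real_card_hcube)
  also have "(\<Sum>g\<in>cube n. H ((+) g ` cube k)) \<le>
      (\<Sum>g\<in>cube n. shannon q (\<lambda>x. restrict (shift g x) (cube k)))"
    unfolding H_def
  proof (intro sum_mono shannon_le_of_factor[OF ps])
    fix g :: "'d \<Rightarrow> int"
    show "simple_function q (\<lambda>x. restrict (shift g x) (cube k))"
      by (rule simple_function_measure_pmf, rule finite_subset[OF _ finite_range_restrict[of "cube k"]]) auto
  qed (simp add: restrict_eq_iff shift_eq add.commute)
  also have "\<dots> \<le> real n ^ CARD('d) * shannon (avg_pmf n q) (\<lambda>x. restrict x (cube k))"
    by (rule shannon_shift_avg_pmf) (use assms in auto)
  finally show ?thesis unfolding H_def using assms(1,2) by (simp add: field_simps)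
qed

lemma gibbs_pmf:
  assumes "finite Q" "Q \<noteq> {}"
  shows "\<exists>q. set_pmf q \<subseteq> Q \<and> (\<forall>x\<in>Q. pmf q x = exp (F x) / (\<Sum>x\<in>Q. exp (F x)))"
proof -
  define Z where "Z = (\<Sum>x\<in>Q. exp (F x))"
  have Z: "Z > 0" unfolding Z_def using assms by (intro sum_pos) auto
  define f where "f x = (if x \<in> Q then exp (F x) / Z else 0)" for x
  have f0: "0 \<le> f x" for x using Z by (simp add: f_def)
  have "(\<integral>\<^sup>+x. ennreal (f x) \<partial>count_space UNIV) = (\<Sum>x\<in>Q. ennreal (f x))"
    using assms(1) by (intro nn_integral_count_space') (auto simp: f_def)
  also have "\<dots> = ennreal (\<Sum>x\<in>Q. f x)" using f0 by (simp add: sum_ennreal)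
  also have "(\<Sum>x\<in>Q. f x) = 1" using Z by (simp add: f_def sum_divide_distrib[symmetric] Z_def)
  finally have *: "pmf (embed_pmf f) x = f x" for x using f0 by (intro pmf_embed_pmf) auto
  then have "set_pmf (embed_pmf f) \<subseteq> Q" by (auto simp: set_pmf_iff f_def split: if_splits)
  then show ?thesis using * by (intro exI[of _ "embed_pmf f"]) (auto simp: f_def Z_def)
qed

section \<open>Partition functions and equilibrium measures\<close>

text \<open>The case \<open>a = 0\<close> needs its own argument because \<open>ln\<close> is not
  continuous at 0; the square root bound squeezes the term.\<close>

lemma tendsto_entropy_term:
  fixes p :: "nat \<Rightarrow> real"
  assumes "p \<longlonglongrightarrow> a" "\<And>n. 0 \<le> p n" "\<And>n. p n \<le> 1"
  shows "(\<lambda>n. - (p n * ln (p n))) \<longlonglongrightarrow> - (a * ln a)"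
proof (cases "a = 0")
  case True
  have "(\<lambda>n. 2 * sqrt (p n)) \<longlonglongrightarrow> 2 * sqrt a" using assms(1) by (intro tendsto_intros)
  then have "(\<lambda>n. 2 * sqrt (p n)) \<longlonglongrightarrow> 0" using True by simp
  then have "(\<lambda>n. - (p n * ln (p n))) \<longlonglongrightarrow> 0"
    by (rule tendsto_sandwich[OF _ _ tendsto_const, rotated 2])
      (use assms neg_mult_ln_nonneg entropy_term_le_sqrt in \<open>auto intro!: always_eventually\<close>)
  then show ?thesis using True by simp
next
  case False
  then show ?thesis using assms(1) by (intro tendsto_intros)
qed

lemma cylinder_finite_dep: "finite S \<Longrightarrow> (\<lambda>x. restrict x S) -` {v} \<in> finite_dep"
  by (rule finite_depI[of S]) (auto simp: restrict_eq_iff[symmetric])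

lemma weak_limit_shannon:
  fixes P :: "nat \<Rightarrow> ('d::finite, 'a::finite) config pmf"
  assumes mu: "config_measure \<mu>" and S: "finite S"
    and lim: "\<And>E. E \<in> finite_dep \<Longrightarrow> (\<lambda>n. measure (P n) E) \<longlonglongrightarrow> measure \<mu> E"
  shows "(\<lambda>n. shannon (P n) (\<lambda>x. restrict x S)) \<longlonglongrightarrow> shannon \<mu> (\<lambda>x. restrict x S)"
proof -
  interpret config_measure \<mu> by fact
  have fV: "finite (PiE S (\<lambda>_. UNIV) :: ('d, 'a) config set)" using S by (simp add: finite_PiE)
  have "(\<lambda>n. \<Sum>v\<in>PiE S (\<lambda>_. UNIV). - (measure (P n) ((\<lambda>x. restrict x S) -` {v})
          * ln (measure (P n) ((\<lambda>x. restrict x S) -` {v}))))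
      \<longlonglongrightarrow> (\<Sum>v\<in>PiE S (\<lambda>_. UNIV). - (measure \<mu> ((\<lambda>x. restrict x S) -` {v})
          * ln (measure \<mu> ((\<lambda>x. restrict x S) -` {v}))))"
    by (intro tendsto_sum tendsto_entropy_term lim cylinder_finite_dep S) auto
  then show ?thesis
    by (subst (1 2) shannon_eq_sum[OF fV]) auto
qed

context summable_potential
begin

lemma integral_restrict_close:
  assumes "prob_space M" "integrable M \<phi>" "simple_function M (\<lambda>x. restrict x (box m))"
  shows "\<bar>(\<integral>x. \<phi> x \<partial>M) - (\<integral>x. \<phi> (restrict x (box m)) \<partial>M)\<bar> \<le> var m \<phi>"
proof -
  interpret prob_space M by fact
  obtain K where K: "\<And>x. \<bar>\<phi> x\<bar> \<le> K" using bounded_range by auto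
  have int: "integrable M (\<lambda>x. \<phi> (restrict x (box m)))"
    using simple_function_compose[OF assms(3), of \<phi>] K
    by (intro integrable_const_bound[of _ K] borel_measurable_simple_function) (auto simp: o_def)
  have "\<bar>(\<integral>x. \<phi> x \<partial>M) - (\<integral>x. \<phi> (restrict x (box m)) \<partial>M)\<bar>
      = \<bar>\<integral>x. \<phi> x - \<phi> (restrict x (box m)) \<partial>M\<bar>"
    using int assms(2) by simp
  also have "\<dots> \<le> (\<integral>x. \<bar>\<phi> x - \<phi> (restrict x (box m))\<bar> \<partial>M)" by (rule integral_abs_bound)
  also have "\<dots> \<le> var m \<phi>"
    using int assms(2) by (intro integral_le_const) (auto intro!: diff_le_var)
  finally show ?thesis .
qed

text \<open>Convergence is known on cylinders only; \<open>\<phi>\<close> is uniformly within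
  \<open>var m \<phi>\<close> of a function of the symbols in \<open>box m\<close>.\<close>

lemma weak_limit_integral:
  fixes P :: "nat \<Rightarrow> ('d, 'a) config pmf"
  assumes mu: "config_measure \<mu>"
    and lim: "\<And>E. E \<in> finite_dep \<Longrightarrow> (\<lambda>n. measure (P n) E) \<longlonglongrightarrow> measure \<mu> E"
  shows "(\<lambda>n. measure_pmf.expectation (P n) \<phi>) \<longlonglongrightarrow> (\<integral>x. \<phi> x \<partial>\<mu>)"
proof (rule LIMSEQ_I)
  fix e :: real assume e: "e > 0"
  interpret config_measure \<mu> by fact
  obtain K where K: "\<And>x. \<bar>\<phi> x\<bar> \<le> K" using bounded_range by auto
  obtain m where m: "var m \<phi> < e / 3"
    using order_tendstoD(2)[OF var_tendsto_0, of "e / 3"] e by (auto simp: eventually_sequentially)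
  let ?f = "\<lambda>x. restrict x (box m)"
  define V where "V = (PiE (box m) (\<lambda>_. UNIV) :: ('d, 'a) config set)"
  have fV: "finite V" by (simp add: V_def finite_PiE)
  have sP: "simple_function (P n) ?f" for n
    by (rule simple_function_measure_pmf[OF finite_range_restrict]) simp
  have "(\<lambda>n. \<Sum>v\<in>V. measure (P n) (?f -` {v}) * \<phi> v) \<longlonglongrightarrow> (\<Sum>v\<in>V. measure \<mu> (?f -` {v}) * \<phi> v)"
    by (intro tendsto_intros lim cylinder_finite_dep) simp
  moreover have "(\<Sum>v\<in>V. measure (P n) (?f -` {v}) * \<phi> v) = measure_pmf.expectation (P n) (\<lambda>x. \<phi> (?f x))" for n
    by (subst integral_simple_function_eq_sum[OF measure_pmf.prob_space_axioms sP fV]) (auto simp: V_def)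
  moreover have "(\<Sum>v\<in>V. measure \<mu> (?f -` {v}) * \<phi> v) = (\<integral>x. \<phi> (?f x) \<partial>\<mu>)"
    by (subst integral_simple_function_eq_sum[OF prob_space_axioms simple_restrict fV]) (auto simp: V_def)
  ultimately have "(\<lambda>n. measure_pmf.expectation (P n) (\<lambda>x. \<phi> (?f x))) \<longlonglongrightarrow> (\<integral>x. \<phi> (?f x) \<partial>\<mu>)" by simp
  then obtain N where N: "\<And>n. n \<ge> N \<Longrightarrow>
      norm (measure_pmf.expectation (P n) (\<lambda>x. \<phi> (?f x)) - (\<integral>x. \<phi> (?f x) \<partial>\<mu>)) < e / 3"
    using LIMSEQ_D[of _ _ "e / 3"] e by (metis divide_pos_pos zero_less_numeral)
  have "norm (measure_pmf.expectation (P n) \<phi> - (\<integral>x. \<phi> x \<partial>\<mu>)) < e" if "n \<ge> N" for n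
  proof -
    have "integrable (P n) \<phi>"
      by (rule measure_pmf.integrable_const_bound[of _ K]) (use K in auto)
    from integral_restrict_close[OF measure_pmf.prob_space_axioms this sP]
    have "\<bar>measure_pmf.expectation (P n) \<phi> - measure_pmf.expectation (P n) (\<lambda>x. \<phi> (?f x))\<bar> < e / 3"
      using m by (rule le_less_trans)
    moreover have "\<bar>(\<integral>x. \<phi> x \<partial>\<mu>) - (\<integral>x. \<phi> (?f x) \<partial>\<mu>)\<bar> < e / 3"
      using integral_restrict_close[OF prob_space_axioms integrable_potential[OF mu] simple_restrict] m
      by (meson finite_box le_less_trans)
    ultimately show ?thesis using N[OF that] by (simp add: abs_real_def split: if_splits)
  qed
  then show "\<exists>N. \<forall>n\<ge>N. norm (measure_pmf.expectation (P n) \<phi> - (\<integral>x. \<phi> x \<partial>\<mu>)) < e" by blast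
qed

text \<open>Patterns are full configurations with the filling \<open>undefined\<close> outside the
  cube, so that \<open>energy\<close> and \<open>overwrite\<close> apply to them directly.\<close>

definition patterns :: "nat \<Rightarrow> ('d, 'a) config set" where
  "patterns n = PiE (cube n) (\<lambda>_. UNIV)"

lemma finite_patterns: "finite (patterns n)"
  by (simp add: patterns_def finite_PiE)

lemma patterns_nonempty: "patterns n \<noteq> {}"
  by (simp add: patterns_def PiE_eq_empty_iff)

lemma restrict_in_patterns: "restrict x (cube n) \<in> patterns n"
  by (simp add: patterns_def)

text \<open>The filling outside the cube acts as a fixed boundary condition; by
  \<open>energy_restrict_cube\<close> its effect on the energy is of smaller order than the
  volume.\<close>

definition partition_function :: "real \<Rightarrow> nat \<Rightarrow> real" where
  "partition_function \<beta> n = (\<Sum>x\<in>patterns n. exp (\<beta> * energy (cube n) x))"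

lemma partition_function_pos: "partition_function \<beta> n > 0"
  unfolding partition_function_def using finite_patterns patterns_nonempty by (intro sum_pos) auto

text \<open>The equality case of the Gibbs inequality: for weights proportional to
  \<open>exp (F x)\<close>, each term of entropy plus energy is
  \<open>pmf q x * ln Z\<close>.\<close>

lemma gibbs_distribution:
  "\<exists>q. finite (set_pmf q) \<and> shannon q (\<lambda>x. restrict x (cube n))
     + \<beta> * measure_pmf.expectation q (energy (cube n)) = ln (partition_function \<beta> n)"
proof -
  let ?Z = "partition_function \<beta> n" and ?F = "\<lambda>x. \<beta> * energy (cube n) x"
  obtain q where q: "set_pmf q \<subseteq> patterns n" "\<And>x. x \<in> patterns n \<Longrightarrow> pmf q x = exp (?F x) / ?Z"
    using gibbs_pmf[OF finite_patterns[of n] patterns_nonempty, of ?F] unfolding partition_function_def by blast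
  have fin: "finite (set_pmf q)" using q(1) finite_patterns by (rule finite_subset)
  have id: "restrict x (cube n) = x" if "x \<in> patterns n" for x
    using that by (auto simp: patterns_def PiE_def extensional_restrict)
  have pv: "measure_pmf.prob q ((\<lambda>x. restrict x (cube n)) -` {v}) = pmf q v" if "v \<in> patterns n" for v
  proof -
    have "measure_pmf.prob q ((\<lambda>x. restrict x (cube n)) -` {v}) = measure_pmf.prob q {v}"
      using q(1) id by (intro measure_pmf.finite_measure_eq_AE) (auto simp: AE_measure_pmf_iff)
    then show ?thesis by (simp add: measure_pmf_single)
  qed
  have "shannon q (\<lambda>x. restrict x (cube n)) = (\<Sum>x\<in>patterns n. - (pmf q x * ln (pmf q x)))"
    by (subst shannon_eq_sum[OF finite_patterns[of n]]) (auto simp: restrict_in_patterns pv)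
  moreover have "\<beta> * measure_pmf.expectation q (energy (cube n)) = (\<Sum>x\<in>patterns n. pmf q x * ?F x)"
    using q(1) by (subst integral_measure_pmf[OF finite_patterns[of n]])
      (auto simp: sum_distrib_left algebra_simps)
  moreover have "(\<Sum>x\<in>patterns n. - (pmf q x * ln (pmf q x))) + (\<Sum>x\<in>patterns n. pmf q x * ?F x)
      = (\<Sum>x\<in>patterns n. pmf q x * ln ?Z)"
    unfolding sum.distrib[symmetric]
  proof (intro sum.cong refl)
    fix x assume "x \<in> patterns n"
    then have "ln (pmf q x) = ?F x - ln ?Z"
      using partition_function_pos[of \<beta> n] by (simp add: q(2) ln_div)
    then show "- (pmf q x * ln (pmf q x)) + pmf q x * ?F x = pmf q x * ln ?Z"
      by (simp add: right_diff_distrib)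
  qed
  moreover have "\<dots> = ln ?Z"
    using sum_pmf_eq_1[OF finite_patterns[of n] q(1)] by (simp add: sum_distrib_right[symmetric])
  ultimately show ?thesis using fin by auto
qed

text \<open>The measure arises, as in Misiurewicz's proof of the variational principle, as a limit of
  averaged translates of finite-volume Gibbs distributions.\<close>

theorem exists_measure_ge_pressure:
  "\<exists>\<mu>. invariant_measure \<mu> \<and>
    (\<forall>c. (\<forall>e>0. \<forall>\<^sub>F n in sequentially. c - e \<le> ln (partition_function \<beta> n) / real n ^ CARD('d))
      \<longrightarrow> c \<le> ks_entropy \<mu> + \<beta> * (\<integral>x. \<phi> x \<partial>\<mu>))"
proof -
  let ?E = "measure_pmf.expectation"
  have "\<forall>n. \<exists>q. finite (set_pmf q) \<and> shannon q (\<lambda>x. restrict x (cube n))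
     + \<beta> * ?E q (energy (cube n)) = ln (partition_function \<beta> n)"
    using gibbs_distribution ..
  from choice[OF this] obtain q where fin: "\<And>n. finite (set_pmf (q n))"
    and q: "\<And>n. shannon (q n) (\<lambda>x. restrict x (cube n))
     + \<beta> * ?E (q n) (energy (cube n)) = ln (partition_function \<beta> n)"
    by auto
  define P where "P n = avg_pmf n (q n)" for n
  obtain r \<mu> where r: "strict_mono r" and mu: "invariant_measure \<mu>"
    and lim: "\<And>E. E \<in> finite_dep \<Longrightarrow> (\<lambda>n. measure (P (r n)) E) \<longlonglongrightarrow> measure \<mu> E"
    using weak_compactness[OF avg_pmf_asymptotically_invariant[of q, OF fin, folded P_def]] by blast
  interpret invariant_measure \<mu> by fact
  have bound: "ln (partition_function \<beta> n) / real n ^ CARD('d) \<le>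
      shannon (P n) (\<lambda>x. restrict x (cube k)) / real k ^ CARD('d)
      + ((real n + (real k - 1)) ^ CARD('d) / real n ^ CARD('d) - 1) * ln (real CARD('a))
      + \<beta> * ?E (P n) \<phi>" if "n > 0" "k > 0" for n k
  proof -
    have "real n ^ CARD('d) * ?E (P n) \<phi> = (\<Sum>g\<in>cube n. ?E (q n) (\<lambda>x. \<phi> (shift g x)))"
      unfolding P_def by (rule expectation_avg_pmf[OF that(1) fin])
    also have "\<dots> = ?E (q n) (energy (cube n))"
      unfolding energy_def using fin[of n]
      by (intro Bochner_Integration.integral_sum[symmetric] integrable_measure_pmf_finite)
    finally have "\<beta> * ?E (q n) (energy (cube n)) / real n ^ CARD('d) = \<beta> * ?E (P n) \<phi>"
      using that by (simp add: field_simps)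
    then show ?thesis
      using shannon_cube_le_avg_pmf[OF that fin[of n]]
      unfolding q[symmetric] P_def by (simp add: add_divide_distrib)
  qed
  have "c \<le> ks_entropy \<mu> + \<beta> * (\<integral>x. \<phi> x \<partial>\<mu>)"
    if c: "\<And>e. e > 0 \<Longrightarrow> \<forall>\<^sub>F n in sequentially. c - e \<le> ln (partition_function \<beta> n) / real n ^ CARD('d)" for c
  proof -
    \<comment> \<open>For fixed \<open>k\<close> the pattern entropy on \<open>cube k\<close> passes
      to the limit along \<open>r\<close>; only afterwards does \<open>k\<close> tend to infinity,
      which turns it into the entropy rate.\<close>
    have step: "c \<le> pattern_entropy (cube k) / real k ^ CARD('d) + \<beta> * (\<integral>x. \<phi> x \<partial>\<mu>)" if k: "k > 0" for k
    proof (rule field_le_epsilon)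
      fix e :: real assume e: "e > 0"
      let ?err = "\<lambda>n. ((real n + (real k - 1)) ^ CARD('d) / real n ^ CARD('d) - 1) * ln (real CARD('a))"
      have "?err \<longlonglongrightarrow> (1 - 1) * ln (real CARD('a))"
        by (intro tendsto_intros cube_ratio_tendsto)
      then have "(\<lambda>n. ?err (r n)) \<longlonglongrightarrow> 0"
        using LIMSEQ_subseq_LIMSEQ[OF _ r, of ?err] by (simp add: o_def)
      then have "(\<lambda>n. shannon (P (r n)) (\<lambda>x. restrict x (cube k)) / real k ^ CARD('d)
          + ?err (r n) + \<beta> * ?E (P (r n)) \<phi>)
        \<longlonglongrightarrow> shannon \<mu> (\<lambda>x. restrict x (cube k)) / real k ^ CARD('d) + 0 + \<beta> * (\<integral>x. \<phi> x \<partial>\<mu>)"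
        using k by (intro tendsto_intros weak_limit_shannon weak_limit_integral lim config_measure_axioms) auto
      moreover have "\<forall>\<^sub>F n in sequentially. c - e \<le> shannon (P (r n)) (\<lambda>x. restrict x (cube k)) / real k ^ CARD('d)
          + ?err (r n) + \<beta> * ?E (P (r n)) \<phi>"
      proof -
        have "\<forall>\<^sub>F n in sequentially. c - e \<le> shannon (P n) (\<lambda>x. restrict x (cube k)) / real k ^ CARD('d)
          + ?err n + \<beta> * ?E (P n) \<phi>"
          using c[OF e] eventually_gt_at_top[of 0]
          by eventually_elim (rule order_trans[OF _ bound[OF _ k]])
        then show ?thesis by (rule eventually_subseq[OF r])
      qed
      ultimately have "c - e \<le> shannon \<mu> (\<lambda>x. restrict x (cube k)) / real k ^ CARD('d) + 0 + \<beta> * (\<integral>x. \<phi> x \<partial>\<mu>)"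
        by (intro tendsto_lowerbound) auto
      then show "c \<le> pattern_entropy (cube k) / real k ^ CARD('d) + \<beta> * (\<integral>x. \<phi> x \<partial>\<mu>) + e"
        by (simp add: pattern_entropy_def)
    qed
    have "c \<le> entropy_rate + \<beta> * (\<integral>x. \<phi> x \<partial>\<mu>)"
    proof (rule tendsto_lowerbound)
      show "(\<lambda>k. pattern_entropy (cube k) / real k ^ CARD('d) + \<beta> * (\<integral>x. \<phi> x \<partial>\<mu>))
        \<longlonglongrightarrow> entropy_rate + \<beta> * (\<integral>x. \<phi> x \<partial>\<mu>)"
        by (intro tendsto_intros entropy_rate)
      show "\<forall>\<^sub>F k in sequentially. c \<le> pattern_entropy (cube k) / real k ^ CARD('d) + \<beta> * (\<integral>x. \<phi> x \<partial>\<mu>)"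
        using eventually_gt_at_top[of 0] by eventually_elim (rule step)
    qed simp
    then show ?thesis by (simp add: ks_entropy_eq_rate)
  qed
  then show ?thesis using mu by blast
qed

end

section \<open>Modifying configurations on a grid of cells\<close>

text \<open>Cells of side \<open>2 * r + 1\<close> tile the lattice; the offset \<open>r\<close>
  makes each cell a translate of \<open>box r\<close>. With a centre attached to every site,
  overwriting any set of cells is a sitewise rule.\<close>

definition cell_center :: "nat \<Rightarrow> ('d \<Rightarrow> int) \<Rightarrow> ('d \<Rightarrow> int)" where
  "cell_center r p = (\<lambda>i. int (2 * r + 1) * (p i div int (2 * r + 1)) + int r)"

text \<open>Only centres of cells lying entirely in \<open>cube n\<close> are kept, so that writing
  on them never leaves the cube.\<close>

definition grid :: "nat \<Rightarrow> nat \<Rightarrow> ('d \<Rightarrow> int) set" where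
  "grid r n = (\<lambda>t i. int (2 * r + 1) * t i + int r) ` cube (n div (2 * r + 1))"

definition overwrite ::
  "nat \<Rightarrow> ('d \<Rightarrow> int) set \<Rightarrow> ('d, 'a) config \<Rightarrow> ('d, 'a) config \<Rightarrow> ('d, 'a) config" where
  "overwrite r s v z = (\<lambda>p. if cell_center r p \<in> s then v (p - cell_center r p) else z p)"

lemma finite_grid [simp]: "finite (grid r n :: ('d::finite \<Rightarrow> int) set)"
  by (simp add: grid_def)

lemma card_grid: "card (grid r n :: ('d::finite \<Rightarrow> int) set) = (n div (2 * r + 1)) ^ CARD('d)"
  unfolding grid_def
  by (subst card_image) (auto simp: inj_on_def fun_eq_iff card_hcube)

lemma minus_cell_center_in_box: "p - cell_center r p \<in> box r"
proof -
  have "\<bar>p i - (int (2 * r + 1) * (p i div int (2 * r + 1)) + int r)\<bar> \<le> int r" for i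
  proof -
    have "p i = int (2 * r + 1) * (p i div int (2 * r + 1)) + p i mod int (2 * r + 1)"
      by (rule mult_div_mod_eq[symmetric])
    moreover have "0 \<le> p i mod int (2 * r + 1)" "p i mod int (2 * r + 1) < int (2 * r + 1)" by simp_all
    ultimately show ?thesis by linarith
  qed
  then show ?thesis by (simp add: box_def cell_center_def)
qed

lemma cell_center_grid:
  assumes "\<gamma> \<in> grid r n" "h \<in> box r"
  shows "cell_center r (h + \<gamma>) = \<gamma>"
proof -
  obtain t where t: "\<gamma> = (\<lambda>i. int (2 * r + 1) * t i + int r)" using assms(1) by (auto simp: grid_def)
  have "(h + \<gamma>) i div int (2 * r + 1) = t i" for i
  proof -
    have h: "\<bar>h i\<bar> \<le> int r" using assms(2) by (simp add: box_def)
    have "(h + \<gamma>) i = (h i + int r) + t i * int (2 * r + 1)" by (simp add: t algebra_simps)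
    then have "(h + \<gamma>) i div int (2 * r + 1) = t i + (h i + int r) div int (2 * r + 1)"
      by (simp only: div_mult_self1 of_nat_eq_0_iff add_is_0) simp
    also have "(h i + int r) div int (2 * r + 1) = 0" using h by (intro div_pos_pos_trivial) auto
    finally show ?thesis by simp
  qed
  then show ?thesis by (simp add: cell_center_def t)
qed

lemma grid_cell_in_cube:
  assumes "\<gamma> \<in> grid r n" "h \<in> box r"
  shows "h + \<gamma> \<in> cube n"
proof -
  obtain t where t: "\<gamma> = (\<lambda>i. int (2 * r + 1) * t i + int r)" "t \<in> cube (n div (2 * r + 1))"
    using assms(1) by (auto simp: grid_def)
  have "0 \<le> (h + \<gamma>) i \<and> (h + \<gamma>) i < int n" for i
  proof -
    have h: "\<bar>h i\<bar> \<le> int r" using assms(2) by (simp add: box_def)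
    have ti: "0 \<le> t i" "t i < int (n div (2 * r + 1))"
      using t(2) unfolding hcube_def mem_Collect_eq by blast+
    have "int (2 * r + 1) * (t i + 1) \<le> int (2 * r + 1) * int (n div (2 * r + 1))"
      using zless_imp_add1_zle[OF ti(2)] by (rule mult_left_mono) simp
    also have "\<dots> = int ((2 * r + 1) * (n div (2 * r + 1)))" by (simp only: of_nat_mult)
    also have "\<dots> \<le> int n" unfolding of_nat_le_iff by (rule times_div_less_eq_dividend)
    finally have "int (2 * r + 1) * t i + int (2 * r + 1) \<le> int n" by (simp add: algebra_simps)
    moreover have "0 \<le> int (2 * r + 1) * t i" using ti(1) by simp
    ultimately show ?thesis using h by (simp add: t(1)) (smt (verit))
  qed
  then show ?thesis by (simp add: hcube_def)
qed

lemma cell_center_in_grid_imp_cube: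
  fixes p :: "'d::finite \<Rightarrow> int"
  shows "cell_center r p \<in> grid r n \<Longrightarrow> p \<in> cube n"
  using grid_cell_in_cube[OF _ minus_cell_center_in_box, of "cell_center r p" r n p] by simp

text \<open>Rounding costs at most a factor 2 per coordinate once \<open>n\<close> is at least twice
  the side of a cell. What matters is a positive density independent of \<open>n\<close>.\<close>

lemma grid_density:
  "\<forall>\<^sub>F n in sequentially. (1 / (2 * real (2 * r + 1))) ^ CARD('d) * real n ^ CARD('d)
    \<le> real (card (grid r n :: ('d::finite \<Rightarrow> int) set))"
  using eventually_ge_at_top[of "2 * (2 * r + 1)"]
proof eventually_elim
  case (elim n)
  define L where "L = 2 * r + 1"
  have L: "L > 0" by (simp add: L_def)
  have "n < L * (n div L) + L" using L mult_div_mod_eq[of L n] mod_less_divisor[OF L, of n] by linarith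
  then have "n \<le> 2 * L * (n div L)" using elim unfolding L_def[symmetric] by linarith
  then have "real n \<le> real (2 * L * (n div L))" by (simp only: of_nat_le_iff)
  then have "1 / (2 * real L) * real n \<le> real (n div L)" using L by (simp add: field_simps)
  then have "(1 / (2 * real L) * real n) ^ CARD('d) \<le> real (n div L) ^ CARD('d)"
    by (intro power_mono) auto
  then show ?case by (simp only: power_mult_distrib card_grid L_def of_nat_power)
qed

lemma overwrite_in_cell:
  assumes "s \<subseteq> grid r n" "\<gamma> \<in> s" "h \<in> box r"
  shows "overwrite r s v z (h + \<gamma>) = v h"
  using assms cell_center_grid[of \<gamma> r n h] by (auto simp: overwrite_def)

lemma overwrite_off_cell:
  assumes "\<gamma> \<in> grid r n" "\<gamma> \<notin> s" "h \<in> box r"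
  shows "overwrite r s v z (h + \<gamma>) = z (h + \<gamma>)"
  using assms cell_center_grid[of \<gamma> r n h] by (auto simp: overwrite_def)

definition cells :: "nat \<Rightarrow> ('d::finite \<Rightarrow> int) set \<Rightarrow> ('d \<Rightarrow> int) set" where
  "cells r s = (\<Union>\<gamma>\<in>s. (\<lambda>h. h + \<gamma>) ` box r)"

lemma cell_center_in_cells: "cell_center r p \<in> s \<Longrightarrow> p \<in> cells r s"
  unfolding cells_def
  by (rule UN_I[of "cell_center r p"])
    (auto intro!: image_eqI[OF _ minus_cell_center_in_box[of p r]])

lemma finite_cells: "finite s \<Longrightarrow> finite (cells r s :: ('d::finite \<Rightarrow> int) set)"
  by (simp add: cells_def)

lemma card_cells_le:
  assumes "finite (s :: ('d::finite \<Rightarrow> int) set)"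
  shows "card (cells r s) \<le> card s * card (box r :: ('d \<Rightarrow> int) set)"
proof -
  have "card (cells r s) \<le> (\<Sum>\<gamma>\<in>s. card ((\<lambda>h. h + \<gamma>) ` box r))"
    unfolding cells_def by (rule card_UN_le[OF assms])
  also have "\<dots> \<le> (\<Sum>\<gamma>\<in>s. card (box r :: ('d \<Rightarrow> int) set))"
    by (intro sum_mono card_image_le) auto
  finally show ?thesis by simp
qed

lemma overwrite_eq_off_cells: "p \<notin> cells r s \<Longrightarrow> overwrite r s v z p = z p"
  using cell_center_in_cells[of r p s] by (auto simp: overwrite_def)

lemma integrable_of_simple:
  fixes F :: "'v \<Rightarrow> real"
  assumes "prob_space M" "simple_function M f"
  shows "integrable M (\<lambda>x. F (f x))"
proof -
  interpret prob_space M by fact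
  have fin: "finite ((\<lambda>v. \<bar>F v\<bar>) ` f ` space M)" using simple_functionD(1)[OF assms(2)] by simp
  show ?thesis
  proof (rule integrable_const_bound)
    show "AE x in M. norm (F (f x)) \<le> Max ((\<lambda>v. \<bar>F v\<bar>) ` f ` space M)"
      using fin by (intro AE_I2) (auto intro!: Max_ge)
    show "(\<lambda>x. F (f x)) \<in> borel_measurable M"
      using simple_function_compose[OF assms(2), of F]
      by (intro borel_measurable_simple_function) (simp add: o_def)
  qed
qed

lemma sum_Pow_power_card:
  fixes t :: real
  shows "finite G \<Longrightarrow> (\<Sum>s\<in>Pow G. t ^ card s) = (1 + t) ^ card G"
proof (induction rule: finite_induct)
  case (insert x G)
  have "(\<Sum>s\<in>Pow (insert x G). t ^ card s) = (\<Sum>s\<in>Pow G. t ^ card s) + (\<Sum>s\<in>insert x ` Pow G. t ^ card s)"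
    unfolding Pow_insert using insert by (intro sum.union_disjoint) auto
  also have "(\<Sum>s\<in>insert x ` Pow G. t ^ card s) = (\<Sum>s\<in>Pow G. t * t ^ card s)"
    using insert by (intro sum.reindex_cong[of "insert x"])
      (auto simp: inj_on_def card_insert_if finite_subset)
  finally show ?case using insert by (simp add: sum_distrib_left[symmetric] algebra_simps)
qed simp

section \<open>Lower bounds for partition functions\<close>

context summable_potential
begin

lemma energy_overwrite_diff_le:
  assumes "finite s"
  shows "\<bar>energy (cube n) (overwrite r s v z) - energy (cube n) z\<bar>
    \<le> real (card s) * (real (card (box r :: ('d \<Rightarrow> int) set)) * total_influence)"
proof -
  have "\<bar>energy (cube n) (overwrite r s v z) - energy (cube n) z\<bar> \<le> real (card (cells r s)) * total_influence"
    by (rule energy_diff_le[OF finite_cells[OF assms]]) (simp_all add: overwrite_eq_off_cells)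
  also have "\<dots> \<le> real (card s * card (box r :: ('d \<Rightarrow> int) set)) * total_influence"
    by (intro mult_right_mono of_nat_mono card_cells_le assms total_influence_nonneg)
  finally show ?thesis by (simp add: mult.assoc)
qed

lemma overwrite_in_patterns:
  assumes "s \<subseteq> grid r n" "z \<in> patterns n"
  shows "overwrite r s v z \<in> patterns n"
proof -
  have "overwrite r s v z p = undefined" if "p \<notin> cube n" for p
    using that assms cell_center_in_grid_imp_cube[of r p n]
    by (auto simp: overwrite_def patterns_def PiE_def extensional_def)
  then show ?thesis by (auto simp: patterns_def PiE_def extensional_def)
qed

lemma integral_energy_restrict:
  assumes "invariant_measure \<mu>" "e > 0"
  shows "\<forall>\<^sub>F n in sequentially. real n ^ CARD('d) * (\<integral>x. \<phi> x \<partial>\<mu>) - e * real n ^ CARD('d)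
    \<le> (\<integral>x. energy (cube n) (restrict x (cube n)) \<partial>\<mu>)"
  using energy_restrict_cube[OF assms(2)]
proof eventually_elim
  case (elim n)
  interpret invariant_measure \<mu> by fact
  have int: "integrable \<mu> (\<lambda>x. energy (cube n) (restrict x (cube n)))"
    by (rule integrable_of_simple[OF prob_space_axioms simple_restrict]) simp
  have int': "integrable \<mu> (energy (cube n))"
    and total: "(\<integral>x. energy (cube n) x \<partial>\<mu>) = real n ^ CARD('d) * (\<integral>x. \<phi> x \<partial>\<mu>)"
    using integral_energy[OF assms(1), of "cube n"] by (simp_all add: card_hcube)
  have "(\<integral>x. energy (cube n) x - e * real n ^ CARD('d) \<partial>\<mu>)
      \<le> (\<integral>x. energy (cube n) (restrict x (cube n)) \<partial>\<mu>)"
  proof (rule integral_mono)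
    fix x
    show "energy (cube n) x - e * real n ^ CARD('d) \<le> energy (cube n) (restrict x (cube n))"
      using elim[rule_format, of x] by linarith
  qed (use int int' in auto)
  then show ?case
    using Bochner_Integration.integral_diff[OF int' integrable_const[of "e * real n ^ CARD('d)"]]
    using prob_space by (simp add: total)
qed

text \<open>The common last step of three lower bounds: \<open>a\<close> is the entropy retained per
  site and \<open>\<kappa>\<close> the gain per cell of the grid.\<close>

lemma pressure_ge_of_bound:
  assumes inv: "invariant_measure \<mu>" and "\<beta> > 0" and "\<kappa> \<ge> 0"
    and bound: "\<And>n. a * real n ^ CARD('d)
      + \<beta> * (\<integral>x. energy (cube n) (restrict x (cube n)) \<partial>\<mu>)
      + real (card (grid r n :: ('d \<Rightarrow> int) set)) * \<kappa> \<le> ln (partition_function \<beta> n)"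
    and e: "e > 0"
  shows "\<forall>\<^sub>F n in sequentially. a + \<beta> * (\<integral>x. \<phi> x \<partial>\<mu>)
    + (1 / (2 * real (2 * r + 1))) ^ CARD('d) * \<kappa> - e \<le> ln (partition_function \<beta> n) / real n ^ CARD('d)"
proof -
  \<comment> \<open>The energy error will be multiplied by \<open>\<beta>\<close>.\<close>
  have "e / \<beta> > 0" using e assms(2) by simp
  from integral_energy_restrict[OF inv this] grid_density[of r, where 'd = 'd] eventually_gt_at_top[of 0]
  show ?thesis
  proof eventually_elim
    case (elim n)
    define N where "N = real n ^ CARD('d)"
    define R where "R = (1 / (2 * real (2 * r + 1))) ^ CARD('d)"
    have N: "N > 0" using elim(3) by (simp add: N_def)
    have "\<beta> * (N * (\<integral>x. \<phi> x \<partial>\<mu>) - e / \<beta> * N)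
        \<le> \<beta> * (\<integral>x. energy (cube n) (restrict x (cube n)) \<partial>\<mu>)"
      using elim(1) assms(2) unfolding N_def by (intro mult_left_mono) auto
    also have "\<beta> * (N * (\<integral>x. \<phi> x \<partial>\<mu>) - e / \<beta> * N) = N * (\<beta> * (\<integral>x. \<phi> x \<partial>\<mu>) - e)"
      using assms(2) by (simp add: field_simps)
    finally have 1: "N * (\<beta> * (\<integral>x. \<phi> x \<partial>\<mu>) - e)
        \<le> \<beta> * (\<integral>x. energy (cube n) (restrict x (cube n)) \<partial>\<mu>)" .
    have "R * N * \<kappa> \<le> real (card (grid r n :: ('d \<Rightarrow> int) set)) * \<kappa>"
      using elim(2) assms(3) unfolding R_def N_def by (intro mult_right_mono)
    with 1 bound[of n] have "a * N + N * (\<beta> * (\<integral>x. \<phi> x \<partial>\<mu>) - e) + R * N * \<kappa> \<le> ln (partition_function \<beta> n)"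
      unfolding N_def[symmetric] by linarith
    then have "(a + \<beta> * (\<integral>x. \<phi> x \<partial>\<mu>) + R * \<kappa> - e) * N \<le> ln (partition_function \<beta> n)"
      by (simp add: algebra_simps)
    then show ?case using N unfolding R_def[symmetric] N_def[symmetric] by (simp add: pos_le_divide_eq)
  qed
qed

lemma entropy_le_pattern_entropy:
  fixes \<mu> :: "('d, 'a) config measure"
  assumes "invariant_measure \<mu>"
  shows "ks_entropy \<mu> * real n ^ CARD('d) \<le> shannon \<mu> (\<lambda>x. restrict x (cube n))"
proof -
  interpret invariant_measure \<mu> by fact
  show ?thesis
  proof (cases "n = 0")
    case False
    then have "entropy_rate \<le> pattern_entropy (cube n) / real n ^ CARD('d)"
      using entropy_rate(2)[of n] by simp
    then show ?thesis
      using False by (simp add: ks_entropy_eq_rate pattern_entropy_def pos_le_divide_eq)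
  qed (simp add: zero_power shannon_nonneg[OF prob_space_axioms])
qed

text \<open>One half of the variational principle: the law of \<mu> on the cube is the trial
  distribution. Nothing is overwritten, so the gain per cell is 0.\<close>

lemma pressure_ge_free_energy:
  assumes inv: "invariant_measure \<mu>" and "\<beta> > 0" "e > 0"
  shows "\<forall>\<^sub>F n in sequentially. ks_entropy \<mu> + \<beta> * (\<integral>x. \<phi> x \<partial>\<mu>) - e
    \<le> ln (partition_function \<beta> n) / real n ^ CARD('d)"
proof -
  interpret invariant_measure \<mu> by fact
  have "ks_entropy \<mu> * real n ^ CARD('d) + \<beta> * (\<integral>x. energy (cube n) (restrict x (cube n)) \<partial>\<mu>)
      + real (card (grid 0 n :: ('d \<Rightarrow> int) set)) * 0 \<le> ln (partition_function \<beta> n)" for n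
    using entropy_le_pattern_entropy[OF inv, of n]
      gibbs_inequality[OF prob_space_axioms simple_restrict finite_patterns[of n], of "cube n"
        "\<lambda>x. \<beta> * energy (cube n) x"]
    by (simp add: restrict_in_patterns partition_function_def)
  from pressure_ge_of_bound[OF inv assms(2) _ this assms(3)] show ?thesis by simp
qed

text \<open>If the pattern \<open>w\<close> never occurs under \<open>\<mu>\<close>, then the set of grid cells on which \<open>w\<close> has been
  written can be read off the result. Writing \<open>w\<close> on \<open>k\<close> cells costs at most \<open>c * k\<close> in free
  energy, so summing over all sets of cells multiplies the partition function by
  \<open>(1 + exp (- c))\<close> per cell.\<close>

lemma pressure_gt_of_missing_pattern:
  assumes inv: "invariant_measure \<mu>" and "\<beta> > 0"
    and zero: "measure \<mu> {x. \<forall>h\<in>box r. x h = w h} = 0"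
  shows "\<exists>\<kappa>>0. \<forall>e>0. \<forall>\<^sub>F n in sequentially. ks_entropy \<mu> + \<beta> * (\<integral>x. \<phi> x \<partial>\<mu>) + \<kappa> - e
    \<le> ln (partition_function \<beta> n) / real n ^ CARD('d)"
proof -
  interpret invariant_measure \<mu> by fact
  define b where "b = real (card (box r :: ('d \<Rightarrow> int) set))"
  \<comment> \<open>The price of one cell: erasing its \<open>b\<close> sites loses at most
    \<open>ln (real CARD('a))\<close> of entropy and \<open>total_influence\<close> of energy per
    site, the latter weighted by \<open>\<beta>\<close>.\<close>
  define c where "c = b * (ln (real CARD('a)) + \<beta> * total_influence)"
  define \<kappa> where "\<kappa> = ln (1 + exp (- c))"
  have k: "\<kappa> > 0" unfolding \<kappa>_def by (rule ln_gt_zero) simp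
  have W: "{x. \<forall>h\<in>box r. x h = w h} \<in> sets \<mu>"
    by (rule sets_finite_dep[of "box r"]) auto
  have bound: "ks_entropy \<mu> * real n ^ CARD('d)
      + \<beta> * (\<integral>x. energy (cube n) (restrict x (cube n)) \<partial>\<mu>)
      + real (card (grid r n :: ('d \<Rightarrow> int) set)) * \<kappa> \<le> ln (partition_function \<beta> n)" for n
  proof -
    let ?x = "\<lambda>x. restrict x (cube n) :: ('d, 'a) config"
    define G where "G = (grid r n :: ('d \<Rightarrow> int) set)"
    have fG: "finite G" by (simp add: G_def)
    define occ where "occ y = {\<gamma>\<in>G. \<forall>h\<in>box r. y (h + \<gamma>) = w h}" for y :: "('d, 'a) config"
    define V where "V s = {y \<in> patterns n. occ y = s}" for s
    have fV: "finite (V s)" for s using finite_patterns by (simp add: V_def)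
    define Y where "Y s x = overwrite r s w (?x x)" for s x
    define a where "a = shannon \<mu> ?x + \<beta> * (\<integral>x. energy (cube n) (?x x) \<partial>\<mu>)"
    have noocc: "AE x in \<mu>. \<forall>\<gamma>\<in>G. \<not> (\<forall>h\<in>box r. x (h + \<gamma>) = w h)"
    proof (rule AE_finite_allI[OF fG])
      fix \<gamma>
      have "measure \<mu> (shift \<gamma> -` {x. \<forall>h\<in>box r. x h = w h}) = 0"
        using measure_shift_vimage[OF W] zero by simp
      moreover have "shift \<gamma> -` {x. \<forall>h\<in>box r. x h = w h} \<in> sets \<mu>"
        using measurable_sets[OF measurable_shift_mu W] by simp
      ultimately have "AE x in \<mu>. x \<notin> shift \<gamma> -` {x. \<forall>h\<in>box r. x h = w h}"
        by (simp add: prob_eq_0)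
      then show "AE x in \<mu>. \<not> (\<forall>h\<in>box r. x (h + \<gamma>) = w h)" by (simp add: shift_eq)
    qed
    have YV: "AE x in \<mu>. Y s x \<in> V s" if s: "s \<subseteq> G" for s
      using noocc
    proof (rule AE_mp, intro AE_I2 impI)
      fix x assume x: "\<forall>\<gamma>\<in>G. \<not> (\<forall>h\<in>box r. x (h + \<gamma>) = w h)"
      have sg: "s \<subseteq> grid r n" using s by (simp add: G_def)
      have "Y s x \<in> patterns n"
        unfolding Y_def by (rule overwrite_in_patterns[OF sg restrict_in_patterns])
      moreover have "(\<forall>h\<in>box r. Y s x (h + \<gamma>) = w h) \<longleftrightarrow> \<gamma> \<in> s" if g: "\<gamma> \<in> G" for \<gamma>
      proof (cases "\<gamma> \<in> s")
        case True
        then show ?thesis by (simp add: Y_def overwrite_in_cell[OF sg])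
      next
        case False
        have g': "\<gamma> \<in> grid r n" using g by (simp add: G_def)
        \<comment> \<open>Cells are disjoint, so a cell that was not selected keeps its original
          symbols, and almost surely these do not spell \<open>w\<close>.\<close>
        have "Y s x (h + \<gamma>) = x (h + \<gamma>)" if "h \<in> box r" for h
          unfolding Y_def overwrite_off_cell[OF g' False that]
          by (simp add: grid_cell_in_cube[OF g' that])
        then show ?thesis using x g False by simp
      qed
      ultimately show "Y s x \<in> V s" using s by (auto simp: V_def occ_def)
    qed
    have simpleY: "simple_function \<mu> (Y s)" for s
      by (rule simple_function_of_factor[OF simple_restrict[of "cube n"]]) (simp_all add: Y_def)
    have ln_ge: "exp (a - c * real (card s)) \<le> (\<Sum>y\<in>V s. exp (\<beta> * energy (cube n) y))" if s: "s \<subseteq> G" for s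
    proof -
      have fs: "finite s" using s fG by (rule finite_subset)
      have fc: "finite (cells r s)" using fs by (rule finite_cells)
      \<comment> \<open>The original pattern can be recovered from the overwritten one and the
        erased symbols.\<close>
      have "shannon \<mu> ?x \<le> shannon \<mu> (\<lambda>x. (Y s x, restrict x (cells r s)))"
      proof (rule shannon_le_of_factor[OF prob_space_axioms simple_function_Pair[OF simpleY simple_restrict[OF fc]]])
        fix x y assume eq: "(Y s x, restrict x (cells r s)) = (Y s y, restrict y (cells r s))"
        have "x p = y p" if "p \<in> cube n" for p
        proof (cases "p \<in> cells r s")
          case True
          then show ?thesis using eq by (simp add: restrict_eq_iff)
        next
          case False
          then have "Y s x p = x p" "Y s y p = y p"
            using that by (simp_all add: Y_def overwrite_eq_off_cells)
          then show ?thesis using eq by simp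
        qed
        then show "?x x = ?x y" by (simp add: restrict_eq_iff)
      qed
      also have "\<dots> \<le> shannon \<mu> (Y s) + shannon \<mu> (\<lambda>x. restrict x (cells r s))"
        by (rule shannon_Pair_le[OF prob_space_axioms simpleY simple_restrict[OF fc]])
      also have "shannon \<mu> (\<lambda>x. restrict x (cells r s)) \<le> (\<Sum>p\<in>cells r s. shannon \<mu> (\<lambda>x. x p))"
        using shannon_family_le_sum[OF prob_space_axioms simple_coordinate fc] by simp
      also have "\<dots> \<le> (\<Sum>p\<in>cells r s. ln (real CARD('a)))"
        by (intro sum_mono shannon_le_ln_card[OF prob_space_axioms simple_coordinate]) auto
      also have "\<dots> = real (card (cells r s)) * ln (real CARD('a))" by simp
      also have "\<dots> \<le> real (card s * card (box r :: ('d \<Rightarrow> int) set)) * ln (real CARD('a))"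
        by (intro mult_right_mono of_nat_mono card_cells_le fs) simp
      finally have 1: "shannon \<mu> ?x \<le> shannon \<mu> (Y s) + real (card s) * (b * ln (real CARD('a)))"
        by (simp add: b_def mult.assoc del: restrict_apply)
      have "(\<integral>x. energy (cube n) (?x x) - real (card s) * (b * total_influence) \<partial>\<mu>)
          \<le> (\<integral>x. energy (cube n) (Y s x) \<partial>\<mu>)"
      proof (rule integral_mono)
        fix x
        show "energy (cube n) (?x x) - real (card s) * (b * total_influence) \<le> energy (cube n) (Y s x)"
          using energy_overwrite_diff_le[OF fs, of n r w "?x x"] unfolding Y_def b_def by linarith
      qed (auto intro!: Bochner_Integration.integrable_diff
          integrable_of_simple[OF prob_space_axioms simpleY]
          integrable_of_simple[OF prob_space_axioms simple_restrict[of "cube n"]])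
      also have "(\<integral>x. energy (cube n) (?x x) - real (card s) * (b * total_influence) \<partial>\<mu>)
          = (\<integral>x. energy (cube n) (?x x) \<partial>\<mu>) - real (card s) * (b * total_influence)"
        by (subst Bochner_Integration.integral_diff)
          (use prob_space in \<open>auto intro!: integrable_of_simple[OF prob_space_axioms simple_restrict[of "cube n"]]\<close>)
      finally have "\<beta> * ((\<integral>x. energy (cube n) (?x x) \<partial>\<mu>) - real (card s) * (b * total_influence))
          \<le> \<beta> * (\<integral>x. energy (cube n) (Y s x) \<partial>\<mu>)"
        using assms(2) by (intro mult_left_mono) auto
      moreover have "shannon \<mu> (Y s) + \<beta> * (\<integral>x. energy (cube n) (Y s x) \<partial>\<mu>)
          \<le> ln (\<Sum>y\<in>V s. exp (\<beta> * energy (cube n) y))"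
        using gibbs_inequality[OF prob_space_axioms simpleY fV YV[OF s], of "\<lambda>x. \<beta> * energy (cube n) x"]
        by simp
      ultimately have "a - c * real (card s) \<le> ln (\<Sum>y\<in>V s. exp (\<beta> * energy (cube n) y))"
        using 1 by (simp add: a_def c_def algebra_simps)
      moreover have "V s \<noteq> {}"
        using prob_sum_fibres[OF prob_space_axioms simpleY fV YV[OF s]] by auto
      then have "(\<Sum>y\<in>V s. exp (\<beta> * energy (cube n) y)) > 0" using fV by (intro sum_pos) auto
      ultimately show ?thesis using ln_ge_iff by blast
    qed
    have "exp (a + real (card G) * \<kappa>) = exp a * (1 + exp (- c)) ^ card G"
    proof -
      have "exp (real (card G) * \<kappa>) = exp \<kappa> ^ card G" by (rule exp_of_nat_mult)
      moreover have "exp \<kappa> = 1 + exp (- c)" unfolding \<kappa>_def by (rule exp_ln) (simp add: add_pos_pos)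
      ultimately show ?thesis by (simp add: exp_add)
    qed
    also have "\<dots> = (\<Sum>s\<in>Pow G. exp (a - c * real (card s)))"
      unfolding sum_Pow_power_card[OF fG, symmetric]
      by (simp add: sum_distrib_left exp_diff exp_minus field_simps flip: exp_of_nat_mult)
    also have "\<dots> \<le> (\<Sum>s\<in>Pow G. \<Sum>y\<in>V s. exp (\<beta> * energy (cube n) y))"
      by (intro sum_mono ln_ge) auto
    \<comment> \<open>The sets \<open>V s\<close> are the fibres of \<open>occ\<close>, so no
      pattern is counted twice; this is what decoding \<open>s\<close> from the result
      achieves.\<close>
    also have "\<dots> = partition_function \<beta> n"
      unfolding V_def partition_function_def
      by (rule sum.group) (use finite_patterns fG in \<open>auto simp: occ_def\<close>)
    finally have "a + real (card G) * \<kappa> \<le> ln (partition_function \<beta> n)"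
      using partition_function_pos by (simp add: ln_ge_iff)
    then show ?thesis
      using entropy_le_pattern_entropy[OF inv, of n] by (simp add: a_def G_def)
  qed
  define R where "R = (1 / (2 * real (2 * r + 1))) ^ CARD('d)"
  have "R * \<kappa> > 0" using k by (simp add: R_def)
  moreover have "\<forall>e>0. \<forall>\<^sub>F n in sequentially. ks_entropy \<mu> + \<beta> * (\<integral>x. \<phi> x \<partial>\<mu>) + R * \<kappa> - e
    \<le> ln (partition_function \<beta> n) / real n ^ CARD('d)"
    unfolding R_def using pressure_ge_of_bound[OF inv assms(2) less_imp_le[OF k] bound] by blast
  ultimately show ?thesis by blast
qed

\<comment> \<open>Overwriting a pattern of positive probability\<close>
end

context summable_potential
begin

text \<open>Occurrences are overwritten one cell at a time. Earlier replacements disturb the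
  surroundings of later ones, but \<open>gain\<close> requires agreement with \<open>u\<close> on
  the box only and so survives. Since \<open>gain\<close> is stated around the origin, the window is
  translated to the cell.\<close>

lemma energy_overwrite_gain:
  fixes z :: "('d, 'a) config"
  assumes "\<delta> > 0"
    and gain: "\<And>W z z'. finite W \<Longrightarrow> box r \<subseteq> W \<Longrightarrow> (\<forall>h\<in>box r. z h = u h \<and> z' h = v h) \<Longrightarrow>
      (\<forall>h. h \<notin> box r \<longrightarrow> z h = z' h) \<Longrightarrow> energy W z + \<delta> \<le> energy W z'"
    and s: "finite s" "s \<subseteq> grid r n" and occ: "\<And>(\<gamma> :: 'd \<Rightarrow> int) h. \<gamma> \<in> s \<Longrightarrow> h \<in> box r \<Longrightarrow> z (h + \<gamma>) = u h"
  shows "energy (cube n) z + \<delta> * real (card s) \<le> energy (cube n) (overwrite r s v z)"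
  using s occ
proof (induction rule: finite_induct)
  case empty
  have "overwrite r {} v z = z" by (simp add: overwrite_def)
  then show ?case by simp
next
  case (insert \<gamma> s)
  let ?z1 = "overwrite r s v z" and ?z2 = "overwrite r (insert \<gamma> s) v z"
  define W where "W = (+) (- \<gamma>) ` (cube n :: ('d \<Rightarrow> int) set)"
  have cube: "cube n = (+) \<gamma> ` W" by (simp add: W_def image_image)
  have g: "\<gamma> \<in> grid r n" using insert.prems(1) by simp
  have "energy W (shift \<gamma> ?z1) + \<delta> \<le> energy W (shift \<gamma> ?z2)"
  proof (rule gain)
    show "finite W" by (simp add: W_def)
    show "box r \<subseteq> W"
    proof
      fix h :: "'d \<Rightarrow> int" assume "h \<in> box r"
      then have "h + \<gamma> \<in> cube n" by (rule grid_cell_in_cube[OF g])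
      then have "- \<gamma> + (h + \<gamma>) \<in> W" unfolding W_def by (rule imageI)
      then show "h \<in> W" by simp
    qed
    show "\<forall>h\<in>box r. shift \<gamma> ?z1 h = u h \<and> shift \<gamma> ?z2 h = v h"
    proof
      fix h :: "'d \<Rightarrow> int" assume h: "h \<in> box r"
      have "z (h + \<gamma>) = u h" by (rule insert.prems(2)) (use h in simp_all)
      then show "shift \<gamma> ?z1 h = u h \<and> shift \<gamma> ?z2 h = v h"
        using overwrite_off_cell[OF g insert.hyps(2) h, of v z]
          overwrite_in_cell[OF insert.prems(1) insertI1 h, of v z]
        by (simp add: shift_eq)
    qed
    show "\<forall>h. h \<notin> box r \<longrightarrow> shift \<gamma> ?z1 h = shift \<gamma> ?z2 h"
    proof (intro allI impI)
      fix h :: "'d \<Rightarrow> int" assume h: "h \<notin> box r"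
      have "cell_center r (h + \<gamma>) \<noteq> \<gamma>"
        using minus_cell_center_in_box[of "h + \<gamma>" r] h by auto
      then show "shift \<gamma> ?z1 h = shift \<gamma> ?z2 h" by (simp add: shift_eq overwrite_def)
    qed
  qed
  then have "energy (cube n) ?z1 + \<delta> \<le> energy (cube n) ?z2"
    unfolding cube energy_translate .
  moreover have "energy (cube n) z + \<delta> * real (card s) \<le> energy (cube n) ?z1"
    using insert.prems by (intro insert.IH) auto
  ultimately show ?case using insert.hyps by (simp add: algebra_simps)
qed

text \<open>Every occurrence of \<open>u\<close> at a grid cell is replaced by \<open>v\<close>; by
  invariance the expected number of occurrences is the size of the grid times the probability of the
  pattern. The leading \<open>0 +\<close> is the entropy term of
  \<open>pressure_ge_of_bound\<close>.\<close>

lemma pressure_ge_of_improvable_pattern: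
  assumes inv: "invariant_measure \<mu>" and "\<beta> > 0" and "\<delta> > 0"
    and gain: "\<And>W z z'. finite W \<Longrightarrow> box r \<subseteq> W \<Longrightarrow> (\<forall>h\<in>box r. z h = u h \<and> z' h = v h) \<Longrightarrow>
      (\<forall>h. h \<notin> box r \<longrightarrow> z h = z' h) \<Longrightarrow> energy W z + \<delta> \<le> energy W z'"
    and "e > 0"
  shows "\<forall>\<^sub>F n in sequentially. 0 + \<beta> * (\<integral>x. \<phi> x \<partial>\<mu>) + (1 / (2 * real (2 * r + 1))) ^ CARD('d)
      * (\<beta> * \<delta> * measure \<mu> {x. \<forall>h\<in>box r. x h = u h}) - e
    \<le> ln (partition_function \<beta> n) / real n ^ CARD('d)"
proof (rule pressure_ge_of_bound[OF inv assms(2) _ _ assms(5)])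
  interpret invariant_measure \<mu> by fact
  define U where "U = {x :: ('d, 'a) config. \<forall>h\<in>box r. x h = u h}"
  have U: "U \<in> sets \<mu>" unfolding U_def by (rule sets_finite_dep[of "box r"]) auto
  fix n
  let ?x = "\<lambda>x. restrict x (cube n) :: ('d, 'a) config"
  define G where "G = (grid r n :: ('d \<Rightarrow> int) set)"
  have fG: "finite G" by (simp add: G_def)
  define occ where "occ y = {\<gamma>\<in>G. \<forall>h\<in>box r. y (h + \<gamma>) = u h}" for y :: "('d, 'a) config"
  define Y where "Y x = overwrite r (occ (?x x)) v (?x x)" for x
  have occ_sub: "occ y \<subseteq> grid r n" for y by (auto simp: occ_def G_def)
  have simpleY: "simple_function \<mu> Y"
    by (rule simple_function_of_factor[OF simple_restrict[of "cube n"]]) (simp_all add: Y_def)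
  have occ_x: "occ (?x x) = {\<gamma>\<in>G. shift \<gamma> x \<in> U}" for x
    unfolding occ_def U_def using grid_cell_in_cube[of _ r n] by (auto simp: shift_eq G_def)
  have int1: "integrable \<mu> (\<lambda>x. energy (cube n) (?x x))"
    by (rule integrable_of_simple[OF prob_space_axioms simple_restrict]) simp
  have int2: "integrable \<mu> (\<lambda>x. real (card (occ (?x x))))"
    by (rule integrable_of_simple[OF prob_space_axioms simple_restrict]) simp
  have int3: "integrable \<mu> (\<lambda>x. energy (cube n) (Y x))"
    by (rule integrable_of_simple[OF prob_space_axioms simpleY])
  have count: "(\<integral>x. real (card (occ (?x x))) \<partial>\<mu>) = real (card G) * measure \<mu> U"
  proof -
    have V: "shift \<gamma> -` U \<in> sets \<mu>" for \<gamma> using measurable_sets[OF measurable_shift_mu U] by simp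
    have "(\<integral>x. real (card (occ (?x x))) \<partial>\<mu>) = (\<integral>x. (\<Sum>\<gamma>\<in>G. indicator (shift \<gamma> -` U) x) \<partial>\<mu>)"
      using fG by (simp only: occ_x) (simp add: indicator_def sum.If_cases Int_def)
    also have "\<dots> = (\<Sum>\<gamma>\<in>G. \<integral>x. indicator (shift \<gamma> -` U) x \<partial>\<mu>)"
      using V by (intro Bochner_Integration.integral_sum) (simp add: less_top[symmetric])
    also have "\<dots> = (\<Sum>\<gamma>\<in>G. measure \<mu> U)"
      using V by (intro sum.cong refl) (simp add: measure_shift_vimage[OF U])
    finally show ?thesis by simp
  qed
  have "(\<integral>x. energy (cube n) (?x x) + \<delta> * real (card (occ (?x x))) \<partial>\<mu>) \<le> (\<integral>x. energy (cube n) (Y x) \<partial>\<mu>)"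
  proof (rule integral_mono)
    fix x
    show "energy (cube n) (?x x) + \<delta> * real (card (occ (?x x))) \<le> energy (cube n) (Y x)"
      unfolding Y_def
    proof (rule energy_overwrite_gain[OF assms(3) gain _ occ_sub])
      show "finite (occ (?x x))" using fG by (simp add: occ_def)
    qed (auto simp: occ_def)
  qed (use int1 int2 int3 in auto)
  then have "(\<integral>x. energy (cube n) (?x x) \<partial>\<mu>) + \<delta> * (real (card G) * measure \<mu> U)
      \<le> (\<integral>x. energy (cube n) (Y x) \<partial>\<mu>)"
    using int1 int2 by (simp add: count[symmetric] del: restrict_apply)
  then have "\<beta> * ((\<integral>x. energy (cube n) (?x x) \<partial>\<mu>) + \<delta> * (real (card G) * measure \<mu> U))
      \<le> \<beta> * (\<integral>x. energy (cube n) (Y x) \<partial>\<mu>)"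
    using assms(2) by (intro mult_left_mono) auto
  \<comment> \<open>The unknown entropy of the modified pattern is bounded below by 0.\<close>
  also have "\<dots> \<le> shannon \<mu> Y + (\<integral>x. \<beta> * energy (cube n) (Y x) \<partial>\<mu>)"
    using shannon_nonneg[OF prob_space_axioms, of Y] by simp
  also have "\<dots> \<le> ln (partition_function \<beta> n)"
    unfolding partition_function_def
    by (rule gibbs_inequality[OF prob_space_axioms simpleY finite_patterns])
      (simp add: Y_def overwrite_in_patterns[OF occ_sub restrict_in_patterns])
  finally show "0 * real n ^ CARD('d) + \<beta> * (\<integral>x. energy (cube n) (?x x) \<partial>\<mu>)
      + real (card (grid r n :: ('d \<Rightarrow> int) set))
        * (\<beta> * \<delta> * measure \<mu> {x. \<forall>h\<in>box r. x h = u h}) \<le> ln (partition_function \<beta> n)"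
    by (simp add: G_def U_def algebra_simps del: restrict_apply)
next
  show "0 \<le> \<beta> * \<delta> * measure \<mu> {x. \<forall>h\<in>box r. x h = u h}" using assms(2,3) by simp
qed

section \<open>Equilibrium states and the exclusion of freezing\<close>

lemma ES_iff:
  "\<mu> \<in> ES \<beta> \<phi> \<longleftrightarrow> invariant_measure \<mu> \<and> (\<forall>\<nu>. invariant_measure \<nu> \<longrightarrow>
    ks_entropy \<nu> + \<beta> * (\<integral>x. \<phi> x \<partial>\<nu>) \<le> ks_entropy \<mu> + \<beta> * (\<integral>x. \<phi> x \<partial>\<mu>))"
  by (auto simp: ES_def invariant_measures_iff)

text \<open>The measure from \<open>exists_measure_ge_pressure\<close> is one of the competitors
  that an equilibrium state must match.\<close>

lemma ES_pressure_le:
  assumes "\<mu> \<in> ES \<beta> \<phi>"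
    and "\<And>e. e > 0 \<Longrightarrow> \<forall>\<^sub>F n in sequentially. c - e \<le> ln (partition_function \<beta> n) / real n ^ CARD('d)"
  shows "c \<le> ks_entropy \<mu> + \<beta> * (\<integral>x. \<phi> x \<partial>\<mu>)"
  using exists_measure_ge_pressure[of \<beta>] assms unfolding ES_iff by (meson order_trans)

text \<open>The measure from \<open>exists_measure_ge_pressure\<close> is itself an equilibrium
  state, since the free energy of every invariant measure is an asymptotic lower bound.\<close>

lemma ES_nonempty: "\<beta> > 0 \<Longrightarrow> ES \<beta> \<phi> \<noteq> {}"
  using exists_measure_ge_pressure[of \<beta>] pressure_ge_free_energy[of _ \<beta>]
  unfolding ES_iff ex_in_conv[symmetric] by meson

text \<open>For a missing pattern the single value \<open>\<beta>0\<close> is contradictory.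
  Otherwise the unbounded range of \<beta> is used: \<open>\<beta> * R\<close> would stay below the
  fixed number \<open>ks_entropy \<mu>\<close>.\<close>

lemma not_ES_for_all_large_beta:
  assumes inv: "invariant_measure \<mu>1" "invariant_measure \<mu>2"
    "(\<integral>x. \<phi> x \<partial>\<mu>1) < (\<integral>x. \<phi> x \<partial>\<mu>2)"
  shows "\<exists>\<beta>>b. \<mu> \<notin> ES \<beta> \<phi>"
proof (rule ccontr)
  assume "\<not> ?thesis"
  then have ES: "\<mu> \<in> ES \<beta> \<phi>" if "\<beta> > b" for \<beta> using that by auto
  have mu: "invariant_measure \<mu>" using ES[of "b + 1"] by (simp add: ES_iff)
  from homoclinic_gain[OF inv] obtain m u v \<delta> where d: "\<delta> > 0"
    and uv: "\<forall>h. h \<notin> cube m \<longrightarrow> u h = v h"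
    and g: "\<forall>W. finite W \<longrightarrow> cube m \<subseteq> W \<longrightarrow> energy W u + \<delta> \<le> energy W v"
    by (elim exE conjE) (rule that)
  have "\<exists>r. (cube m :: ('d \<Rightarrow> int) set) \<subseteq> box r \<and> (\<forall>W z z'. finite W \<longrightarrow> box r \<subseteq> W \<longrightarrow>
      (\<forall>h\<in>box r. z h = u h \<and> z' h = v h) \<longrightarrow> (\<forall>h. h \<notin> box r \<longrightarrow> z h = z' h) \<longrightarrow>
      energy W z + \<delta> / 2 \<le> energy W z')"
    by (rule robust_gain[OF d finite_hcube]) (use uv g in simp_all)
  then obtain r where "\<forall>W z z'. finite W \<longrightarrow> box r \<subseteq> W \<longrightarrow> (\<forall>h\<in>box r. z h = u h \<and> z' h = v h) \<longrightarrow>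
      (\<forall>h. h \<notin> box r \<longrightarrow> z h = z' h) \<longrightarrow> energy W z + \<delta> / 2 \<le> energy W z'"
    by (elim exE conjE) (rule that)
  then have gain: "finite W \<Longrightarrow> box r \<subseteq> W \<Longrightarrow> (\<forall>h\<in>box r. z h = u h \<and> z' h = v h) \<Longrightarrow>
      (\<forall>h. h \<notin> box r \<longrightarrow> z h = z' h) \<Longrightarrow> energy W z + \<delta> / 2 \<le> energy W z'" for W z z'
    by simp
  define \<theta> where "\<theta> = measure \<mu> {x. \<forall>h\<in>box r. x h = u h}"
  define \<beta>0 where "\<beta>0 = max b 0 + 1"
  have b0: "\<beta>0 > 0" "\<beta>0 > b" by (auto simp: \<beta>0_def)
  show False
  proof (cases "\<theta> = 0")
    case True
    then obtain \<kappa> where k: "\<kappa> > 0" "\<forall>e>0. \<forall>\<^sub>F n in sequentially.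
        ks_entropy \<mu> + \<beta>0 * (\<integral>x. \<phi> x \<partial>\<mu>) + \<kappa> - e \<le> ln (partition_function \<beta>0 n) / real n ^ CARD('d)"
      using pressure_gt_of_missing_pattern[OF mu b0(1), of r u] unfolding \<theta>_def by blast
    then show False using ES_pressure_le[OF ES[OF b0(2)]] by fastforce
  next
    case False
    then have t: "\<theta> > 0" unfolding \<theta>_def by (simp add: less_le)
    define R where "R = (1 / (2 * real (2 * r + 1))) ^ CARD('d) * (\<delta> / 2 * \<theta>)"
    have R: "R > 0" using t d by (simp add: R_def)
    have "\<beta> * R \<le> ks_entropy \<mu>" if b: "\<beta> > b" "\<beta> > 0" for \<beta>
    proof -
      have d2: "\<delta> / 2 > 0" using d by simp
      have "\<forall>\<^sub>F n in sequentially. \<beta> * (\<integral>x. \<phi> x \<partial>\<mu>) + \<beta> * R - e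
          \<le> ln (partition_function \<beta> n) / real n ^ CARD('d)" if "e > 0" for e
      proof -
        have eq: "0 + \<beta> * (\<integral>x. \<phi> x \<partial>\<mu>) + (1 / (2 * real (2 * r + 1))) ^ CARD('d) * (\<beta> * (\<delta> / 2) * \<theta>) - e
            = \<beta> * (\<integral>x. \<phi> x \<partial>\<mu>) + \<beta> * R - e"
          by (simp add: R_def)
        show ?thesis
          unfolding eq[symmetric] \<theta>_def
          by (rule pressure_ge_of_improvable_pattern[OF mu b(2) d2 _ that], rule gain)
      qed
      from ES_pressure_le[OF ES[OF b(1)] this] show ?thesis by simp
    qed
    \<comment> \<open>With this parameter the inequality forces
      \<open>ks_entropy \<mu> + 1 \<le> ks_entropy \<mu>\<close>; the maximum with
      \<open>\<beta>0\<close> keeps it in the admissible range.\<close>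
    from this[of "max \<beta>0 ((ks_entropy \<mu> + 1) / R)"] b0
    have "max \<beta>0 ((ks_entropy \<mu> + 1) / R) * R \<le> ks_entropy \<mu>" by auto
    moreover have "(ks_entropy \<mu> + 1) / R * R \<le> max \<beta>0 ((ks_entropy \<mu> + 1) / R) * R"
      using R by (intro mult_right_mono) auto
    ultimately show False using R by simp
  qed
qed

end

theorem theoremB:
  fixes \<phi> :: "(('d::finite \<Rightarrow> int) \<Rightarrow> 'a::finite) \<Rightarrow> real"
  assumes "continuous_map shift_topology euclideanreal \<phi>"
    and "summable (\<lambda>n. real (Suc n) ^ (CARD('d) - 1) * var (Suc n) \<phi>)"
  shows "\<not> (\<exists>\<beta>c. freezing_transition \<phi> \<beta>c)"
proof
  interpret summable_potential \<phi> using assms by unfold_locales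
  assume "\<exists>\<beta>c. freezing_transition \<phi> \<beta>c"
  then obtain \<beta>c where same: "\<And>\<beta> \<beta>'. \<beta> > \<beta>c \<Longrightarrow> \<beta>' > \<beta>c \<Longrightarrow> ES \<beta> \<phi> = ES \<beta>' \<phi>"
    and differ: "\<And>\<beta> \<beta>'. \<beta> < \<beta>c \<Longrightarrow> \<beta>c < \<beta>' \<Longrightarrow> ES \<beta> \<phi> \<noteq> ES \<beta>' \<phi>"
    unfolding freezing_transition_def by blast
  \<comment> \<open>Positive because \<open>ES_nonempty\<close> is available for positive
    parameters, while \<open>\<beta>c\<close> may be negative.\<close>
  define \<beta>0 where "\<beta>0 = max \<beta>c 0 + 1"
  have b0: "\<beta>0 > 0" "\<beta>0 > \<beta>c" by (auto simp: \<beta>0_def)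
  obtain \<mu> where mu: "\<mu> \<in> ES \<beta>0 \<phi>" using ES_nonempty[OF b0(1)] by blast
  show False
  proof (cases "\<exists>\<mu>1 \<mu>2. invariant_measure \<mu>1 \<and> invariant_measure \<mu>2 \<and>
      (\<integral>x. \<phi> x \<partial>\<mu>1) < (\<integral>x. \<phi> x \<partial>\<mu>2)")
    case True
    then obtain \<beta> where "\<beta> > \<beta>c" "\<mu> \<notin> ES \<beta> \<phi>" using not_ES_for_all_large_beta by blast
    then show False using same[OF b0(2), of \<beta>] mu by simp
  next
    case False
    then have eq: "(\<integral>x. \<phi> x \<partial>\<nu>) = (\<integral>x. \<phi> x \<partial>\<mu>)"
      if "invariant_measure \<nu>" "invariant_measure \<mu>" for \<nu> \<mu> using that by (meson linorder_neqE_linordered_idom)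
    have "ES \<beta> \<phi> = ES \<beta>' \<phi>" for \<beta> \<beta>'
    proof -
      \<comment> \<open>With equal integrals the energy cancels from every comparison, so each
        \<open>ES\<close> is the set of measures of maximal entropy, for negative parameters as
        well.\<close>
      have "\<nu> \<in> ES \<beta> \<phi> \<longleftrightarrow> invariant_measure \<nu> \<and> (\<forall>\<nu>' :: ('d, 'a) config measure.
          invariant_measure \<nu>' \<longrightarrow> ks_entropy \<nu>' \<le> ks_entropy \<nu>)" for \<nu> \<beta>
      proof (cases "invariant_measure \<nu>")
        case True
        then have "ks_entropy \<nu>' + \<beta> * (\<integral>x. \<phi> x \<partial>\<nu>') \<le> ks_entropy \<nu> + \<beta> * (\<integral>x. \<phi> x \<partial>\<nu>)
            \<longleftrightarrow> ks_entropy \<nu>' \<le> ks_entropy \<nu>" if "invariant_measure \<nu>'" for \<nu>'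
          by (simp add: eq[OF that True])
        then show ?thesis unfolding ES_iff by simp
      qed (simp add: ES_iff)
      then show ?thesis by blast
    qed
    then show False using differ[of "\<beta>c - 1" "\<beta>c + 1"] by simp
  qed
qed

end
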